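(* Let $\kappa$ be a small regular cardinal, let $\mathbb{T}=(S,\Sigma,\mathbb{T})$ be a $\kappa$-ary partial Horn theory, and let $\Lambda$ be a scale over $\Sigma$. Suppose that we are given a $\Lambda$-gauge for $\mathbb{T}$ and that there is a small ordinal $\gamma$ satisfying $\sharp\tau<\gamma$ for every raw term $\tau$ over $\Sigma$. Then $\delta_{\mathbf{Reg}(\mathbf{\Lambda})}(f)\le\gamma$ for every morphism $f$ in $\mathbf{PMod}\,\mathbb{T}$; therefore $\delta_{\mathbf{Reg}(\mathbf{\Lambda})}(\mathbf{PMod}\,\mathbb{T})\le\gamma+1$ also holds.
   Context: Partial Horn theories. Let $S$ be a small set of sorts. A $\kappa$-ary $S$-sorted signature $\Sigma$ consists of small sets of function symbols $f\colon\sqcap_{i<\alpha}s_i\to s$ and relation symbols $R\colon\sqcap_{i<\alpha}s_i$ with $s_i,s\in S$, $\alpha<\kappa$. Each sort has $\kappa$ many variables (disjoint for distinct sorts). Raw terms: variables, and $f(\tau_i)_{i<\alpha}$ for raw terms $\tau_i$ of sort $s_i$. Raw Horn formulas: $R(\tau_i)_{i<\alpha}$, $\tau=\tau'$ (same sort), $\top$, and conjunctions of fewer than $\kappa$ raw Horn formulas. A context $\vec{x}$ is a tuple of fewer than $\kappa$ distinct (sorted) variables. A term $\vec{x}.\tau$ (Horn formula $\vec{x}.\phi$) is a raw term (raw Horn formula) all of whose variables occur in the context $\vec{x}$. A Horn sequent $\phi\vdash_{\vec{x}}\psi$ is a pair of Horn formulas in the same context; $\phi\dashv\vdash_{\vec{x}}\psi$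 means both directions; $\tau\!\downarrow$ abbreviates $\tau=\tau$. A $\kappa$-ary partial Horn theory $\mathbb{T}$ over $\Sigma$ is a set of Horn sequents. A partial $\Sigma$-structure $M$ has sets $M_s$ ($s\in S$), partial maps $[\![f]\!]_M\colon\prod_i M_{s_i}\rightharpoonup M_s$ and subsets $[\![R]\!]_M\subseteq\prod_iM_{s_i}$. Terms are interpreted as partial maps ($f(\tau_i)_i$ is defined at $\vec m$ iff all $\tau_i$ are and $f$ is defined at the resulting tuple) and Horn formulas as subsets $[\![\vec{x}.\phi]\!]_M$ ($R(\tau_i)$ holds iff all $\tau_i$ are defined and the tuple lies in $[\![R]\!]_M$; $\tau=\tau'$ holds iff both are defined and equal; $\top$ and conjunction as usual). A sequent is valid in $M$ if $[\![\vec{x}.\phi]\!]_M\subseteq[\![\vec{x}.\psi]\!]_M$. A $\mathbb{T}$-model is a structure in which all sequents of $\mathbb{T}$ are valid. A sequent (possibly of larger arity than $\kappa$) is derivable from $\mathbb{T}$ if it is valid in every $\mathbb{T}$-model. Homomorphisms are families of total maps preserving definedness and values of function symbols, and relations. $\mathbf{PMod}\,\mathbb{T}$ is the category of $\mathbb{T}$-models and homomorphisms (it is locally $\kappa$-presentable). For a Horn formula $\vec{x}.\phi$, $\langle\vec{x}.\phi\rangle_{\mathbb{T}}$ denotes the $\mathbb{T}$-model representing the functor $M\mapsto[\![\vec{x}.\phi]\!]_M$, $\mathbf{PMod}\,\mathbb{T}\to\mathbf{Set}$. Scales. A scale over $\Sigma$ consists of a small set $\Lambda$ and, for each $\lambda\in\Lambda$,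 a finite context $\vec{z}^\lambda=(z^\lambda_1:s^\lambda_1,\dots,z^\lambda_{n^\lambda}:s^\lambda_{n^\lambda})$ and a Horn formula $\vec{z}^\lambda.\zeta^\lambda$ over $\Sigma$. It determines the small set $\mathbf{\Lambda}$ of epimorphisms $\langle\vec{z}^\lambda.\top\rangle_{\mathbb{T}}\to\langle\vec{z}^\lambda.\zeta^\lambda\rangle_{\mathbb{T}}$ ($\lambda\in\Lambda$) in $\mathbf{PMod}\,\mathbb{T}$ corresponding by Yoneda to the natural inclusions $[\![\vec{z}^\lambda.\zeta^\lambda]\!]_M\subseteq[\![\vec{z}^\lambda.\top]\!]_M$. Gauges. The minimum context of a raw term $\tau$ is the set $\mathrm{fv}(\tau)$ of variables appearing in $\tau$, regarded as a context. A $\Lambda$-gauge for $\mathbb{T}$ consists of: for each raw term $\tau$ a small ordinal $\sharp\tau$ and a small set $T(\tau)$; for each $t\in T(\tau)$ an element $\lambda(t)\in\Lambda$ and raw terms $\vec\sigma^t=(\sigma^t_k)_{1\le k\le n^{\lambda(t)}}$ with $\sigma^t_k$ of sort $s^{\lambda(t)}_k$, in the minimum context of $\tau$; such that $\sharp\sigma^t_k<\sharp\tau$ for all $t\in T(\tau)$ and $1\le k\le n^{\lambda(t)}$, and for every raw term $\tau$, with minimum context $\vec{x}$, the following is derivable from $\mathbb{T}$: $$\tau\!\downarrow\ \dashv\vdash_{\vec{x}}\ \bigwedge_{t\in T(\tau)}\Bigl(\zeta^{\lambda(t)}[\vec\sigma^t/\vec z^{\lambda(t)}]\wedge\bigwedge_{1\le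 k\le n^{\lambda(t)}}\sigma^t_k\!\downarrow\Bigr).$$ Generalized regular epimorphisms. For a class $\mathbf{\Lambda}$ of epimorphisms in a category $\mathscr{C}$, a morphism $q\colon A\to B$ is $\mathbf{\Lambda}$-regularly epic if for each $f\colon A\to X$ satisfying the following condition there is a unique $k\colon B\to X$ with $f=kq$: whenever $e\colon\Gamma\to\Delta$ is in $\mathbf{\Lambda}$ and $u\colon\Gamma\to A$ is such that $qu$ factors through $e$, then $fu$ factors through $e$. $\mathbf{Reg}(\mathbf{\Lambda})$ is the class of $\mathbf{\Lambda}$-regular epimorphisms. Decomposition numbers. Small means belonging to a fixed universe $\mathcal{U}_1$; $\upsilon$ is the smallest ordinal not in $\mathcal{U}_1$. $p\perp m$ means that every commutative square $mu=vp$ has a unique $h$ with $hp=u$, $mh=v$; $\mathbf{E}\perp m$ means $p\perp m$ for all $p\in\mathbf{E}$. For a class $\mathbf{E}$ of morphisms in $\mathscr{C}$, an $\mathbf{E}$-predecomposition of $f\colon A\to X$ is a functor $A_\bullet$ from the poset of ordinals $<\upsilon$ to $\mathscr{C}$ with $A_0=A$, $A_\gamma\cong\mathrm{colim}_{\beta<\gamma}A_\beta$ for non-zero limit $\gamma$, and all $A_\beta\to A_{\beta+1}$ in $\mathbf{E}$, together with a cocone $(f_\alpha\colon A_\alpha\to X)_\alpha$ with $f_0=f$. It is an $\mathbf{E}$-decomposition if there is $\alpha<\upsilon$ with $\mathbf{E}\perp f_\beta$ for all $\beta\in[\alpha,\upsilon)$; the least such $\alpha$ is its length. $\delta_{\mathbf{E}}(f)$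 is the smallest length of an $\mathbf{E}$-decomposition of $f$ (defined if one exists). If $\delta_{\mathbf{E}}(f)$ is defined for all morphisms $f$ of $\mathscr{C}$, $\delta_{\mathbf{E}}(\mathscr{C})$ is the smallest ordinal $\alpha$ with $\delta_{\mathbf{E}}(f)<\alpha$ for all $f$.
   Formalization: If some formula of the scale has an empty context, 0<γ is assumed; and if γ is finite, ♯τ>0 is assumed for each raw term τ having a t∈T(τ) with n^{λ(t)}=0. Otherwise the claim fails: for c↓⊣⊢R, Λ={[].R, z.P(z)}, ♯=0, γ=1 one gets δ=2. *)

theory Defs
  imports Main "HOL-Library.FuncSet"
begin

unbundle cardinal_syntax

section \<open>The universe of small sets\<close>

text \<open>
  A well-ordered type \<open>'u\<close> whose order type is an uncountable strongly inaccessible cardinal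
  plays the role of the fixed universe: its elements are the small ordinals (with \<open>\<upsilon>\<close> being the
  order type of \<open>'u\<close> itself), and a set is small if its cardinality is below that of \<open>'u\<close>.
  Every small set is in bijection with a small subset of \<open>'u\<close>, so that carriers of structures
  are taken to be small subsets of \<open>'u\<close>.
\<close>

definition small :: "'u itself \<Rightarrow> 'a set \<Rightarrow> bool" where
  "small _ A \<longleftrightarrow> |A| <o |UNIV :: 'u set|"

definition ord_le :: "('u::wellorder) rel" where
  "ord_le = {(x, y). x \<le> y}"

definition universe :: "('u::wellorder) itself \<Rightarrow> bool" where
  "universe U \<longleftrightarrow>
     Card_order (ord_le :: 'u rel) \<and> regularCard (ord_le :: 'u rel) \<and>
     natLeq <o (ord_le :: 'u rel) \<and>
     (\<forall>A :: 'u set. small U A \<longrightarrow> small U (Pow A))"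

definition zero_ord :: "'u::wellorder" where
  "zero_ord = (LEAST x. True)"

definition suc_ord :: "'u::wellorder \<Rightarrow> 'u" where
  "suc_ord x = (LEAST y. x < y)"

definition limit_ord :: "'u::wellorder \<Rightarrow> bool" where
  "limit_ord x \<longleftrightarrow> x \<noteq> zero_ord \<and> (\<forall>y<x. suc_ord y < x)"

definition nat_ord :: "nat \<Rightarrow> 'u::wellorder" where
  "nat_ord n = (suc_ord ^^ n) zero_ord"

definition small_regular_cardinal :: "'u::wellorder \<Rightarrow> bool" where
  "small_regular_cardinal \<kappa> \<longleftrightarrow>
     (let r = {(x, y). x \<le> y \<and> y < \<kappa>} in Card_order r \<and> cinfinite r \<and> regularCard r)"


section \<open>Partial Horn theories\<close>

text \<open>
  The arguments of a symbol of arity \<open>\<alpha>\<close> form a family indexed by the ordinals \<open>i < \<alpha>\<close>. In the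
  syntax, such a family is a partial map with domain \<open>{..<\<alpha>}\<close>. The variables of sort
  \<open>s\<close> are the pairs \<open>(s, i)\<close> with \<open>i < \<kappa>\<close>. The set functions \<open>fv\<close> and \<open>fvs\<close> generated by
  the datatype package give the variables that appear in a raw term or raw formula.
\<close>

record ('s, 'f, 'r, 'u) signature =
  sorts :: "'s set"
  funs :: "'f set"
  rels :: "'r set"
  far :: "'f \<Rightarrow> 'u"
  fdom :: "'f \<Rightarrow> 'u \<Rightarrow> 's"
  fcod :: "'f \<Rightarrow> 's"
  rar :: "'r \<Rightarrow> 'u"
  rdom :: "'r \<Rightarrow> 'u \<Rightarrow> 's"

definition is_signature :: "'u::wellorder \<Rightarrow> ('s, 'f, 'r, 'u) signature \<Rightarrow> bool" where
  "is_signature \<kappa> Sg \<longleftrightarrow>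
     small TYPE('u) (sorts Sg) \<and> small TYPE('u) (funs Sg) \<and> small TYPE('u) (rels Sg) \<and>
     (\<forall>f\<in>funs Sg. far Sg f < \<kappa> \<and> (\<forall>i<far Sg f. fdom Sg f i \<in> sorts Sg) \<and>
        fcod Sg f \<in> sorts Sg) \<and>
     (\<forall>R\<in>rels Sg. rar Sg R < \<kappa> \<and> (\<forall>i<rar Sg R. rdom Sg R i \<in> sorts Sg))"

datatype (fv: 'v, dead 'f, 'u) tm =
    Var 'v
  | App 'f "'u \<Rightarrow> ('v, 'f, 'u) tm option"

text \<open>
  \<open>Conj\<close> takes a family of formulas indexed by a subset of \<open>'u\<close>. Its size is
  restricted to be less than \<open>\<kappa>\<close> only in the predicate \<open>raw_formula\<close> below, because sequents of larger
  arity also have to be considered.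
\<close>

datatype (fvs: 'v, dead 'f, dead 'r, 'u) fm =
    Rel 'r "'u \<Rightarrow> ('v, 'f, 'u) tm option"
  | Eq "('v, 'f, 'u) tm" "('v, 'f, 'u) tm"
  | Top
  | Conj "'u \<Rightarrow> ('v, 'f, 'r, 'u) fm option"

type_synonym ('s, 'f, 'u) sterm = "('s \<times> 'u, 'f, 'u) tm"
type_synonym ('s, 'f, 'r, 'u) sformula = "('s \<times> 'u, 'f, 'r, 'u) fm"

inductive has_sort ::
    "'u::wellorder \<Rightarrow> ('s, 'f, 'r, 'u) signature \<Rightarrow> ('s, 'f, 'u) sterm \<Rightarrow> 's \<Rightarrow> bool"
  for \<kappa> Sg where
  "s \<in> sorts Sg \<Longrightarrow> i < \<kappa> \<Longrightarrow> has_sort \<kappa> Sg (Var (s, i)) s"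
| "f \<in> funs Sg \<Longrightarrow> dom ts = {..<far Sg f} \<Longrightarrow>
   (\<And>i. i < far Sg f \<Longrightarrow> has_sort \<kappa> Sg (the (ts i)) (fdom Sg f i)) \<Longrightarrow>
   has_sort \<kappa> Sg (App f ts) (fcod Sg f)"

definition raw_term ::
    "'u::wellorder \<Rightarrow> ('s, 'f, 'r, 'u) signature \<Rightarrow> ('s, 'f, 'u) sterm \<Rightarrow> bool" where
  "raw_term \<kappa> Sg \<tau> \<longleftrightarrow> (\<exists>s. has_sort \<kappa> Sg \<tau> s)"

inductive raw_formula ::
    "'u::wellorder \<Rightarrow> ('s, 'f, 'r, 'u) signature \<Rightarrow> ('s, 'f, 'r, 'u) sformula \<Rightarrow> bool"
  for \<kappa> Sg where
  "R \<in> rels Sg \<Longrightarrow> dom ts = {..<rar Sg R} \<Longrightarrow>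
   (\<And>i. i < rar Sg R \<Longrightarrow> has_sort \<kappa> Sg (the (ts i)) (rdom Sg R i)) \<Longrightarrow>
   raw_formula \<kappa> Sg (Rel R ts)"
| "has_sort \<kappa> Sg \<tau> s \<Longrightarrow> has_sort \<kappa> Sg \<tau>' s \<Longrightarrow> raw_formula \<kappa> Sg (Eq \<tau> \<tau>')"
| "raw_formula \<kappa> Sg Top"
| "|dom \<phi>s| <o |{..<\<kappa>}| \<Longrightarrow> (\<And>i. i \<in> dom \<phi>s \<Longrightarrow> raw_formula \<kappa> Sg (the (\<phi>s i))) \<Longrightarrow>
   raw_formula \<kappa> Sg (Conj \<phi>s)"

text \<open>A context is given by its set of variables.\<close>

definition is_context ::
    "'u::wellorder \<Rightarrow> ('s, 'f, 'r, 'u) signature \<Rightarrow> ('s \<times> 'u) set \<Rightarrow> bool" where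
  "is_context \<kappa> Sg X \<longleftrightarrow> X \<subseteq> sorts Sg \<times> {..<\<kappa>} \<and> |X| <o |{..<\<kappa>}|"

definition horn_formula ::
    "'u::wellorder \<Rightarrow> ('s, 'f, 'r, 'u) signature \<Rightarrow> ('s \<times> 'u) set \<Rightarrow>
     ('s, 'f, 'r, 'u) sformula \<Rightarrow> bool" where
  "horn_formula \<kappa> Sg X \<phi> \<longleftrightarrow> is_context \<kappa> Sg X \<and> raw_formula \<kappa> Sg \<phi> \<and> fvs \<phi> \<subseteq> X"

text \<open>\<open>(X, \<phi>, \<psi>)\<close> stands for the sequent of \<open>\<phi>\<close> and \<open>\<psi>\<close> in the context \<open>X\<close>.\<close>

type_synonym ('s, 'f, 'r, 'u) sequent =
  "('s \<times> 'u) set \<times> ('s, 'f, 'r, 'u) sformula \<times> ('s, 'f, 'r, 'u) sformula"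

definition horn_theory ::
    "'u::wellorder \<Rightarrow> ('s, 'f, 'r, 'u) signature \<Rightarrow> ('s, 'f, 'r, 'u) sequent set \<Rightarrow> bool" where
  "horn_theory \<kappa> Sg T \<longleftrightarrow>
     (\<forall>(X, \<phi>, \<psi>)\<in>T. horn_formula \<kappa> Sg X \<phi> \<and> horn_formula \<kappa> Sg X \<psi>)"

abbreviation Defined :: "('v, 'f, 'u) tm \<Rightarrow> ('v, 'f, 'r, 'u) fm" where
  "Defined \<tau> \<equiv> Eq \<tau> \<tau>"

definition Conj_list :: "('v, 'f, 'r, 'u::wellorder) fm list \<Rightarrow> ('v, 'f, 'r, 'u) fm" where
  "Conj_list \<phi>s = Conj (map_of (zip (map nat_ord [0..<length \<phi>s]) \<phi>s))"

primrec subst_tm :: "('v \<Rightarrow> ('w, 'f, 'u) tm) \<Rightarrow> ('v, 'f, 'u) tm \<Rightarrow> ('w, 'f, 'u) tm" where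
  "subst_tm \<theta> (Var v) = \<theta> v"
| "subst_tm \<theta> (App f ts) = App f (\<lambda>i. map_option (subst_tm \<theta>) (ts i))"

primrec subst_fm :: "('v \<Rightarrow> ('w, 'f, 'u) tm) \<Rightarrow> ('v, 'f, 'r, 'u) fm \<Rightarrow> ('w, 'f, 'r, 'u) fm" where
  "subst_fm \<theta> (Rel R ts) = Rel R (\<lambda>i. map_option (subst_tm \<theta>) (ts i))"
| "subst_fm \<theta> (Eq \<tau> \<tau>') = Eq (subst_tm \<theta> \<tau>) (subst_tm \<theta> \<tau>')"
| "subst_fm \<theta> Top = Top"
| "subst_fm \<theta> (Conj \<phi>s) = Conj (\<lambda>i. map_option (subst_fm \<theta>) (\<phi>s i))"

definition subst_list :: "'v list \<Rightarrow> ('v, 'f, 'u) tm list \<Rightarrow> 'v \<Rightarrow> ('v, 'f, 'u) tm" where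
  "subst_list zs \<sigma>s v = (case map_of (zip zs \<sigma>s) v of None \<Rightarrow> Var v | Some \<sigma> \<Rightarrow> \<sigma>)"


section \<open>Partial structures and models\<close>

text \<open>
  Argument tuples of structures are extensional functions on \<open>{..<\<alpha>}\<close>. Structures are
  trivial outside their signature, and homomorphisms are extensional, so that
  equality of these objects is the intended one.
\<close>

record ('s, 'f, 'r, 'u) struct =
  car :: "'s \<Rightarrow> 'u set"
  fint :: "'f \<Rightarrow> ('u \<Rightarrow> 'u) \<Rightarrow> 'u option"
  rint :: "'r \<Rightarrow> ('u \<Rightarrow> 'u) set"

definition tuples :: "('s, 'f, 'r, 'u) struct \<Rightarrow> ('u::wellorder) \<Rightarrow> ('u \<Rightarrow> 's) \<Rightarrow> ('u \<Rightarrow> 'u) set" where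
  "tuples M \<alpha> ss = (\<Pi>\<^sub>E i\<in>{..<\<alpha>}. car M (ss i))"

definition partial_structure ::
    "('s, 'f, 'r, 'u::wellorder) signature \<Rightarrow> ('s, 'f, 'r, 'u) struct \<Rightarrow> bool" where
  "partial_structure Sg M \<longleftrightarrow>
     (\<forall>s\<in>sorts Sg. small TYPE('u) (car M s)) \<and>
     (\<forall>f\<in>funs Sg. dom (fint M f) \<subseteq> tuples M (far Sg f) (fdom Sg f) \<and>
        ran (fint M f) \<subseteq> car M (fcod Sg f)) \<and>
     (\<forall>R\<in>rels Sg. rint M R \<subseteq> tuples M (rar Sg R) (rdom Sg R)) \<and>
     (\<forall>s. s \<notin> sorts Sg \<longrightarrow> car M s = {}) \<and>
     (\<forall>f. f \<notin> funs Sg \<longrightarrow> fint M f = Map.empty) \<and>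
     (\<forall>R. R \<notin> rels Sg \<longrightarrow> rint M R = {})"

text \<open>
  \<open>collect vs\<close> is undefined if some member of the family \<open>vs\<close> has an undefined value, and
  is otherwise the tuple of these values.
\<close>

definition collect :: "('u \<Rightarrow> 'a option option) \<Rightarrow> ('u \<Rightarrow> 'a) option" where
  "collect vs =
     (if \<exists>i. vs i = Some None then None else Some (\<lambda>i\<in>dom vs. the (the (vs i))))"

primrec eval ::
    "('s, 'f, 'r, 'u) struct \<Rightarrow> ('v \<Rightarrow> 'u) \<Rightarrow> ('v, 'f, 'u) tm \<Rightarrow> 'u option" where
  "eval M m (Var v) = Some (m v)"
| "eval M m (App f ts) =
     Option.bind (collect (\<lambda>i. map_option (eval M m) (ts i))) (fint M f)"

primrec sat ::
    "('s, 'f, 'r, 'u) struct \<Rightarrow> ('v \<Rightarrow> 'u) \<Rightarrow> ('v, 'f, 'r, 'u) fm \<Rightarrow> bool" where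
  "sat M m (Rel R ts) \<longleftrightarrow>
     (\<exists>x. collect (\<lambda>i. map_option (eval M m) (ts i)) = Some x \<and> x \<in> rint M R)"
| "sat M m (Eq \<tau> \<tau>') \<longleftrightarrow> (\<exists>x. eval M m \<tau> = Some x \<and> eval M m \<tau>' = Some x)"
| "sat M m Top \<longleftrightarrow> True"
| "sat M m (Conj \<phi>s) \<longleftrightarrow> (\<forall>i. map_option (sat M m) (\<phi>s i) \<noteq> Some False)"

definition interp ::
    "('s, 'f, 'r, 'u) struct \<Rightarrow> ('s \<times> 'u) set \<Rightarrow> ('s, 'f, 'r, 'u) sformula \<Rightarrow>
     ('s \<times> 'u \<Rightarrow> 'u) set" where
  "interp M X \<phi> = {m \<in> \<Pi>\<^sub>E v\<in>X. car M (fst v). sat M m \<phi>}"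

fun valid :: "('s, 'f, 'r, 'u) struct \<Rightarrow> ('s, 'f, 'r, 'u) sequent \<Rightarrow> bool" where
  "valid M (X, \<phi>, \<psi>) \<longleftrightarrow> interp M X \<phi> \<subseteq> interp M X \<psi>"

definition models ::
    "('s, 'f, 'r, 'u::wellorder) signature \<Rightarrow> ('s, 'f, 'r, 'u) sequent set \<Rightarrow>
     ('s, 'f, 'r, 'u) struct set" where
  "models Sg T = {M. partial_structure Sg M \<and> (\<forall>\<sigma>\<in>T. valid M \<sigma>)}"

definition derivable ::
    "('s, 'f, 'r, 'u::wellorder) signature \<Rightarrow> ('s, 'f, 'r, 'u) sequent set \<Rightarrow>
     ('s, 'f, 'r, 'u) sequent \<Rightarrow> bool" where
  "derivable Sg T \<sigma> \<longleftrightarrow> (\<forall>M\<in>models Sg T. valid M \<sigma>)"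

definition homs ::
    "('s, 'f, 'r, 'u::wellorder) signature \<Rightarrow> ('s, 'f, 'r, 'u) struct \<Rightarrow>
     ('s, 'f, 'r, 'u) struct \<Rightarrow> ('s \<Rightarrow> 'u \<Rightarrow> 'u) set" where
  "homs Sg M N = {h.
     (\<forall>s. h s \<in> car M s \<rightarrow>\<^sub>E car N s) \<and>
     (\<forall>f\<in>funs Sg. \<forall>x\<in>tuples M (far Sg f) (fdom Sg f). \<forall>y. fint M f x = Some y \<longrightarrow>
        fint N f (\<lambda>i\<in>{..<far Sg f}. h (fdom Sg f i) (x i)) = Some (h (fcod Sg f) y)) \<and>
     (\<forall>R\<in>rels Sg. \<forall>x\<in>rint M R. (\<lambda>i\<in>{..<rar Sg R}. h (rdom Sg R i) (x i)) \<in> rint N R)}"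


section \<open>Categories\<close>

text \<open>\<open>Comp C g f\<close> is the composite of \<open>f\<close> followed by \<open>g\<close>.\<close>

record ('o, 'a) category =
  Ob :: "'o set"
  Ar :: "'a set"
  Dom :: "'a \<Rightarrow> 'o"
  Cod :: "'a \<Rightarrow> 'o"
  Id :: "'o \<Rightarrow> 'a"
  Comp :: "'a \<Rightarrow> 'a \<Rightarrow> 'a"

definition hom :: "('o, 'a) category \<Rightarrow> 'o \<Rightarrow> 'o \<Rightarrow> 'a set" where
  "hom C A B = {f \<in> Ar C. Dom C f = A \<and> Cod C f = B}"

text \<open>\<open>factors_through C h e\<close> says that \<open>h = w e\<close> for some \<open>w\<close>.\<close>

definition factors_through :: "('o, 'a) category \<Rightarrow> 'a \<Rightarrow> 'a \<Rightarrow> bool" where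
  "factors_through C h e \<longleftrightarrow> (\<exists>w\<in>hom C (Cod C e) (Cod C h). Comp C w e = h)"

definition Reg :: "('o, 'a) category \<Rightarrow> 'a set \<Rightarrow> 'a set" where
  "Reg C L = {q \<in> Ar C. \<forall>f\<in>Ar C. Dom C f = Dom C q \<longrightarrow>
     (\<forall>e\<in>L. \<forall>u\<in>hom C (Dom C e) (Dom C q).
        factors_through C (Comp C q u) e \<longrightarrow> factors_through C (Comp C f u) e) \<longrightarrow>
     (\<exists>!k. k \<in> hom C (Cod C q) (Cod C f) \<and> Comp C k q = f)}"

definition orthogonal :: "('o, 'a) category \<Rightarrow> 'a \<Rightarrow> 'a \<Rightarrow> bool" where
  "orthogonal C p m \<longleftrightarrow>
     (\<forall>u\<in>hom C (Dom C p) (Dom C m). \<forall>v\<in>hom C (Cod C p) (Cod C m).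
        Comp C m u = Comp C v p \<longrightarrow>
        (\<exists>!h. h \<in> hom C (Cod C p) (Dom C m) \<and> Comp C h p = u \<and> Comp C m h = v))"

text \<open>
  A functor from the poset of small ordinals is given by its values \<open>A \<alpha>\<close> on objects and
  \<open>a \<alpha> \<beta> : A \<alpha> \<rightarrow> A \<beta>\<close> for \<open>\<alpha> \<le> \<beta>\<close>.
\<close>

definition ordinal_functor ::
    "('o, 'a) category \<Rightarrow> ('u::wellorder \<Rightarrow> 'o) \<Rightarrow> ('u \<Rightarrow> 'u \<Rightarrow> 'a) \<Rightarrow> bool" where
  "ordinal_functor C A a \<longleftrightarrow>
     (\<forall>\<alpha>. A \<alpha> \<in> Ob C) \<and>
     (\<forall>\<alpha> \<beta>. \<alpha> \<le> \<beta> \<longrightarrow> a \<alpha> \<beta> \<in> hom C (A \<alpha>) (A \<beta>)) \<and>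
     (\<forall>\<alpha>. a \<alpha> \<alpha> = Id C (A \<alpha>)) \<and>
     (\<forall>\<alpha> \<beta> \<gamma>. \<alpha> \<le> \<beta> \<longrightarrow> \<beta> \<le> \<gamma> \<longrightarrow> Comp C (a \<beta> \<gamma>) (a \<alpha> \<beta>) = a \<alpha> \<gamma>)"

definition colimit_at ::
    "('o, 'a) category \<Rightarrow> ('u::wellorder \<Rightarrow> 'o) \<Rightarrow> ('u \<Rightarrow> 'u \<Rightarrow> 'a) \<Rightarrow> 'u \<Rightarrow> bool" where
  "colimit_at C A a \<gamma> \<longleftrightarrow>
     (\<forall>X\<in>Ob C. \<forall>g. (\<forall>\<beta><\<gamma>. g \<beta> \<in> hom C (A \<beta>) X) \<and>
        (\<forall>\<alpha> \<beta>. \<alpha> \<le> \<beta> \<longrightarrow> \<beta> < \<gamma> \<longrightarrow> Comp C (g \<beta>) (a \<alpha> \<beta>) = g \<alpha>) \<longrightarrow>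
        (\<exists>!k. k \<in> hom C (A \<gamma>) X \<and> (\<forall>\<beta><\<gamma>. Comp C k (a \<beta> \<gamma>) = g \<beta>)))"

definition predecomposition ::
    "('o, 'a) category \<Rightarrow> 'a set \<Rightarrow> 'a \<Rightarrow>
     ('u::wellorder \<Rightarrow> 'o) \<Rightarrow> ('u \<Rightarrow> 'u \<Rightarrow> 'a) \<Rightarrow> ('u \<Rightarrow> 'a) \<Rightarrow> bool" where
  "predecomposition C E f A a p \<longleftrightarrow>
     ordinal_functor C A a \<and>
     A zero_ord = Dom C f \<and>
     (\<forall>\<gamma>. limit_ord \<gamma> \<longrightarrow> colimit_at C A a \<gamma>) \<and>
     (\<forall>\<beta>. a \<beta> (suc_ord \<beta>) \<in> E) \<and>
     (\<forall>\<alpha>. p \<alpha> \<in> hom C (A \<alpha>) (Cod C f)) \<and>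
     (\<forall>\<alpha> \<beta>. \<alpha> \<le> \<beta> \<longrightarrow> Comp C (p \<beta>) (a \<alpha> \<beta>) = p \<alpha>) \<and>
     p zero_ord = f"

definition decomposition ::
    "('o, 'a) category \<Rightarrow> 'a set \<Rightarrow> 'a \<Rightarrow>
     ('u::wellorder \<Rightarrow> 'o) \<Rightarrow> ('u \<Rightarrow> 'u \<Rightarrow> 'a) \<Rightarrow> ('u \<Rightarrow> 'a) \<Rightarrow> bool" where
  "decomposition C E f A a p \<longleftrightarrow>
     predecomposition C E f A a p \<and> (\<exists>\<alpha>. \<forall>\<beta>\<ge>\<alpha>. \<forall>e\<in>E. orthogonal C e (p \<beta>))"

definition decomposition_length ::
    "('o, 'a) category \<Rightarrow> 'a set \<Rightarrow> ('u::wellorder \<Rightarrow> 'a) \<Rightarrow> 'u" where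
  "decomposition_length C E p = (LEAST \<alpha>. \<forall>\<beta>\<ge>\<alpha>. \<forall>e\<in>E. orthogonal C e (p \<beta>))"

text \<open>
  The decomposition numbers are partially defined, and are therefore introduced as relations:
  \<open>delta_eq C E f d\<close> says that the decomposition number of \<open>f\<close> is defined and equal to
  \<open>d\<close>, and \<open>Delta_eq C E d\<close> says that the decomposition number of \<open>C\<close> is defined, small, and equal
  to \<open>d\<close>.
\<close>

definition delta_eq :: "('o, 'a) category \<Rightarrow> 'a set \<Rightarrow> 'a \<Rightarrow> 'u::wellorder \<Rightarrow> bool" where
  "delta_eq C E f d \<longleftrightarrow>
     (let lengths = {decomposition_length C E p | A a (p :: 'u \<Rightarrow> 'a). decomposition C E f A a p}
      in d \<in> lengths \<and> (\<forall>l\<in>lengths. d \<le> l))"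

definition Delta_eq :: "('o, 'a) category \<Rightarrow> 'a set \<Rightarrow> 'u::wellorder \<Rightarrow> bool" where
  "Delta_eq C E d \<longleftrightarrow>
     (let bound = (\<lambda>b :: 'u. \<forall>f\<in>Ar C. \<exists>l. delta_eq C E f l \<and> l < b)
      in bound d \<and> (\<forall>b. bound b \<longrightarrow> d \<le> b))"


section \<open>The category of models\<close>

type_synonym ('s, 'f, 'r, 'u) model_arrow =
  "('s, 'f, 'r, 'u) struct \<times> ('s \<Rightarrow> 'u \<Rightarrow> 'u) \<times> ('s, 'f, 'r, 'u) struct"

definition PMod ::
    "('s, 'f, 'r, 'u::wellorder) signature \<Rightarrow> ('s, 'f, 'r, 'u) sequent set \<Rightarrow>
     (('s, 'f, 'r, 'u) struct, ('s, 'f, 'r, 'u) model_arrow) category" where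
  "PMod Sg T =
     \<lparr>Ob = models Sg T,
      Ar = {(M, h, N). M \<in> models Sg T \<and> N \<in> models Sg T \<and> h \<in> homs Sg M N},
      Dom = (\<lambda>(M, h, N). M),
      Cod = (\<lambda>(M, h, N). N),
      Id = (\<lambda>M. (M, \<lambda>s. \<lambda>x\<in>car M s. x, M)),
      Comp = (\<lambda>(N, g, P) (M, h, N'). (M, \<lambda>s. compose (car M s) (g s) (h s), P))\<rparr>"

definition map_val ::
    "('s \<times> 'u) set \<Rightarrow> ('s \<Rightarrow> 'u \<Rightarrow> 'u) \<Rightarrow> ('s \<times> 'u \<Rightarrow> 'u) \<Rightarrow> ('s \<times> 'u \<Rightarrow> 'u)" where
  "map_val X h m = (\<lambda>v\<in>X. h (fst v) (m v))"

text \<open>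
  A representation of the functor sending \<open>M\<close> to \<open>interp M X \<phi>\<close> is a model together with a
  universal element.
\<close>

definition represents ::
    "('s, 'f, 'r, 'u::wellorder) signature \<Rightarrow> ('s, 'f, 'r, 'u) sequent set \<Rightarrow>
     ('s \<times> 'u) set \<Rightarrow> ('s, 'f, 'r, 'u) sformula \<Rightarrow>
     ('s, 'f, 'r, 'u) struct \<Rightarrow> ('s \<times> 'u \<Rightarrow> 'u) \<Rightarrow> bool" where
  "represents Sg T X \<phi> A a \<longleftrightarrow>
     A \<in> models Sg T \<and> a \<in> interp A X \<phi> \<and>
     (\<forall>M\<in>models Sg T. \<forall>m\<in>interp M X \<phi>. \<exists>!h. h \<in> homs Sg A M \<and> map_val X h a = m)"

definition representation ::
    "('s, 'f, 'r, 'u::wellorder) signature \<Rightarrow> ('s, 'f, 'r, 'u) sequent set \<Rightarrow>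
     ('s \<times> 'u) set \<Rightarrow> ('s, 'f, 'r, 'u) sformula \<Rightarrow>
     ('s, 'f, 'r, 'u) struct \<times> ('s \<times> 'u \<Rightarrow> 'u)" where
  "representation Sg T X \<phi> = (SOME (A, a). represents Sg T X \<phi> A a)"


section \<open>Scales and gauges\<close>

record ('l, 's, 'f, 'r, 'u) scale =
  idx :: "'l set"
  sctx :: "'l \<Rightarrow> ('s \<times> 'u) list"
  sfm :: "'l \<Rightarrow> ('s, 'f, 'r, 'u) sformula"

definition is_scale ::
    "'u::wellorder \<Rightarrow> ('s, 'f, 'r, 'u) signature \<Rightarrow> ('l, 's, 'f, 'r, 'u) scale \<Rightarrow> bool" where
  "is_scale \<kappa> Sg L \<longleftrightarrow>
     small TYPE('u) (idx L) \<and>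
     (\<forall>l\<in>idx L. distinct (sctx L l) \<and> horn_formula \<kappa> Sg (set (sctx L l)) (sfm L l))"

text \<open>
  By Yoneda, the inclusion of \<open>interp M Z \<zeta>\<close> in \<open>interp M Z Top\<close>, natural in \<open>M\<close>,
  corresponds to the unique homomorphism that sends the universal element of \<open>interp _ Z Top\<close> to
  that of \<open>interp _ Z \<zeta>\<close>.
\<close>

definition inclusion_epi ::
    "('s, 'f, 'r, 'u::wellorder) signature \<Rightarrow> ('s, 'f, 'r, 'u) sequent set \<Rightarrow>
     ('s \<times> 'u) set \<Rightarrow> ('s, 'f, 'r, 'u) sformula \<Rightarrow> ('s, 'f, 'r, 'u) model_arrow" where
  "inclusion_epi Sg T Z \<zeta> =
     (let (A, a) = representation Sg T Z Top; (B, b) = representation Sg T Z \<zeta>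
      in (A, THE h. h \<in> homs Sg A B \<and> map_val Z h a = b, B))"

definition scale_epis ::
    "('s, 'f, 'r, 'u::wellorder) signature \<Rightarrow> ('s, 'f, 'r, 'u) sequent set \<Rightarrow>
     ('l, 's, 'f, 'r, 'u) scale \<Rightarrow> ('s, 'f, 'r, 'u) model_arrow set" where
  "scale_epis Sg T L = (\<lambda>l. inclusion_epi Sg T (set (sctx L l)) (sfm L l)) ` idx L"

text \<open>
  As any small set is in bijection with a small set of small ordinals, the sets \<open>gset G \<tau>\<close>
  may be taken to be of the latter kind.
\<close>

record ('l, 's, 'f, 'u) gauge =
  sharp :: "('s, 'f, 'u) sterm \<Rightarrow> 'u"
  gset :: "('s, 'f, 'u) sterm \<Rightarrow> 'u set"
  gidx :: "('s, 'f, 'u) sterm \<Rightarrow> 'u \<Rightarrow> 'l"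
  gtms :: "('s, 'f, 'u) sterm \<Rightarrow> 'u \<Rightarrow> ('s, 'f, 'u) sterm list"

definition gauge_formula ::
    "('l, 's, 'f, 'r, 'u::wellorder) scale \<Rightarrow> ('l, 's, 'f, 'u) gauge \<Rightarrow> ('s, 'f, 'u) sterm \<Rightarrow>
     ('s, 'f, 'r, 'u) sformula" where
  "gauge_formula L G \<tau> = Conj (\<lambda>t. if t \<in> gset G \<tau> then
     let l = gidx G \<tau> t; \<sigma>s = gtms G \<tau> t
     in Some (Conj_list (subst_fm (subst_list (sctx L l) \<sigma>s) (sfm L l) # map Defined \<sigma>s))
     else None)"

definition is_gauge ::
    "'u::wellorder \<Rightarrow> ('s, 'f, 'r, 'u) signature \<Rightarrow> ('s, 'f, 'r, 'u) sequent set \<Rightarrow>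
     ('l, 's, 'f, 'r, 'u) scale \<Rightarrow> ('l, 's, 'f, 'u) gauge \<Rightarrow> bool" where
  "is_gauge \<kappa> Sg T L G \<longleftrightarrow>
     (\<forall>\<tau>. raw_term \<kappa> Sg \<tau> \<longrightarrow>
        small TYPE('u) (gset G \<tau>) \<and>
        (\<forall>t\<in>gset G \<tau>.
           gidx G \<tau> t \<in> idx L \<and>
           list_all2 (\<lambda>\<sigma> z. has_sort \<kappa> Sg \<sigma> (fst z)) (gtms G \<tau> t) (sctx L (gidx G \<tau> t)) \<and>
           (\<forall>\<sigma>\<in>set (gtms G \<tau> t). fv \<sigma> \<subseteq> fv \<tau> \<and> sharp G \<sigma> < sharp G \<tau>)) \<and>
        derivable Sg T (fv \<tau>, Defined \<tau>, gauge_formula L G \<tau>) \<and>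
        derivable Sg T (fv \<tau>, gauge_formula L G \<tau>, Defined \<tau>))"

unbundle no cardinal_syntax

end

theory Submission
  imports Defs
begin

text \<open>
  By Yoneda, factoring through an epimorphism of the scale means that a tuple of
  elements satisfies a formula \<open>\<zeta>\<close> of the scale. Hence a morphism \<open>p: M \<rightarrow> X\<close> is right orthogonal to
  all \<open>\<Lambda>\<close>-regular epimorphisms as soon as it reflects these formulas (lemma
  \<open>reflects_scale_orthogonal\<close>). To decompose \<open>f: A \<rightarrow> X\<close> one starts with \<open>A\<close> and freely forces,
  at each successor step, all instances of the formulas \<open>\<zeta>\<close> that hold in \<open>X\<close>.

  A tuple of elements of a stage is given by a tuple \<open>\<sigma>\<close> of terms in elements of \<open>A\<close> that are defined in
  that stage. All stages can therefore be presented at once by generators and relations, with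
  the elements of \<open>A\<close> as the generators at every stage: the relations of the stage \<open>\<beta>\<close> are the diagram of \<open>A\<close>
  and all \<open>\<zeta>[\<sigma>]\<close> that hold in \<open>X\<close> and whose terms are defined in some stage below \<open>\<beta>\<close>. Since
  this description treats successors and limits alike, the stages at limits are colimits
  for the simple reason that no relation appears there for the first time (\<open>stages_colimit\<close>), while
  the universal property of the one-step extensions is \<open>\<Lambda>\<close>-regularity (\<open>stages_regular\<close>).
  Presented models exist because terms form a small set: the terms that
  are defined in all solutions of the relations, modulo equality in all solutions, form a full
  substructure of a product of solutions, and such a substructure satisfies all Horn sequents that
  its factors satisfy (\<open>presentation_exists\<close>).

  The gauge bounds the length: a term \<open>\<tau>\<close> over \<open>A\<close> that is defined in \<open>X\<close> is defined from the stage
  \<open>\<sharp>\<tau>\<close> on, by induction on \<open>\<sharp>\<tau>\<close>: that \<open>\<tau>\<close> is defined amounts to conditions \<open>\<zeta>[\<sigma>]\<close> together with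
  definedness of the finitely many terms in each \<open>\<sigma>\<close>, whose numbers are smaller than \<open>\<sharp>\<tau>\<close>. By
  induction these terms are all defined in some stage below \<open>\<sharp>\<tau>\<close>, so that \<open>\<zeta>[\<sigma>]\<close> is forced by the stage
  \<open>\<sharp>\<tau>\<close> (\<open>defined_from_rank\<close>). If now a tuple in a stage \<open>\<beta> \<ge> \<gamma>\<close> has an image in \<open>X\<close> that satisfies \<open>\<zeta>\<close>,
  then the terms naming its members are defined in a stage below \<open>\<gamma>\<close>, and \<open>\<zeta>\<close> is forced on them by
  the stage \<open>\<gamma>\<close>. So the map from the stage \<open>\<beta>\<close> to \<open>X\<close> reflects the scale.

  When \<open>\<sigma>\<close> is the empty tuple, no term witnesses that the stage \<open>\<sharp>\<tau>\<close> has a predecessor in which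
  \<open>\<zeta>\<close> could have been forced. If \<open>\<gamma>\<close> is infinite, this is repaired by replacing \<open>\<sharp>\<tau>\<close> with \<open>1 + \<sharp>\<tau>\<close>, which
  stays below \<open>\<gamma>\<close>; if \<open>\<gamma>\<close> is finite, it is what the hypotheses on empty contexts
  provide.
\<close>

unbundle cardinal_syntax

section \<open>Small sets and small ordinals\<close>

lemma finite_ordLess_infinite_set: "finite A \<Longrightarrow> infinite B \<Longrightarrow> |A| <o |B|"
  by (rule finite_ordLess_infinite[OF card_of_Well_order card_of_Well_order])
    (simp_all add: Field_card_of)

lemma Field_ord_le: "Field (ord_le :: 'u::wellorder rel) = UNIV"
  by (auto simp: ord_le_def Field_def)

lemma universeD:
  assumes "universe TYPE('u::wellorder)"
  shows "Card_order (ord_le :: 'u rel)" "regularCard (ord_le :: 'u rel)"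
    "natLeq <o (ord_le :: 'u rel)"
    "small TYPE('u) (A :: 'u set) \<Longrightarrow> small TYPE('u) (Pow A)"
  using assms unfolding universe_def by simp_all

lemma universe_card_order:
  assumes "universe TYPE('u::wellorder)"
  shows "|UNIV :: 'u set| =o (ord_le :: 'u rel)"
  using card_of_Field_ordIso[OF universeD(1)[OF assms]] by (simp add: Field_ord_le)

lemma small_iff_ord_le:
  assumes "universe TYPE('u::wellorder)"
  shows "small TYPE('u) A \<longleftrightarrow> |A| <o (ord_le :: 'u rel)"
  using universe_card_order[OF assms] unfolding small_def
  by (meson ordLess_ordIso_trans ordIso_symmetric)

lemma universe_infinite:
  assumes "universe TYPE('u::wellorder)"
  shows "infinite (UNIV :: 'u set)"
proof -
  have "natLeq <o |UNIV :: 'u set|"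
    using universeD(3)[OF assms] universe_card_order[OF assms]
    by (meson ordLess_ordIso_trans ordIso_symmetric)
  then have "|UNIV :: nat set| <o |UNIV :: 'u set|"
    using card_of_nat ordIso_ordLess_trans by blast
  then show ?thesis
    by (metis card_of_ordLeq_finite infinite_UNIV_nat ordLess_imp_ordLeq)
qed

lemma small_nat:
  assumes "universe TYPE('u::wellorder)"
  shows "small TYPE('u) (UNIV :: nat set)"
  unfolding small_iff_ord_le[OF assms]
  by (rule ordIso_ordLess_trans[OF card_of_nat universeD(3)[OF assms]])

lemma small_inj:
  assumes "inj_on g A" "g ` A \<subseteq> B" "small U B"
  shows "small U A"
  unfolding small_def
proof (rule ordLeq_ordLess_trans)
  show "|A| \<le>o |B|" using assms(1,2) by (intro card_of_ordLeq[THEN iffD1] exI conjI)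
qed (use assms(3) in \<open>simp add: small_def\<close>)

lemma small_mono: "A \<subseteq> B \<Longrightarrow> small U B \<Longrightarrow> small U A"
  using card_of_mono1 ordLeq_ordLess_trans unfolding small_def by blast

lemma small_image: "small U A \<Longrightarrow> small U (g ` A)"
  using card_of_image ordLeq_ordLess_trans unfolding small_def by blast

lemma small_UN:
  assumes "universe TYPE('u::wellorder)" "small TYPE('u) I" "\<And>i. i \<in> I \<Longrightarrow> small TYPE('u) (A i)"
  shows "small TYPE('u) (\<Union>i\<in>I. A i)"
proof -
  have "Cinfinite (ord_le :: 'u rel)"
    using universeD(1)[OF assms(1)] universe_infinite[OF assms(1)]
    by (simp add: cinfinite_def Field_ord_le)
  with universeD(2)[OF assms(1)] show ?thesis
    using assms(2,3) unfolding small_iff_ord_le[OF assms(1)]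
    by (intro card_of_UNION_ordLess_infinite_Field_regularCard ballI)
qed

lemma small_Times:
  assumes "universe TYPE('u::wellorder)" "small TYPE('u) A" "small TYPE('u) B"
  shows "small TYPE('u) (A \<times> B)"
proof -
  have "small TYPE('u) (\<Union>x\<in>A. Pair x ` B)"
    by (rule small_UN[OF assms(1,2)]) (rule small_image[OF assms(3)])
  moreover have "(\<Union>x\<in>A. Pair x ` B) = A \<times> B" by auto
  ultimately show ?thesis by simp
qed

lemma small_Un:
  assumes "universe TYPE('u::wellorder)" "small TYPE('u) A" "small TYPE('u) B"
  shows "small TYPE('u) (A \<union> B)"
  using card_of_Un_ordLess_infinite[OF universe_infinite[OF assms(1)]] assms(2,3)
  unfolding small_def .

text \<open>
  The closure of the universe under power sets is an axiom about sets of elements of \<open>'u\<close>. It extends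
  to small sets of any type, since these are moved into \<open>'u\<close> by an injection.
\<close>

lemma small_embeds:
  assumes "small TYPE('u) A"
  obtains e :: "'a \<Rightarrow> 'u" where "inj_on e A"
proof -
  have "|A| \<le>o |UNIV :: 'u set|"
    using assms unfolding small_def by (rule ordLess_imp_ordLeq)
  then have "\<exists>e :: 'a \<Rightarrow> 'u. inj_on e A \<and> e ` A \<subseteq> UNIV" by (rule card_of_ordLeq[THEN iffD2])
  then show thesis using that by (elim exE conjE)
qed

lemma small_Pow:
  assumes "universe TYPE('u::wellorder)" "small TYPE('u) A"
  shows "small TYPE('u) (Pow A)"
proof -
  obtain e :: "_ \<Rightarrow> 'u" where e: "inj_on e A" using small_embeds[OF assms(2)] .
  have Pow_small: "small TYPE('u) (Pow (e ` A))"
    by (rule universeD(4)[OF assms(1) small_image[OF assms(2)]])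
  have "image e ` Pow A \<subseteq> Pow (e ` A)" by (rule image_Pow_mono) (rule subset_refl)
  from small_inj[OF inj_on_image_Pow[OF e] this Pow_small] show ?thesis .
qed

text \<open>A list is determined by the graph of its entries.\<close>

lemma small_lists:
  assumes "universe TYPE('u::wellorder)" "small TYPE('u) A"
  shows "small TYPE('u) (lists A)"
proof (rule small_inj)
  let ?g = "\<lambda>xs :: 'a list. (\<lambda>i. (i, xs ! i)) ` {..<length xs}"
  show "inj_on ?g (lists A)"
  proof (rule inj_onI)
    fix xs ys :: "'a list" assume eq: "?g xs = ?g ys"
    have "fst ` ?g zs = {..<length zs}" for zs :: "'a list" by (simp add: image_image)
    then have len: "length xs = length ys" using eq by (metis lessThan_eq_iff)
    have "xs ! i = ys ! i" if "i < length xs" for i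
    proof -
      have "(i, xs ! i) \<in> ?g ys" using that eq by blast
      then show ?thesis by auto
    qed
    with len show "xs = ys" by (rule nth_equalityI)
  qed
  show "?g ` lists A \<subseteq> Pow (UNIV \<times> A)"
  proof
    fix S assume "S \<in> ?g ` lists A"
    then obtain xs where "xs \<in> lists A" "S = ?g xs" by blast
    then show "S \<in> Pow (UNIV \<times> A)" by (auto simp: lists_eq_set)
  qed
  show "small TYPE('u) (Pow ((UNIV :: nat set) \<times> A))"
    by (rule small_Pow[OF assms(1) small_Times[OF assms(1) small_nat[OF assms(1)] assms(2)]])
qed

lemma small_lessThan:
  assumes "universe TYPE('u::wellorder)"
  shows "small TYPE('u) {..<\<kappa> :: 'u}"
proof -
  have "underS (ord_le :: 'u rel) \<kappa> = {..<\<kappa>}" by (auto simp: underS_def ord_le_def)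
  then show ?thesis
    using card_of_underS[OF universeD(1)[OF assms], of \<kappa>]
    by (simp add: small_iff_ord_le[OF assms] Field_ord_le)
qed

lemma universe_unbounded:
  assumes "universe TYPE('u::wellorder)"
  shows "\<exists>y. (x :: 'u) < y"
proof -
  have "infinite (Field (ord_le :: 'u rel))"
    using universe_infinite[OF assms] by (simp add: Field_ord_le)
  then obtain y where "x \<noteq> y" "(x, y) \<in> (ord_le :: 'u rel)"
    using infinite_Card_order_limit[OF universeD(1)[OF assms]]
    unfolding Field_ord_le by blast
  then have "x < y" by (auto simp: ord_le_def)
  then show ?thesis ..
qed

lemma zero_ord_le: "zero_ord \<le> (x :: 'u::wellorder)"
  unfolding zero_ord_def by (rule Least_le) simp

lemma less_suc_ord:
  assumes "universe TYPE('u::wellorder)"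
  shows "(x :: 'u) < suc_ord x"
  unfolding suc_ord_def using universe_unbounded[OF assms] by (rule LeastI_ex)

lemma suc_ord_le: "(x :: 'u::wellorder) < y \<Longrightarrow> suc_ord x \<le> y"
  unfolding suc_ord_def by (rule Least_le)

lemma nat_ord_strict_mono:
  assumes "universe TYPE('u::wellorder)"
  shows "strict_mono (nat_ord :: nat \<Rightarrow> 'u)"
  by (rule strict_mono_Suc_iff[THEN iffD2]) (simp add: nat_ord_def less_suc_ord[OF assms])

text \<open>
  Regularity is stated for the order on the ordinals below \<open>\<kappa>\<close>; the proof moves to this order and
  back, as it is isomorphic to the cardinality of its field.
\<close>

lemma below_regular_UN:
  assumes "small_regular_cardinal (\<kappa> :: 'u::wellorder)" "\<alpha> < \<kappa>"
    and "\<And>i. i < \<alpha> \<Longrightarrow> |A i| <o |{..<\<kappa>}|"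
  shows "|\<Union>i<\<alpha>. A i| <o |{..<\<kappa>}|"
proof -
  let ?r = "{(x :: 'u, y). x \<le> y \<and> y < \<kappa>}"
  have r: "Card_order ?r" "cinfinite ?r" "regularCard ?r"
    using assms(1) by (simp_all add: small_regular_cardinal_def Let_def)
  have field: "Field ?r = {..<\<kappa>}" by (auto simp: Field_def)
  have iso: "|{..<\<kappa>}| =o ?r" using card_of_Field_ordIso[OF r(1)] field by simp
  have "underS ?r \<alpha> = {..<\<alpha>}" using assms(2) by (auto simp: underS_def)
  then have "|{..<\<alpha>}| <o ?r"
    using card_of_underS[OF r(1), of \<alpha>] assms(2) field by simp
  moreover have "\<forall>i\<in>{..<\<alpha>}. |A i| <o ?r" using assms(3) iso ordLess_ordIso_trans by blast
  ultimately have "|\<Union>i<\<alpha>. A i| <o ?r"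
    using r card_of_UNION_ordLess_infinite_Field_regularCard by blast
  then show ?thesis using iso ordIso_symmetric ordLess_ordIso_trans by blast
qed

lemma finite_below_regular:
  assumes "small_regular_cardinal (\<kappa> :: 'u::wellorder)" "finite A"
  shows "|A| <o |{..<\<kappa>}|"
proof -
  have "Field {(x :: 'u, y). x \<le> y \<and> y < \<kappa>} = {..<\<kappa>}" by (auto simp: Field_def)
  then have "infinite {..<\<kappa>}"
    using assms(1) by (simp add: small_regular_cardinal_def Let_def cinfinite_def)
  then show ?thesis by (rule finite_ordLess_infinite_set[OF assms(2)])
qed


section \<open>Terms and formulas over a sorted set of variables\<close>

text \<open>
  Elements of a model are used as variables, so that terms are needed over an arbitrary set of
  pairs \<open>(s, i)\<close>, without the bound \<open>i < \<kappa>\<close> on the variables of raw terms. In the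
  formulas considered here, conjunctions may have any size.
\<close>

inductive sorted_term ::
    "('s, 'f, 'r, 'u::wellorder) signature \<Rightarrow> ('s \<times> 'u) set \<Rightarrow> ('s, 'f, 'u) sterm \<Rightarrow> 's \<Rightarrow> bool"
  for Sg V where
  var: "v \<in> V \<Longrightarrow> s = fst v \<Longrightarrow> sorted_term Sg V (Var v) s"
| app: "f \<in> funs Sg \<Longrightarrow> dom ts = {..<far Sg f} \<Longrightarrow>
   (\<And>i. i < far Sg f \<Longrightarrow> sorted_term Sg V (the (ts i)) (fdom Sg f i)) \<Longrightarrow> s = fcod Sg f \<Longrightarrow>
   sorted_term Sg V (App f ts) s"

inductive sorted_formula ::
    "('s, 'f, 'r, 'u::wellorder) signature \<Rightarrow> ('s \<times> 'u) set \<Rightarrow> ('s, 'f, 'r, 'u) sformula \<Rightarrow> bool"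
  for Sg V where
  Rel: "R \<in> rels Sg \<Longrightarrow> dom ts = {..<rar Sg R} \<Longrightarrow>
   (\<And>i. i < rar Sg R \<Longrightarrow> sorted_term Sg V (the (ts i)) (rdom Sg R i)) \<Longrightarrow>
   sorted_formula Sg V (Rel R ts)"
| Eq: "sorted_term Sg V \<tau> s \<Longrightarrow> sorted_term Sg V \<tau>' s \<Longrightarrow> sorted_formula Sg V (Eq \<tau> \<tau>')"
| Top: "sorted_formula Sg V Top"
| Conj: "(\<And>i \<phi>. \<phi>s i = Some \<phi> \<Longrightarrow> sorted_formula Sg V \<phi>) \<Longrightarrow> sorted_formula Sg V (Conj \<phi>s)"

lemma fv_App: "fv (App f ts) = (\<Union>i\<in>dom ts. fv (the (ts i)))"
  by (fastforce simp: dom_def ran_def)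

lemma fvs_Rel: "fvs (Rel R ts) = (\<Union>i\<in>dom ts. fv (the (ts i)))"
  by (fastforce simp: dom_def)

lemma fvs_Conj: "fvs (Conj \<phi>s) = (\<Union>i\<in>dom \<phi>s. fvs (the (\<phi>s i)))"
  by (fastforce simp: dom_def)

declare tm.set(2) [simp del] fm.set(1,4) [simp del]
declare fv_App [simp] fvs_Rel [simp] fvs_Conj [simp]

lemma tm_induct [case_names Var App]:
  assumes "\<And>v. P (Var v)"
    and "\<And>f ts. (\<And>i. i \<in> dom ts \<Longrightarrow> P (the (ts i))) \<Longrightarrow> P (App f ts)"
  shows "P t"
proof (induction t)
  case (App f ts)
  show ?case
  proof (rule assms(2))
    fix i assume "i \<in> dom ts"
    then show "P (the (ts i))" using App[of "ts i" "the (ts i)"] by auto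
  qed
qed (rule assms(1))

lemma fm_induct [case_names Rel Eq Top Conj]:
  assumes "\<And>R ts. P (Rel R ts)" "\<And>\<tau> \<tau>'. P (Eq \<tau> \<tau>')" "P Top"
    and "\<And>\<phi>s. (\<And>i. i \<in> dom \<phi>s \<Longrightarrow> P (the (\<phi>s i))) \<Longrightarrow> P (Conj \<phi>s)"
  shows "P \<phi>"
proof (induction \<phi>)
  case (Conj \<phi>s)
  show ?case
  proof (rule assms(4))
    fix i assume "i \<in> dom \<phi>s"
    then show "P (the (\<phi>s i))" using Conj[of "\<phi>s i" "the (\<phi>s i)"] by auto
  qed
qed (rule assms)+

lemma sorted_term_fv: "sorted_term Sg V t s \<Longrightarrow> fv t \<subseteq> V"
  by (induction rule: sorted_term.induct) auto

lemma sorted_formula_fvs: "sorted_formula Sg V \<phi> \<Longrightarrow> fvs \<phi> \<subseteq> V"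
proof (induction rule: sorted_formula.induct)
  case (Rel R ts)
  then show ?case using sorted_term_fv by fastforce
next
  case (Conj \<phi>s)
  have "fvs (the (\<phi>s i)) \<subseteq> V" if "i \<in> dom \<phi>s" for i
    using that Conj.IH[of i "the (\<phi>s i)"] by (simp add: domIff)
  then show ?case by (simp add: UN_subset_iff)
qed (auto dest: sorted_term_fv)

lemma sorted_term_mono: "sorted_term Sg V t s \<Longrightarrow> fv t \<subseteq> W \<Longrightarrow> sorted_term Sg W t s"
proof (induction rule: sorted_term.induct)
  case (app f ts s)
  have "sorted_term Sg W (the (ts i)) (fdom Sg f i)" if "i < far Sg f" for i
  proof (rule app.IH[OF that])
    have "i \<in> dom ts" using app.hyps(2) that by simp
    then show "fv (the (ts i)) \<subseteq> W" using app.prems by (auto simp del: app.hyps(2))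
  qed
  with app.hyps show ?case by (intro sorted_term.app)
qed (auto intro: sorted_term.var)

lemma has_sort_sorted_term: "has_sort \<kappa> Sg t s \<Longrightarrow> sorted_term Sg (fv t) t s"
proof (induction rule: has_sort.induct)
  case (2 f ts)
  then show ?case by (intro sorted_term.app) (auto intro: sorted_term_mono)
qed (auto intro: sorted_term.var)

lemma raw_formula_sorted_formula:
  "raw_formula \<kappa> Sg \<phi> \<Longrightarrow> fvs \<phi> \<subseteq> V \<Longrightarrow> sorted_formula Sg V \<phi>"
proof (induction rule: raw_formula.induct)
  case (1 R ts)
  then show ?case
    by (intro sorted_formula.Rel) (auto intro!: sorted_term_mono[OF has_sort_sorted_term])
next
  case (4 \<phi>s)
  show ?case
  proof (rule sorted_formula.Conj)
    fix i \<phi> assume "\<phi>s i = Some \<phi>"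
    then show "sorted_formula Sg V \<phi>" using 4(3)[of i] 4(4) by (force simp: domI)
  qed
qed (auto intro!: sorted_formula.intros sorted_term_mono[OF has_sort_sorted_term])

lemma sorted_term_subst:
  "sorted_term Sg V t s \<Longrightarrow> (\<And>v. v \<in> V \<Longrightarrow> sorted_term Sg W (\<theta> v) (fst v)) \<Longrightarrow>
    sorted_term Sg W (subst_tm \<theta> t) s"
proof (induction rule: sorted_term.induct)
  case (app f ts s)
  have dom_eq: "dom (\<lambda>i. map_option (subst_tm \<theta>) (ts i)) = {..<far Sg f}"
    using app.hyps(2) by (auto simp: dom_def)
  have "sorted_term Sg W (the (map_option (subst_tm \<theta>) (ts i))) (fdom Sg f i)"
    if "i < far Sg f" for i
  proof -
    have "i \<in> dom ts" using app.hyps(2) that by simp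
    then show ?thesis using app.IH[OF that app.prems] by auto
  qed
  then show ?case using app.hyps dom_eq by (auto intro!: sorted_term.app)
qed auto

lemma sorted_formula_subst:
  "sorted_formula Sg V \<phi> \<Longrightarrow> (\<And>v. v \<in> V \<Longrightarrow> sorted_term Sg W (\<theta> v) (fst v)) \<Longrightarrow>
    sorted_formula Sg W (subst_fm \<theta> \<phi>)"
proof (induction rule: sorted_formula.induct)
  case (Rel R ts)
  have dom_eq: "dom (\<lambda>i. map_option (subst_tm \<theta>) (ts i)) = {..<rar Sg R}"
    using Rel.hyps(2) by (auto simp: dom_def)
  have "sorted_term Sg W (the (map_option (subst_tm \<theta>) (ts i))) (rdom Sg R i)"
    if "i < rar Sg R" for i
  proof -
    have "i \<in> dom ts" using Rel.hyps(2) that by simp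
    then show ?thesis using sorted_term_subst[OF Rel.hyps(3)[OF that] Rel.prems] by auto
  qed
  then show ?case using Rel.hyps dom_eq by (auto intro!: sorted_formula.Rel)
qed (auto intro!: sorted_formula.intros sorted_term_subst)


section \<open>Evaluation\<close>

lemma collect_eq_Some:
  "collect (\<lambda>i. map_option g (ts i)) = Some x \<longleftrightarrow>
    x \<in> extensional (dom ts) \<and> (\<forall>i\<in>dom ts. g (the (ts i)) = Some (x i))"
  (is "?L \<longleftrightarrow> ?R")
proof
  assume ?L
  then have x: "x = (\<lambda>i\<in>dom (\<lambda>i. map_option g (ts i)). the (the (map_option g (ts i))))"
    and all: "map_option g (ts i) \<noteq> Some None" for i
    by (auto simp: collect_def split: if_splits)
  have "dom (\<lambda>i. map_option g (ts i)) = dom ts" by (auto simp: dom_def)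
  then show ?R using all unfolding x by (force simp: domIff)
next
  assume R: ?R
  have "map_option g (ts i) \<noteq> Some None" for i
    using R by (cases "ts i") (auto simp: dom_def)
  moreover have "(\<lambda>i\<in>dom (\<lambda>i. map_option g (ts i)). the (the (map_option g (ts i)))) = x"
  proof
    fix i show "(\<lambda>i\<in>dom (\<lambda>i. map_option g (ts i)). the (the (map_option g (ts i)))) i = x i"
      using R by (cases "ts i") (auto simp: dom_def extensional_def)
  qed
  ultimately show ?L by (simp add: collect_def)
qed

lemma eval_App_eq_Some:
  "eval M m (App f ts) = Some y \<longleftrightarrow>
    (\<exists>x. x \<in> extensional (dom ts) \<and> (\<forall>i\<in>dom ts. eval M m (the (ts i)) = Some (x i)) \<and>
      fint M f x = Some y)"
  by (auto simp: bind_eq_Some_conv collect_eq_Some)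

lemma sat_Rel_iff:
  "sat M m (Rel R ts) \<longleftrightarrow>
    (\<exists>x. x \<in> extensional (dom ts) \<and> (\<forall>i\<in>dom ts. eval M m (the (ts i)) = Some (x i)) \<and>
      x \<in> rint M R)"
  by (auto simp: collect_eq_Some)

lemma eval_App_eq:
  assumes "dom ts = {..<\<alpha>}" "\<And>i. i < \<alpha> \<Longrightarrow> eval M m (the (ts i)) = Some (x i)"
  shows "eval M m (App f ts) = fint M f (\<lambda>i\<in>{..<\<alpha>}. x i)"
proof -
  have "collect (\<lambda>i. map_option (eval M m) (ts i)) = Some (\<lambda>i\<in>{..<\<alpha>}. x i)"
    using assms by (simp add: collect_eq_Some)
  then show ?thesis by simp
qed

lemma sat_Rel_eq:
  assumes "dom ts = {..<\<alpha>}" "\<And>i. i < \<alpha> \<Longrightarrow> eval M m (the (ts i)) = Some (x i)"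
  shows "sat M m (Rel R ts) \<longleftrightarrow> (\<lambda>i\<in>{..<\<alpha>}. x i) \<in> rint M R"
proof -
  have "collect (\<lambda>i. map_option (eval M m) (ts i)) = Some (\<lambda>i\<in>{..<\<alpha>}. x i)"
    using assms by (simp add: collect_eq_Some)
  then show ?thesis by simp
qed

lemma sat_Conj_iff: "sat M m (Conj \<phi>s) \<longleftrightarrow> (\<forall>i\<in>dom \<phi>s. sat M m (the (\<phi>s i)))"
  by (fastforce simp: dom_def)

lemma sat_Defined: "sat M m (Defined t) \<longleftrightarrow> eval M m t \<noteq> None"
  by auto

declare eval.simps(2) [simp del] sat.simps(1,4) [simp del]

text \<open>
  The substitution lemma covers changes of valuation as well, since a valuation of variables may
  be read as a substitution by variables.
\<close>

lemma eval_subst: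
  assumes "\<And>v. v \<in> fv t \<Longrightarrow> eval M n (\<theta> v) = Some (m v)"
  shows "eval M n (subst_tm \<theta> t) = eval M m t"
  using assms
proof (induction t rule: tm_induct)
  case (App f ts)
  have dom_eq: "dom (\<lambda>i. map_option (subst_tm \<theta>) (ts i)) = dom ts" by (auto simp: dom_def)
  have "eval M n (the (map_option (subst_tm \<theta>) (ts i))) = eval M m (the (ts i))"
    if i: "i \<in> dom ts" for i
  proof -
    have "eval M n (\<theta> v) = Some (m v)" if "v \<in> fv (the (ts i))" for v
      using App.prems that i by auto
    from App.IH[OF i this] show ?thesis using i by (auto simp: option.map_sel)
  qed
  then have "eval M n (subst_tm \<theta> (App f ts)) = Some y \<longleftrightarrow> eval M m (App f ts) = Some y" for y
    by (simp add: eval_App_eq_Some dom_eq)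
  then show ?case by (metis not_Some_eq)
qed simp

lemma sat_subst:
  assumes "\<And>v. v \<in> fvs \<phi> \<Longrightarrow> eval M n (\<theta> v) = Some (m v)"
  shows "sat M n (subst_fm \<theta> \<phi>) = sat M m \<phi>"
  using assms
proof (induction \<phi> rule: fm_induct)
  case (Rel R ts)
  have dom_eq: "dom (\<lambda>i. map_option (subst_tm \<theta>) (ts i)) = dom ts" by (auto simp: dom_def)
  have "eval M n (the (map_option (subst_tm \<theta>) (ts i))) = eval M m (the (ts i))"
    if i: "i \<in> dom ts" for i
  proof -
    have "eval M n (\<theta> v) = Some (m v)" if "v \<in> fv (the (ts i))" for v
      using Rel that i by auto
    from eval_subst[OF this] show ?thesis using i by (auto simp: option.map_sel)
  qed
  then show ?case by (simp add: sat_Rel_iff dom_eq)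
next
  case (Eq \<tau> \<tau>')
  then show ?case using eval_subst[of \<tau> M n \<theta> m] eval_subst[of \<tau>' M n \<theta> m] by simp
next
  case (Conj \<phi>s)
  have dom_eq: "dom (\<lambda>i. map_option (subst_fm \<theta>) (\<phi>s i)) = dom \<phi>s" by (auto simp: dom_def)
  have "sat M n (the (map_option (subst_fm \<theta>) (\<phi>s i))) = sat M m (the (\<phi>s i))"
    if i: "i \<in> dom \<phi>s" for i
  proof -
    have "eval M n (\<theta> v) = Some (m v)" if "v \<in> fvs (the (\<phi>s i))" for v
      using Conj.prems that i by auto
    from Conj.IH[OF i this] show ?thesis using i by (auto simp: option.map_sel)
  qed
  then show ?case by (simp add: sat_Conj_iff dom_eq)
qed simp

lemma subst_tm_Var: "subst_tm Var t = t"
proof (induction t rule: tm_induct)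
  case (App f ts)
  have "map_option (subst_tm Var) (ts i) = ts i" for i
    using App[of i] by (cases "ts i") auto
  then show ?case by simp
qed simp

lemma eval_cong:
  assumes "\<And>v. v \<in> fv t \<Longrightarrow> m v = n v"
  shows "eval M m t = eval M n t"
  using eval_subst[of t M m Var n] assms by (simp add: subst_tm_Var)

lemma subst_fm_Var: "subst_fm Var \<phi> = \<phi>"
proof (induction \<phi> rule: fm_induct)
  case (Conj \<phi>s)
  have "map_option (subst_fm Var) (\<phi>s i) = \<phi>s i" for i
    using Conj[of i] by (cases "\<phi>s i") auto
  then show ?case by simp
qed (simp_all add: subst_tm_Var option.map_ident cong: option.map_cong)

lemma sat_cong:
  assumes "\<And>v. v \<in> fvs \<phi> \<Longrightarrow> m v = n v"
  shows "sat M m \<phi> = sat M n \<phi>"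
  using sat_subst[of \<phi> M m Var n] assms by (simp add: subst_fm_Var)

lemma eval_in_car:
  assumes "partial_structure Sg M" "sorted_term Sg V t s" "m \<in> (\<Pi> v\<in>V. car M (fst v))"
    and "eval M m t = Some y"
  shows "y \<in> car M s"
  using assms(2)
proof (cases rule: sorted_term.cases)
  case (var v)
  then show ?thesis using assms(3,4) by auto
next
  case (app f ts)
  then obtain x where "fint M f x = Some y" using assms(4) by (auto simp: eval_App_eq_Some)
  then have "y \<in> ran (fint M f)" by (auto simp: ran_def)
  then show ?thesis using app assms(1) unfolding partial_structure_def by blast
qed


section \<open>Homomorphisms\<close>

lemma homs_car: "h \<in> homs Sg M N \<Longrightarrow> x \<in> car M s \<Longrightarrow> h s x \<in> car N s"
  unfolding homs_def by blast

lemma homs_extensional: "h \<in> homs Sg M N \<Longrightarrow> h s \<in> extensional (car M s)"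
  by (auto simp: homs_def PiE_def)

lemma homs_fun:
  assumes "h \<in> homs Sg M N" "f \<in> funs Sg" "partial_structure Sg M" "fint M f x = Some y"
  shows "fint N f (\<lambda>i\<in>{..<far Sg f}. h (fdom Sg f i) (x i)) = Some (h (fcod Sg f) y)"
proof -
  have "dom (fint M f) \<subseteq> tuples M (far Sg f) (fdom Sg f)"
    using assms(2,3) unfolding partial_structure_def by blast
  then have "x \<in> tuples M (far Sg f) (fdom Sg f)" using assms(4) by blast
  then show ?thesis using assms unfolding homs_def by blast
qed

lemma homs_rel:
  assumes "h \<in> homs Sg M N" "R \<in> rels Sg" "x \<in> rint M R"
  shows "(\<lambda>i\<in>{..<rar Sg R}. h (rdom Sg R i) (x i)) \<in> rint N R"
  using assms unfolding homs_def by blast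

lemma homs_eqI:
  assumes "h \<in> homs Sg M N" "k \<in> homs Sg M P" "\<And>s x. x \<in> car M s \<Longrightarrow> h s x = k s x"
  shows "h = k"
proof
  fix s show "h s = k s"
    using homs_extensional[OF assms(1)] homs_extensional[OF assms(2)] assms(3)
    by (rule extensionalityI)
qed

lemma homs_eval:
  assumes M: "partial_structure Sg M" and h: "h \<in> homs Sg M N"
    and t: "sorted_term Sg V t s" and m: "m \<in> (\<Pi> v\<in>V. car M (fst v))"
    and n: "\<And>v. v \<in> V \<Longrightarrow> n v = h (fst v) (m v)" and y: "eval M m t = Some y"
  shows "eval N n t = Some (h s y)"
  using t y
proof (induction arbitrary: y rule: sorted_term.induct)
  case (app f ts s)
  obtain x where x: "x \<in> extensional {..<far Sg f}" "fint M f x = Some y"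
    "\<And>i. i < far Sg f \<Longrightarrow> eval M m (the (ts i)) = Some (x i)"
    using app.prems app.hyps(2) by (auto simp: eval_App_eq_Some)
  have "fint N f (\<lambda>i\<in>{..<far Sg f}. h (fdom Sg f i) (x i)) = Some (h s y)"
    using homs_fun[OF h app.hyps(1) M x(2)] app.hyps by simp
  then show ?case
    using app.IH x(3) app.hyps(2) unfolding eval_App_eq_Some
    by (intro exI[of _ "\<lambda>i\<in>{..<far Sg f}. h (fdom Sg f i) (x i)"]) auto
qed (use n in auto)

lemma homs_sat:
  assumes M: "partial_structure Sg M" and h: "h \<in> homs Sg M N"
    and \<phi>: "sorted_formula Sg V \<phi>" and m: "m \<in> (\<Pi> v\<in>V. car M (fst v))"
    and n: "\<And>v. v \<in> V \<Longrightarrow> n v = h (fst v) (m v)" and sat: "sat M m \<phi>"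
  shows "sat N n \<phi>"
  using \<phi> sat
proof (induction rule: sorted_formula.induct)
  case (Rel R ts)
  then obtain x where x: "x \<in> extensional {..<rar Sg R}" "x \<in> rint M R"
    "\<And>i. i < rar Sg R \<Longrightarrow> eval M m (the (ts i)) = Some (x i)"
    by (auto simp: sat_Rel_iff)
  have "eval N n (the (ts i)) = Some (h (rdom Sg R i) (x i))" if "i < rar Sg R" for i
    using homs_eval[OF M h Rel.hyps(3)[OF that] m n x(3)[OF that]] .
  then show ?case
    using homs_rel[OF h Rel.hyps(1) x(2)] Rel.hyps(2) unfolding sat_Rel_iff
    by (intro exI[of _ "\<lambda>i\<in>{..<rar Sg R}. h (rdom Sg R i) (x i)"]) auto
next
  case (Eq \<tau> s \<tau>')
  then obtain y where "eval M m \<tau> = Some y" "eval M m \<tau>' = Some y" by auto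
  then show ?case using homs_eval[OF M h Eq(1) m n] homs_eval[OF M h Eq(2) m n] by simp
next
  case (Conj \<phi>s)
  then show ?case by (fastforce simp: sat_Conj_iff dom_def)
qed simp

lemma homs_compose:
  assumes h: "h \<in> homs Sg M N" and k: "k \<in> homs Sg N P" and M: "partial_structure Sg M"
    and N: "partial_structure Sg N"
  shows "(\<lambda>s. compose (car M s) (k s) (h s)) \<in> homs Sg M P"
proof -
  let ?c = "\<lambda>s. compose (car M s) (k s) (h s)"
  have car: "?c s \<in> car M s \<rightarrow>\<^sub>E car P s" for s
    using homs_car[OF h] homs_car[OF k] by (auto simp: compose_def)
  have "fint P f (\<lambda>i\<in>{..<far Sg f}. ?c (fdom Sg f i) (x i)) = Some (?c (fcod Sg f) y)"
    if f: "f \<in> funs Sg" and x: "x \<in> tuples M (far Sg f) (fdom Sg f)" and y: "fint M f x = Some y"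
    for f x y
  proof -
    have "ran (fint M f) \<subseteq> car M (fcod Sg f)" using M f unfolding partial_structure_def by blast
    then have "y \<in> car M (fcod Sg f)" using y by (auto simp: ran_def)
    moreover have "(\<lambda>i\<in>{..<far Sg f}. k (fdom Sg f i)
        ((\<lambda>i\<in>{..<far Sg f}. h (fdom Sg f i) (x i)) i)) =
      (\<lambda>i\<in>{..<far Sg f}. ?c (fdom Sg f i) (x i))"
      using x by (auto simp: compose_def tuples_def restrict_def fun_eq_iff)
    ultimately show ?thesis
      using homs_fun[OF k f N homs_fun[OF h f M y]] by (simp add: compose_def)
  qed
  moreover have "(\<lambda>i\<in>{..<rar Sg R}. ?c (rdom Sg R i) (x i)) \<in> rint P R"
    if R: "R \<in> rels Sg" and x: "x \<in> rint M R" for R x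
  proof -
    have "x \<in> tuples M (rar Sg R) (rdom Sg R)" using M R x unfolding partial_structure_def by blast
    then have "(\<lambda>i\<in>{..<rar Sg R}. k (rdom Sg R i)
        ((\<lambda>i\<in>{..<rar Sg R}. h (rdom Sg R i) (x i)) i)) =
      (\<lambda>i\<in>{..<rar Sg R}. ?c (rdom Sg R i) (x i))"
      by (auto simp: compose_def tuples_def restrict_def fun_eq_iff)
    then show ?thesis using homs_rel[OF k R homs_rel[OF h R x]] by simp
  qed
  ultimately show ?thesis using car unfolding homs_def by blast
qed


section \<open>Smallness of the set of terms\<close>

text \<open>
  A term is a well-founded tree and hence determined by the set of its labelled paths. The paths are
  finite lists of small ordinals, so that the terms over a small set of variables embed in the
  power set of a small set.
\<close>

primrec tm_code :: "('v, 'f, 'u) tm \<Rightarrow> ('u list \<times> ('v + 'f)) set" where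
  "tm_code (Var v) = {([], Inl v)}"
| "tm_code (App f ts) = insert ([], Inr f)
     (\<Union>i. case map_option tm_code (ts i) of None \<Rightarrow> {} | Some S \<Rightarrow> (\<lambda>(p, l). (i # p, l)) ` S)"

lemma tm_code_Nil: "([], l) \<in> tm_code (App f ts) \<longleftrightarrow> l = Inr f"
  by (auto split: option.splits)

lemma tm_code_Cons:
  "(i # p, l) \<in> tm_code (App f ts) \<longleftrightarrow> (\<exists>t. ts i = Some t \<and> (p, l) \<in> tm_code t)"
proof
  assume "(i # p, l) \<in> tm_code (App f ts)"
  then obtain j where "(i # p, l) \<in>
      (case map_option tm_code (ts j) of None \<Rightarrow> {} | Some S \<Rightarrow> (\<lambda>(p, l). (j # p, l)) ` S)"
    by auto
  then show "\<exists>t. ts i = Some t \<and> (p, l) \<in> tm_code t" by (cases "ts j") auto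
next
  assume "\<exists>t. ts i = Some t \<and> (p, l) \<in> tm_code t"
  then obtain t where "ts i = Some t" "(p, l) \<in> tm_code t" by blast
  then have "(i # p, l) \<in>
      (case map_option tm_code (ts i) of None \<Rightarrow> {} | Some S \<Rightarrow> (\<lambda>(p, l). (i # p, l)) ` S)"
    by force
  then show "(i # p, l) \<in> tm_code (App f ts)" unfolding tm_code.simps by blast
qed

declare tm_code.simps(2) [simp del]
declare tm_code_Nil [simp] tm_code_Cons [simp]

lemma tm_code_nonempty: "\<exists>l. ([], l) \<in> tm_code t"
  by (cases t) auto

lemma tm_code_inj: "tm_code t = tm_code t' \<Longrightarrow> t = t'"
proof (induction t arbitrary: t' rule: tm_induct)
  case (Var v)
  then have "([], Inl v) \<in> tm_code t'" by (metis insertI1 tm_code.simps(1))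
  then show ?case by (cases t') simp_all
next
  case (App f ts)
  have "([], Inr f) \<in> tm_code t'" using App.prems tm_code_Nil by metis
  then obtain ts' where t': "t' = App f ts'" by (cases t') simp_all
  have branch: "(\<exists>t. ts i = Some t \<and> (p, l) \<in> tm_code t) \<longleftrightarrow>
      (\<exists>t. ts' i = Some t \<and> (p, l) \<in> tm_code t)" for i p l
    using App.prems tm_code_Cons[of i p l f ts] tm_code_Cons[of i p l f ts'] unfolding t' by simp
  have "ts i = ts' i" for i
  proof (cases "ts i")
    case None
    have "ts' i \<noteq> Some u" for u
    proof
      assume u: "ts' i = Some u"
      obtain l where "([], l) \<in> tm_code u" using tm_code_nonempty by blast
      then show False using branch[of i "[]" l] None u by simp
    qed
    then show ?thesis using None by (cases "ts' i") auto
  next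
    case (Some u)
    obtain l where "([], l) \<in> tm_code u" using tm_code_nonempty by blast
    then obtain u' where u': "ts' i = Some u'" using branch[of i "[]" l] Some by auto
    then have "(p, l) \<in> tm_code u \<longleftrightarrow> (p, l) \<in> tm_code u'" for p l
      using branch[of i p l] Some by simp
    then have "tm_code u = tm_code u'" by auto
    then show ?thesis using App.IH[of i u'] Some u' by auto
  qed
  then show ?case by (auto simp: t')
qed

lemma tm_code_sorted_term:
  assumes "is_signature \<kappa> Sg" "sorted_term Sg V t s"
  shows "tm_code t \<subseteq> lists {..<\<kappa>} \<times> (Inl ` V \<union> Inr ` funs Sg)"
  using assms(2)
proof (induction rule: sorted_term.induct)
  case (app f ts s)
  have ar: "far Sg f < \<kappa>" using assms(1) app.hyps(1) by (auto simp: is_signature_def)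
  show ?case
  proof (rule subrelI)
    fix p l assume pl: "(p, l) \<in> tm_code (App f ts)"
    show "(p, l) \<in> lists {..<\<kappa>} \<times> (Inl ` V \<union> Inr ` funs Sg)"
    proof (cases p)
      case Nil
      then show ?thesis using pl app.hyps(1) by simp
    next
      case (Cons i q)
      then obtain t where t: "ts i = Some t" "(q, l) \<in> tm_code t" using pl by auto
      then have i: "i < far Sg f" using app.hyps(2) by auto
      have "(q, l) \<in> lists {..<\<kappa>} \<times> (Inl ` V \<union> Inr ` funs Sg)"
        using app.IH[OF i] t by auto
      moreover have "i < \<kappa>" using i ar by (rule less_trans)
      ultimately show ?thesis using Cons by simp
    qed
  qed
qed auto

lemma small_sorted_terms:
  fixes V :: "('s \<times> 'u::wellorder) set"
  assumes U: "universe TYPE('u)" and Sg: "is_signature \<kappa> Sg" and V: "small TYPE('u) V"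
  shows "small TYPE('u) {t. \<exists>s. sorted_term Sg V t s}"
proof (rule small_inj)
  show "inj_on tm_code {t. \<exists>s. sorted_term Sg V t s}"
    by (auto intro!: inj_onI tm_code_inj)
  show "tm_code ` {t. \<exists>s. sorted_term Sg V t s}
      \<subseteq> Pow (lists {..<\<kappa>} \<times> (Inl ` V \<union> Inr ` funs Sg))"
  proof (rule image_subsetI)
    fix t assume "t \<in> {t. \<exists>s. sorted_term Sg V t s}"
    then obtain s where "sorted_term Sg V t s" by blast
    from tm_code_sorted_term[OF Sg this]
    show "tm_code t \<in> Pow (lists {..<\<kappa>} \<times> (Inl ` V \<union> Inr ` funs Sg))" by (rule PowI)
  qed
  have funs_small: "small TYPE('u) (funs Sg)" using Sg by (simp add: is_signature_def)
  show "small TYPE('u) (Pow (lists {..<\<kappa>} \<times> (Inl ` V \<union> Inr ` funs Sg)))"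
    by (rule small_Pow[OF U small_Times[OF U small_lists[OF U small_lessThan[OF U]]
        small_Un[OF U small_image[OF V] small_image[OF funs_small]]]])
qed


section \<open>Jointly reflecting families of homomorphisms\<close>

text \<open>
  Such a family exhibits \<open>F\<close> as a full substructure of a product. Horn formulas are
  therefore reflected jointly, and \<open>F\<close> inherits all sequents that hold in the targets.
\<close>

locale jointly_reflecting =
  fixes Sg :: "('s, 'f, 'r, 'u::wellorder) signature"
    and F :: "('s, 'f, 'r, 'u) struct"
    and H :: "(('s \<Rightarrow> 'u \<Rightarrow> 'u) \<times> ('s, 'f, 'r, 'u) struct) set"
  assumes struct: "partial_structure Sg F"
    and hom: "(h, Y) \<in> H \<Longrightarrow> h \<in> homs Sg F Y"
    and eqI: "x \<in> car F s \<Longrightarrow> y \<in> car F s \<Longrightarrow> (\<And>h Y. (h, Y) \<in> H \<Longrightarrow> h s x = h s y) \<Longrightarrow> x = y"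
    and definedI: "f \<in> funs Sg \<Longrightarrow> xs \<in> tuples F (far Sg f) (fdom Sg f) \<Longrightarrow>
      (\<And>h Y. (h, Y) \<in> H \<Longrightarrow> fint Y f (\<lambda>i\<in>{..<far Sg f}. h (fdom Sg f i) (xs i)) \<noteq> None) \<Longrightarrow>
      fint F f xs \<noteq> None"
    and relI: "R \<in> rels Sg \<Longrightarrow> xs \<in> tuples F (rar Sg R) (rdom Sg R) \<Longrightarrow>
      (\<And>h Y. (h, Y) \<in> H \<Longrightarrow> (\<lambda>i\<in>{..<rar Sg R}. h (rdom Sg R i) (xs i)) \<in> rint Y R) \<Longrightarrow>
      xs \<in> rint F R"
begin

text \<open>
  The maps of the family determine the values of subterms, so that an operation that is
  defined in all targets is applied there to the images of one tuple of \<open>F\<close>.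
\<close>

lemma eval_defined:
  assumes t: "sorted_term Sg V t s" and m: "m \<in> (\<Pi> v\<in>V. car F (fst v))"
    and Y: "\<And>h Y. (h, Y) \<in> H \<Longrightarrow> eval Y (\<lambda>v. h (fst v) (m v)) t \<noteq> None"
  shows "eval F m t \<noteq> None"
  using t Y
proof (induction rule: sorted_term.induct)
  case (app f ts s)
  define x where "x = (\<lambda>i\<in>{..<far Sg f}. the (eval F m (the (ts i))))"
  have args: "eval F m (the (ts i)) = Some (x i)" if i: "i < far Sg f" for i
  proof -
    have "eval F m (the (ts i)) \<noteq> None"
    proof (rule app.IH[OF i])
      fix h Y assume "(h, Y) \<in> H"
      then have "eval Y (\<lambda>v. h (fst v) (m v)) (App f ts) \<noteq> None" by (rule app.prems)
      then obtain y where "eval Y (\<lambda>v. h (fst v) (m v)) (App f ts) = Some y" by blast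
      then obtain z where "\<forall>i\<in>dom ts. eval Y (\<lambda>v. h (fst v) (m v)) (the (ts i)) = Some (z i)"
        unfolding eval_App_eq_Some by blast
      then show "eval Y (\<lambda>v. h (fst v) (m v)) (the (ts i)) \<noteq> None"
        using i app.hyps(2) by simp
    qed
    then show ?thesis using i by (auto simp: x_def)
  qed
  have x: "x \<in> tuples F (far Sg f) (fdom Sg f)"
    using eval_in_car[OF struct app.hyps(3) m args] by (auto simp: tuples_def x_def)
  have "fint F f x \<noteq> None"
  proof (rule definedI[OF app.hyps(1) x])
    fix h Y assume hY: "(h, Y) \<in> H"
    have "eval Y (\<lambda>v. h (fst v) (m v)) (the (ts i)) = Some (h (fdom Sg f i) (x i))"
      if "i < far Sg f" for i
      by (rule homs_eval[OF struct hom[OF hY] app.hyps(3)[OF that] m refl args[OF that]])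
    from eval_App_eq[OF app.hyps(2) this, of f] app.prems[OF hY]
    show "fint Y f (\<lambda>i\<in>{..<far Sg f}. h (fdom Sg f i) (x i)) \<noteq> None" by simp
  qed
  moreover have "(\<lambda>i\<in>{..<far Sg f}. x i) = x" by (auto simp: x_def)
  ultimately show ?case using eval_App_eq[OF app.hyps(2) args, of f] by simp
qed simp

lemma sat_reflected:
  assumes \<phi>: "sorted_formula Sg V \<phi>" and m: "m \<in> (\<Pi> v\<in>V. car F (fst v))"
    and Y: "\<And>h Y. (h, Y) \<in> H \<Longrightarrow> sat Y (\<lambda>v. h (fst v) (m v)) \<phi>"
  shows "sat F m \<phi>"
  using \<phi> Y
proof (induction rule: sorted_formula.induct)
  case (Rel R ts)
  define x where "x = (\<lambda>i\<in>{..<rar Sg R}. the (eval F m (the (ts i))))"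
  have args: "eval F m (the (ts i)) = Some (x i)" if i: "i < rar Sg R" for i
  proof -
    have "eval F m (the (ts i)) \<noteq> None"
    proof (rule eval_defined[OF Rel.hyps(3)[OF i] m])
      fix h Y assume "(h, Y) \<in> H"
      then have "sat Y (\<lambda>v. h (fst v) (m v)) (Rel R ts)" by (rule Rel.prems)
      then obtain z where "\<forall>i\<in>dom ts. eval Y (\<lambda>v. h (fst v) (m v)) (the (ts i)) = Some (z i)"
        unfolding sat_Rel_iff by blast
      then show "eval Y (\<lambda>v. h (fst v) (m v)) (the (ts i)) \<noteq> None"
        using i Rel.hyps(2) by simp
    qed
    then show ?thesis using i by (auto simp: x_def)
  qed
  have x: "x \<in> tuples F (rar Sg R) (rdom Sg R)"
    using eval_in_car[OF struct Rel.hyps(3) m args] by (auto simp: tuples_def x_def)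
  have "x \<in> rint F R"
  proof (rule relI[OF Rel.hyps(1) x])
    fix h Y assume hY: "(h, Y) \<in> H"
    have "eval Y (\<lambda>v. h (fst v) (m v)) (the (ts i)) = Some (h (rdom Sg R i) (x i))"
      if "i < rar Sg R" for i
      by (rule homs_eval[OF struct hom[OF hY] Rel.hyps(3)[OF that] m refl args[OF that]])
    from sat_Rel_eq[OF Rel.hyps(2) this, of R] Rel.prems[OF hY]
    show "(\<lambda>i\<in>{..<rar Sg R}. h (rdom Sg R i) (x i)) \<in> rint Y R" by simp
  qed
  moreover have "(\<lambda>i\<in>{..<rar Sg R}. x i) = x" by (auto simp: x_def)
  ultimately show ?case using sat_Rel_eq[OF Rel.hyps(2) args, of R] by simp
next
  case (Eq \<tau> s \<tau>')
  have eval_eq: "eval Y (\<lambda>v. h (fst v) (m v)) \<tau> \<noteq> None \<and>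
      eval Y (\<lambda>v. h (fst v) (m v)) \<tau> = eval Y (\<lambda>v. h (fst v) (m v)) \<tau>'"
    if "(h, Y) \<in> H" for h Y using Eq.prems[OF that] by auto
  obtain y where y: "eval F m \<tau> = Some y"
    using eval_defined[OF Eq.hyps(1) m] eval_eq by blast
  have "eval Y (\<lambda>v. h (fst v) (m v)) \<tau>' \<noteq> None" if "(h, Y) \<in> H" for h Y
    using eval_eq[OF that] by (metis (no_types))
  then have "eval F m \<tau>' \<noteq> None" by (rule eval_defined[OF Eq.hyps(2) m])
  then obtain y' where y': "eval F m \<tau>' = Some y'" by blast
  have "y = y'"
  proof (rule eqI)
    show "y \<in> car F s" by (rule eval_in_car[OF struct Eq.hyps(1) m y])
    show "y' \<in> car F s" by (rule eval_in_car[OF struct Eq.hyps(2) m y'])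
    fix h Y assume hY: "(h, Y) \<in> H"
    show "h s y = h s y'"
      using homs_eval[OF struct hom[OF hY] Eq.hyps(1) m refl y]
        homs_eval[OF struct hom[OF hY] Eq.hyps(2) m refl y'] eval_eq[OF hY] by simp
  qed
  then show ?case using y y' by simp
next
  case (Conj \<phi>s)
  have "sat F m (the (\<phi>s i))" if i: "i \<in> dom \<phi>s" for i
  proof -
    have "\<phi>s i = Some (the (\<phi>s i))" using i by auto
    from Conj.IH[OF this] Conj.prems i show ?thesis by (auto simp: sat_Conj_iff)
  qed
  then show ?case by (simp add: sat_Conj_iff)
qed simp

lemma sequent_valid:
  assumes \<phi>: "sorted_formula Sg X \<phi>" and \<psi>: "sorted_formula Sg X \<psi>"
    and fvs: "fvs \<phi> \<subseteq> X" "fvs \<psi> \<subseteq> X"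
    and Y: "\<And>h Y. (h, Y) \<in> H \<Longrightarrow> valid Y (X, \<phi>, \<psi>)"
  shows "valid F (X, \<phi>, \<psi>)"
proof -
  have "sat F m \<psi>" if m: "m \<in> (\<Pi>\<^sub>E v\<in>X. car F (fst v))" and sat: "sat F m \<phi>" for m
  proof (rule sat_reflected[OF \<psi>])
    show Pi: "m \<in> (\<Pi> v\<in>X. car F (fst v))" using m by auto
    fix h Y assume hY: "(h, Y) \<in> H"
    let ?n = "map_val X h m"
    have n: "?n \<in> (\<Pi>\<^sub>E v\<in>X. car Y (fst v))"
      using homs_car[OF hom[OF hY]] m by (auto simp: map_val_def PiE_mem)
    have "sat Y ?n \<phi>"
      by (rule homs_sat[OF struct hom[OF hY] \<phi> Pi _ sat]) (simp add: map_val_def)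
    then have "sat Y ?n \<psi>" using n Y[OF hY] by (auto simp: interp_def)
    moreover have "sat Y ?n \<psi> \<longleftrightarrow> sat Y (\<lambda>v. h (fst v) (m v)) \<psi>"
      by (rule sat_cong) (use fvs(2) in \<open>auto simp: map_val_def\<close>)
    ultimately show "sat Y (\<lambda>v. h (fst v) (m v)) \<psi>" by (simp only:)
  qed
  then show ?thesis by (auto simp: interp_def)
qed

end

lemma models_struct: "M \<in> models Sg T \<Longrightarrow> partial_structure Sg M"
  by (simp add: models_def)

lemma (in jointly_reflecting) models_reflected:
  assumes T: "horn_theory \<kappa> Sg T" and Y: "\<And>h Y. (h, Y) \<in> H \<Longrightarrow> Y \<in> models Sg T"
  shows "F \<in> models Sg T"
proof -
  have "valid F (X, \<phi>, \<psi>)" if ax: "(X, \<phi>, \<psi>) \<in> T" for X \<phi> \<psi>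
  proof (rule sequent_valid)
    have "horn_formula \<kappa> Sg X \<phi>" "horn_formula \<kappa> Sg X \<psi>"
      using T ax by (auto simp: horn_theory_def)
    then show "sorted_formula Sg X \<phi>" "sorted_formula Sg X \<psi>" "fvs \<phi> \<subseteq> X" "fvs \<psi> \<subseteq> X"
      by (auto simp: horn_formula_def intro: raw_formula_sorted_formula)
    show "valid Y (X, \<phi>, \<psi>)" if "(h, Y) \<in> H" for h Y
    proof -
      have "\<forall>\<sigma>\<in>T. valid Y \<sigma>" using Y[OF that] by (simp add: models_def)
      then show ?thesis using ax by (rule bspec)
    qed
  qed
  then show ?thesis using struct by (auto simp: models_def)
qed


section \<open>Models presented by generators and relations\<close>

text \<open>
  Given a class \<open>K\<close> of valuations of \<open>V\<close> in structures, the terms that are defined under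
  all members of \<open>K\<close>, taken up to equality under all members of \<open>K\<close>, form a structure that
  is jointly reflected by its maps to the members of \<open>K\<close>. Each class is named by the code
  in \<open>'u\<close> of a chosen representative. The carriers are small because the number of classes is
  bounded by the number of terms, however large \<open>K\<close> is.
\<close>

locale term_structure =
  fixes \<kappa> :: "'u::wellorder"
    and Sg :: "('s, 'f, 'r, 'u) signature"
    and V :: "('s \<times> 'u) set"
    and K :: "(('s, 'f, 'r, 'u) struct \<times> ('s \<times> 'u \<Rightarrow> 'u)) set"
    and e :: "('s, 'f, 'u) sterm \<Rightarrow> 'u"
  assumes signature: "is_signature \<kappa> Sg"
    and V_sorts: "fst ` V \<subseteq> sorts Sg"
    and terms_small: "small TYPE('u) {t. \<exists>s. sorted_term Sg V t s}"
    and inj_e: "inj_on e {t. \<exists>s. sorted_term Sg V t s}"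
    and K_struct: "(Y, m) \<in> K \<Longrightarrow> partial_structure Sg Y"
    and K_val: "(Y, m) \<in> K \<Longrightarrow> m \<in> (\<Pi>\<^sub>E v\<in>V. car Y (fst v))"
begin

definition same :: "('s, 'f, 'u) sterm \<Rightarrow> ('s, 'f, 'u) sterm \<Rightarrow> bool" where
  "same t t' \<longleftrightarrow> (\<forall>(Y, m)\<in>K. eval Y m t = eval Y m t')"

definition defined_terms :: "'s \<Rightarrow> ('s, 'f, 'u) sterm set" where
  "defined_terms s = {t. sorted_term Sg V t s \<and> (\<forall>(Y, m)\<in>K. eval Y m t \<noteq> None)}"

definition cls :: "'s \<Rightarrow> ('s, 'f, 'u) sterm \<Rightarrow> 'u" where
  "cls s t = e (SOME t'. t' \<in> defined_terms s \<and> same t' t)"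

definition rep :: "'u \<Rightarrow> ('s, 'f, 'u) sterm" where
  "rep = inv_into {t. \<exists>s. sorted_term Sg V t s} e"

definition carrier :: "'s \<Rightarrow> 'u set" where
  "carrier s = cls s ` defined_terms s"

definition args :: "'u \<Rightarrow> ('u \<Rightarrow> 'u) \<Rightarrow> 'u \<Rightarrow> ('s, 'f, 'u) sterm option" where
  "args \<alpha> x = (\<lambda>i. if i < \<alpha> then Some (rep (x i)) else None)"

definition F :: "('s, 'f, 'r, 'u) struct" where
  "F = \<lparr>car = carrier,
     fint = (\<lambda>f x.
       if f \<in> funs Sg \<and> x \<in> (\<Pi>\<^sub>E i\<in>{..<far Sg f}. carrier (fdom Sg f i)) \<and>
          App f (args (far Sg f) x) \<in> defined_terms (fcod Sg f)
       then Some (cls (fcod Sg f) (App f (args (far Sg f) x))) else None),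
     rint = (\<lambda>R.
       if R \<in> rels Sg
       then {x \<in> \<Pi>\<^sub>E i\<in>{..<rar Sg R}. carrier (rdom Sg R i).
         \<forall>(Y, m)\<in>K. sat Y m (Rel R (args (rar Sg R) x))} else {})\<rparr>"

definition proj ::
    "('s, 'f, 'r, 'u) struct \<Rightarrow> ('s \<times> 'u \<Rightarrow> 'u) \<Rightarrow> 's \<Rightarrow> 'u \<Rightarrow> 'u" where
  "proj Y m s = (\<lambda>x\<in>carrier s. the (eval Y m (rep x)))"

definition gens :: "'s \<times> 'u \<Rightarrow> 'u" where
  "gens = (\<lambda>v\<in>V. cls (fst v) (Var v))"

lemma rep_cls:
  assumes "t \<in> defined_terms s"
  shows "rep (cls s t) \<in> defined_terms s" "same (rep (cls s t)) t"
proof -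
  let ?t = "SOME t'. t' \<in> defined_terms s \<and> same t' t"
  have "t \<in> defined_terms s \<and> same t t" using assms by (simp add: same_def)
  then have t: "?t \<in> defined_terms s \<and> same ?t t" by (rule someI)
  then have "rep (cls s t) = ?t"
    unfolding rep_def cls_def by (intro inv_into_f_f inj_e) (auto simp: defined_terms_def)
  with t show "rep (cls s t) \<in> defined_terms s" "same (rep (cls s t)) t" by simp_all
qed

lemma cls_eq: "same t t' \<Longrightarrow> cls s t = cls s t'"
proof -
  assume "same t t'"
  then have "same u t \<longleftrightarrow> same u t'" for u by (fastforce simp: same_def)
  then show "cls s t = cls s t'" by (simp add: cls_def)
qed

lemma cls_rep: "x \<in> carrier s \<Longrightarrow> cls s (rep x) = x"
  using rep_cls(2) cls_eq by (auto simp: carrier_def)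

lemma rep_defined: "x \<in> carrier s \<Longrightarrow> rep x \<in> defined_terms s"
  using rep_cls(1) by (auto simp: carrier_def)

lemma cls_carrier: "t \<in> defined_terms s \<Longrightarrow> cls s t \<in> carrier s"
  by (simp add: carrier_def)

lemma eval_rep:
  assumes "(Y, m) \<in> K" "x \<in> carrier s"
  shows "eval Y m (rep x) = Some (proj Y m s x)"
  using rep_defined[OF assms(2)] assms by (auto simp: proj_def defined_terms_def)

lemma proj_cls:
  assumes "(Y, m) \<in> K" "t \<in> defined_terms s"
  shows "eval Y m t = Some (proj Y m s (cls s t))"
proof -
  have "eval Y m (rep (cls s t)) = eval Y m t"
    using rep_cls(2)[OF assms(2)] assms(1) by (auto simp: same_def)
  then show ?thesis using eval_rep[OF assms(1) cls_carrier[OF assms(2)]] by simp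
qed

lemma dom_args: "dom (args \<alpha> x) = {..<\<alpha>}"
  by (auto simp: args_def dom_def)

lemma eval_args:
  assumes "(Y, m) \<in> K" "x \<in> (\<Pi>\<^sub>E i\<in>{..<\<alpha>}. carrier (ss i))"
  shows "eval Y m (App f (args \<alpha> x)) = fint Y f (\<lambda>i\<in>{..<\<alpha>}. proj Y m (ss i) (x i))"
  using assms by (intro eval_App_eq dom_args) (auto simp: args_def intro!: eval_rep)

lemma sat_args:
  assumes "(Y, m) \<in> K" "x \<in> (\<Pi>\<^sub>E i\<in>{..<\<alpha>}. carrier (ss i))"
  shows "sat Y m (Rel R (args \<alpha> x)) \<longleftrightarrow> (\<lambda>i\<in>{..<\<alpha>}. proj Y m (ss i) (x i)) \<in> rint Y R"
  using assms by (intro sat_Rel_eq dom_args) (auto simp: args_def intro!: eval_rep)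

lemma sorted_args:
  assumes "f \<in> funs Sg" "x \<in> (\<Pi>\<^sub>E i\<in>{..<far Sg f}. carrier (fdom Sg f i))"
  shows "sorted_term Sg V (App f (args (far Sg f) x)) (fcod Sg f)"
proof (rule sorted_term.app[OF assms(1) dom_args _ refl])
  fix i assume "i < far Sg f"
  then show "sorted_term Sg V (the (args (far Sg f) x i)) (fdom Sg f i)"
    using rep_defined[of "x i" "fdom Sg f i"] assms(2) by (auto simp: args_def defined_terms_def)
qed

lemma sorted_term_sorts: "sorted_term Sg V t s \<Longrightarrow> s \<in> sorts Sg"
  using V_sorts signature by (auto elim!: sorted_term.cases simp: is_signature_def)

lemma F_structure: "partial_structure Sg F"
proof -
  have "small TYPE('u) (carrier s)" for s
  proof -
    have "carrier s \<subseteq> e ` {t. \<exists>s. sorted_term Sg V t s}"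
    proof
      fix x assume x: "x \<in> carrier s"
      then obtain t where t: "t \<in> defined_terms s" "x = cls s t" by (auto simp: carrier_def)
      then have "t \<in> defined_terms s \<and> same t t" by (simp add: same_def)
      then have "(SOME t'. t' \<in> defined_terms s \<and> same t' t) \<in> defined_terms s"
        by (rule someI2) simp
      then show "x \<in> e ` {t. \<exists>s. sorted_term Sg V t s}"
        by (auto simp: t(2) cls_def defined_terms_def)
    qed
    then show ?thesis by (rule small_mono[OF _ small_image[OF terms_small]])
  qed
  moreover have "carrier s = {}" if "s \<notin> sorts Sg" for s
    using that sorted_term_sorts by (auto simp: carrier_def defined_terms_def)
  ultimately show ?thesis
    unfolding partial_structure_def F_def
    by (auto simp: tuples_def ran_def intro!: cls_carrier split: if_splits)
qed

lemma proj_hom: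
  assumes K: "(Y, m) \<in> K"
  shows "proj Y m \<in> homs Sg F Y"
proof -
  have Pi: "m \<in> (\<Pi> v\<in>V. car Y (fst v))" using K_val[OF K] by auto
  have car: "proj Y m s x \<in> car Y s" if "x \<in> carrier s" for s x
    using eval_in_car[OF K_struct[OF K] _ Pi eval_rep[OF K that]] rep_defined[OF that]
    by (auto simp: defined_terms_def)
  have "proj Y m s \<in> car F s \<rightarrow>\<^sub>E car Y s" for s
    using car by (auto simp: F_def proj_def)
  moreover have "fint Y f (\<lambda>i\<in>{..<far Sg f}. proj Y m (fdom Sg f i) (x i)) =
      Some (proj Y m (fcod Sg f) y)"
    if "f \<in> funs Sg" "x \<in> tuples F (far Sg f) (fdom Sg f)" "fint F f x = Some y" for f x y
  proof -
    have x: "x \<in> (\<Pi>\<^sub>E i\<in>{..<far Sg f}. carrier (fdom Sg f i))"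
      using that(2) by (simp add: tuples_def F_def)
    have D: "App f (args (far Sg f) x) \<in> defined_terms (fcod Sg f)"
      and y: "y = cls (fcod Sg f) (App f (args (far Sg f) x))"
      using that(3) by (auto simp: F_def split: if_splits)
    show ?thesis using proj_cls[OF K D] eval_args[OF K x, of f] y by simp
  qed
  moreover have "(\<lambda>i\<in>{..<rar Sg R}. proj Y m (rdom Sg R i) (x i)) \<in> rint Y R"
    if "R \<in> rels Sg" "x \<in> rint F R" for R x
  proof -
    have x: "x \<in> (\<Pi>\<^sub>E i\<in>{..<rar Sg R}. carrier (rdom Sg R i))"
      and "sat Y m (Rel R (args (rar Sg R) x))"
      using that K by (auto simp: F_def)
    then show ?thesis using sat_args[OF K x] by simp
  qed
  ultimately show ?thesis unfolding homs_def by blast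
qed

sublocale jointly_reflecting Sg F "(\<lambda>(Y, m). (proj Y m, Y)) ` K"
proof
  show "partial_structure Sg F" by (rule F_structure)
next
  fix h Y assume "(h, Y) \<in> (\<lambda>(Y, m). (proj Y m, Y)) ` K"
  then show "h \<in> homs Sg F Y" using proj_hom by auto
next
  fix x y s
  assume xy: "x \<in> car F s" "y \<in> car F s"
    and eq: "\<And>h Y. (h, Y) \<in> (\<lambda>(Y, m). (proj Y m, Y)) ` K \<Longrightarrow> h s x = h s y"
  have x: "x \<in> carrier s" and y: "y \<in> carrier s" using xy by (simp_all add: F_def)
  have "eval Y m (rep x) = eval Y m (rep y)" if K: "(Y, m) \<in> K" for Y m
    using eq[of "proj Y m" Y] K by (force simp: eval_rep[OF K x] eval_rep[OF K y])
  then have "same (rep x) (rep y)" by (auto simp: same_def)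
  then show "x = y" using cls_eq[of "rep x" "rep y" s] cls_rep[OF x] cls_rep[OF y] by simp
next
  fix f x
  assume f: "f \<in> funs Sg" and tup: "x \<in> tuples F (far Sg f) (fdom Sg f)"
    and def: "\<And>h Y. (h, Y) \<in> (\<lambda>(Y, m). (proj Y m, Y)) ` K \<Longrightarrow>
      fint Y f (\<lambda>i\<in>{..<far Sg f}. h (fdom Sg f i) (x i)) \<noteq> None"
  have x: "x \<in> (\<Pi>\<^sub>E i\<in>{..<far Sg f}. carrier (fdom Sg f i))"
    using tup by (simp add: tuples_def F_def)
  have "eval Y m (App f (args (far Sg f) x)) \<noteq> None" if K: "(Y, m) \<in> K" for Y m
    using def[of "proj Y m" Y] K eval_args[OF K x] by force
  then have "App f (args (far Sg f) x) \<in> defined_terms (fcod Sg f)"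
    using sorted_args[OF f x] by (auto simp: defined_terms_def)
  then show "fint F f x \<noteq> None" using f x by (simp add: F_def)
next
  fix R x
  assume R: "R \<in> rels Sg" and "x \<in> tuples F (rar Sg R) (rdom Sg R)"
    and def: "\<And>h Y. (h, Y) \<in> (\<lambda>(Y, m). (proj Y m, Y)) ` K \<Longrightarrow>
      (\<lambda>i\<in>{..<rar Sg R}. h (rdom Sg R i) (x i)) \<in> rint Y R"
  then have x: "x \<in> (\<Pi>\<^sub>E i\<in>{..<rar Sg R}. carrier (rdom Sg R i))" by (simp add: tuples_def F_def)
  have "sat Y m (Rel R (args (rar Sg R) x))" if K: "(Y, m) \<in> K" for Y m
    using def[of "proj Y m" Y] K sat_args[OF K x] by force
  then show "x \<in> rint F R" using R x by (auto simp: F_def)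
qed

lemma gens_val: "gens \<in> (\<Pi>\<^sub>E v\<in>V. car F (fst v))"
  and map_val_proj_gens: "(Y, m) \<in> K \<Longrightarrow> map_val V (proj Y m) gens = m"
proof -
  have gen: "Var v \<in> defined_terms (fst v)" if "v \<in> V" for v
    using that by (auto simp: defined_terms_def intro: sorted_term.var)
  then show "gens \<in> (\<Pi>\<^sub>E v\<in>V. car F (fst v))"
    by (auto simp: gens_def F_def intro!: cls_carrier)
  assume K: "(Y, m) \<in> K"
  show "map_val V (proj Y m) gens = m"
  proof
    fix v show "map_val V (proj Y m) gens v = m v"
    proof (cases "v \<in> V")
      case True
      then show ?thesis using proj_cls[OF K gen[OF True]] by (simp add: map_val_def gens_def)
    next
      case False
      then show ?thesis using PiE_arb[OF K_val[OF K]] by (simp add: map_val_def)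
    qed
  qed
qed

lemma eval_gens:
  assumes "(Y, m) \<in> K" "fv t \<subseteq> V"
  shows "eval Y (\<lambda>v. proj Y m (fst v) (gens v)) t = eval Y m t"
proof (rule eval_cong)
  fix v assume "v \<in> fv t"
  then have "v \<in> V" using assms(2) by blast
  then show "proj Y m (fst v) (gens v) = m v"
    using fun_cong[OF map_val_proj_gens[OF assms(1)], of v] by (simp add: map_val_def)
qed

lemma sat_gens:
  assumes \<phi>: "sorted_formula Sg V \<phi>" "fvs \<phi> \<subseteq> V" and sat: "\<And>Y m. (Y, m) \<in> K \<Longrightarrow> sat Y m \<phi>"
  shows "sat F gens \<phi>"
proof (rule sat_reflected[OF \<phi>(1)])
  show "gens \<in> (\<Pi> v\<in>V. car F (fst v))" using gens_val by auto
  fix h Y assume "(h, Y) \<in> (\<lambda>(Y, m). (proj Y m, Y)) ` K"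
  then obtain m where K: "(Y, m) \<in> K" and h: "h = proj Y m" by auto
  have "sat Y (\<lambda>v. proj Y m (fst v) (gens v)) \<phi> = sat Y m \<phi>"
  proof (rule sat_cong)
    fix v assume "v \<in> fvs \<phi>"
    then have "v \<in> V" using \<phi>(2) by blast
    then show "proj Y m (fst v) (gens v) = m v"
      using fun_cong[OF map_val_proj_gens[OF K], of v] by (simp add: map_val_def)
  qed
  then show "sat Y (\<lambda>v. h (fst v) (gens v)) \<phi>" using sat[OF K] h by simp
qed

text \<open>
  A term that is defined under all members of \<open>K\<close> is defined in \<open>F\<close> and denotes its own class, since
  all maps of the family agree on this; hence \<open>F\<close> is generated by the classes of variables.
\<close>

lemma generated:
  assumes x: "x \<in> car F s"
  shows "sorted_term Sg V (rep x) s" "eval F gens (rep x) = Some x"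
proof -
  have c: "x \<in> carrier s" using x by (simp add: F_def)
  show t: "sorted_term Sg V (rep x) s" using rep_defined[OF c] by (simp add: defined_terms_def)
  have Pi: "gens \<in> (\<Pi> v\<in>V. car F (fst v))" using gens_val by auto
  have "eval F gens (rep x) \<noteq> None"
  proof (rule eval_defined[OF t Pi])
    fix h Y assume "(h, Y) \<in> (\<lambda>(Y, m). (proj Y m, Y)) ` K"
    then obtain m where K: "(Y, m) \<in> K" and h: "h = proj Y m" by auto
    then show "eval Y (\<lambda>v. h (fst v) (gens v)) (rep x) \<noteq> None"
      using eval_gens[OF K sorted_term_fv[OF t]] eval_rep[OF K c] by simp
  qed
  then obtain y where y: "eval F gens (rep x) = Some y" by blast
  have "y = x"
  proof (rule eqI[OF _ x])
    show "y \<in> car F s" by (rule eval_in_car[OF struct t Pi y])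
    fix h Y assume hY: "(h, Y) \<in> (\<lambda>(Y, m). (proj Y m, Y)) ` K"
    then obtain m where K: "(Y, m) \<in> K" and h: "h = proj Y m" by auto
    show "h s y = h s x"
      using homs_eval[OF struct proj_hom[OF K] t Pi refl y]
        eval_gens[OF K sorted_term_fv[OF t]] eval_rep[OF K c] h by simp
  qed
  with y show "eval F gens (rep x) = Some x" by simp
qed

end

definition solutions ::
    "('s, 'f, 'r, 'u::wellorder) signature \<Rightarrow> ('s, 'f, 'r, 'u) sequent set \<Rightarrow> ('s \<times> 'u) set \<Rightarrow>
     ('s, 'f, 'r, 'u) sformula set \<Rightarrow> (('s, 'f, 'r, 'u) struct \<times> ('s \<times> 'u \<Rightarrow> 'u)) set" where
  "solutions Sg T V \<Phi> =
     {(Y, m). Y \<in> models Sg T \<and> m \<in> (\<Pi>\<^sub>E v\<in>V. car Y (fst v)) \<and> (\<forall>\<phi>\<in>\<Phi>. sat Y m \<phi>)}"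

text \<open>
  The universal property has two halves. That homomorphisms to solutions exist is part of the definition;
  that they are unique follows from generation by \<open>V\<close>, which is recorded in their place because it
  also names every element by a term.
\<close>

definition presents ::
    "('s, 'f, 'r, 'u::wellorder) signature \<Rightarrow> ('s, 'f, 'r, 'u) sequent set \<Rightarrow> ('s \<times> 'u) set \<Rightarrow>
     ('s, 'f, 'r, 'u) sformula set \<Rightarrow> ('s, 'f, 'r, 'u) struct \<Rightarrow> ('s \<times> 'u \<Rightarrow> 'u) \<Rightarrow> bool" where
  "presents Sg T V \<Phi> A \<eta> \<longleftrightarrow>
     (A, \<eta>) \<in> solutions Sg T V \<Phi> \<and>
     (\<forall>s. \<forall>x\<in>car A s. \<exists>t. sorted_term Sg V t s \<and> eval A \<eta> t = Some x) \<and>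
     (\<forall>(Y, m)\<in>solutions Sg T V \<Phi>. \<exists>h\<in>homs Sg A Y. map_val V h \<eta> = m)"

lemma presents_solution: "presents Sg T V \<Phi> A \<eta> \<Longrightarrow> (A, \<eta>) \<in> solutions Sg T V \<Phi>"
  by (simp add: presents_def)

lemma presents_generated:
  assumes "presents Sg T V \<Phi> A \<eta>" "x \<in> car A s"
  obtains t where "sorted_term Sg V t s" "eval A \<eta> t = Some x"
  using assms unfolding presents_def by blast

lemma presents_homE:
  assumes "presents Sg T V \<Phi> A \<eta>" "(Y, m) \<in> solutions Sg T V \<Phi>"
  obtains h where "h \<in> homs Sg A Y" "map_val V h \<eta> = m"
proof -
  have "\<forall>(Y, m)\<in>solutions Sg T V \<Phi>. \<exists>h\<in>homs Sg A Y. map_val V h \<eta> = m"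
    using assms(1) by (simp add: presents_def)
  from bspec[OF this assms(2)] show thesis using that by auto
qed

lemma presentation_exists:
  fixes V :: "('s \<times> 'u::wellorder) set"
  assumes U: "universe TYPE('u)" and Sg: "is_signature \<kappa> Sg" and T: "horn_theory \<kappa> Sg T"
    and V: "small TYPE('u) V" "fst ` V \<subseteq> sorts Sg"
    and \<Phi>: "\<And>\<phi>. \<phi> \<in> \<Phi> \<Longrightarrow> sorted_formula Sg V \<phi>"
  shows "\<exists>A \<eta>. presents Sg T V \<Phi> A \<eta>"
proof -
  have terms: "small TYPE('u) {t. \<exists>s. sorted_term Sg V t s}"
    by (rule small_sorted_terms[OF U Sg V(1)])
  obtain e :: "_ \<Rightarrow> 'u" where e: "inj_on e {t. \<exists>s. sorted_term Sg V t s}"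
    by (rule small_embeds[OF terms])
  interpret term_structure \<kappa> Sg V "solutions Sg T V \<Phi>" e
    by unfold_locales (use Sg V(2) terms e in \<open>auto simp: solutions_def models_struct\<close>)
  have "F \<in> models Sg T"
    by (rule models_reflected[OF T]) (auto simp: solutions_def)
  moreover have "sat F gens \<phi>" if "\<phi> \<in> \<Phi>" for \<phi>
    by (rule sat_gens[OF \<Phi>[OF that] sorted_formula_fvs[OF \<Phi>[OF that]]])
      (use that in \<open>auto simp: solutions_def\<close>)
  ultimately have "(F, gens) \<in> solutions Sg T V \<Phi>" using gens_val by (simp add: solutions_def)
  moreover have "\<exists>h\<in>homs Sg F Y. map_val V h gens = m" if "(Y, m) \<in> solutions Sg T V \<Phi>" for Y m
    using proj_hom[OF that] map_val_proj_gens[OF that] by blast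
  ultimately have "presents Sg T V \<Phi> F gens"
    using generated unfolding presents_def by blast
  then show ?thesis by blast
qed

lemma presents_hom_unique:
  assumes A: "presents Sg T V \<Phi> A \<eta>" and h: "h \<in> homs Sg A Y" and k: "k \<in> homs Sg A Y"
    and eq: "\<And>v. v \<in> V \<Longrightarrow> h (fst v) (\<eta> v) = k (fst v) (\<eta> v)"
  shows "h = k"
proof (rule homs_eqI[OF h k])
  have struct: "partial_structure Sg A" and \<eta>: "\<eta> \<in> (\<Pi> v\<in>V. car A (fst v))"
    using A by (auto simp: presents_def solutions_def models_struct)
  fix s x assume "x \<in> car A s"
  then obtain t where t: "sorted_term Sg V t s" "eval A \<eta> t = Some x"
    by (rule presents_generated[OF A])
  show "h s x = k s x"
    using homs_eval[OF struct h t(1) \<eta> refl t(2)] homs_eval[OF struct k t(1) \<eta> eq t(2)] by simp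
qed


section \<open>The category of models\<close>

abbreviation hom_comp ::
    "('s, 'f, 'r, 'u) struct \<Rightarrow> ('s \<Rightarrow> 'u \<Rightarrow> 'u) \<Rightarrow> ('s \<Rightarrow> 'u \<Rightarrow> 'u) \<Rightarrow> 's \<Rightarrow> 'u \<Rightarrow> 'u" where
  "hom_comp M k h \<equiv> (\<lambda>s. compose (car M s) (k s) (h s))"

abbreviation hom_id :: "('s, 'f, 'r, 'u) struct \<Rightarrow> 's \<Rightarrow> 'u \<Rightarrow> 'u" where
  "hom_id M \<equiv> (\<lambda>s. \<lambda>x\<in>car M s. x)"

lemma PMod_simps [simp]:
  "Ob (PMod Sg T) = models Sg T"
  "(M, h, N) \<in> Ar (PMod Sg T) \<longleftrightarrow> M \<in> models Sg T \<and> N \<in> models Sg T \<and> h \<in> homs Sg M N"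
  "Dom (PMod Sg T) (M, h, N) = M"
  "Cod (PMod Sg T) (M, h, N) = N"
  "Id (PMod Sg T) M = (M, hom_id M, M)"
  "Comp (PMod Sg T) (N', k, P) (M, h, N) = (M, hom_comp M k h, P)"
  by (simp_all add: PMod_def)

lemma PMod_hom_iff [simp]:
  "(M', h, N') \<in> hom (PMod Sg T) M N \<longleftrightarrow>
    M' = M \<and> N' = N \<and> M \<in> models Sg T \<and> N \<in> models Sg T \<and> h \<in> homs Sg M N"
  by (auto simp: hom_def)

lemma PMod_homE:
  assumes "q \<in> hom (PMod Sg T) M N"
  obtains h where "q = (M, h, N)" "M \<in> models Sg T" "N \<in> models Sg T" "h \<in> homs Sg M N"
  using assms by (cases q) auto

lemma PMod_ArE:
  assumes "q \<in> Ar (PMod Sg T)"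
  obtains M h N where "q = (M, h, N)" "M \<in> models Sg T" "N \<in> models Sg T" "h \<in> homs Sg M N"
  using assms by (cases q) auto

lemma hom_comp_homs:
  assumes "M \<in> models Sg T" "N \<in> models Sg T" "h \<in> homs Sg M N" "k \<in> homs Sg N P"
  shows "hom_comp M k h \<in> homs Sg M P"
  using homs_compose[OF assms(3,4) models_struct[OF assms(1)] models_struct[OF assms(2)]] .

lemma hom_id_homs:
  assumes "partial_structure Sg M"
  shows "hom_id M \<in> homs Sg M M"
proof -
  have "(\<lambda>i\<in>{..<\<alpha>}. hom_id M (ss i) (x i)) = x" if "x \<in> tuples M \<alpha> ss" for x \<alpha> ss
    using that by (auto simp: tuples_def PiE_def extensional_def fun_eq_iff)
  moreover have "y \<in> car M (fcod Sg f)" if "f \<in> funs Sg" "fint M f x = Some y" for f x y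
    using assms that ranI unfolding partial_structure_def by (metis subsetD)
  moreover have "x \<in> tuples M (rar Sg R) (rdom Sg R)" if "R \<in> rels Sg" "x \<in> rint M R" for R x
    using assms that unfolding partial_structure_def by blast
  ultimately show ?thesis by (auto simp: homs_def)
qed

lemma map_val_apply: "v \<in> X \<Longrightarrow> map_val X h m v = h (fst v) (m v)"
  by (simp add: map_val_def)

lemma homs_sat_map_val:
  assumes "partial_structure Sg M" "h \<in> homs Sg M N" "sorted_formula Sg V \<phi>"
    "m \<in> (\<Pi> v\<in>V. car M (fst v))" "sat M m \<phi>"
  shows "sat N (map_val V h m) \<phi>"
  using assms(1-4) _ assms(5) by (rule homs_sat) (rule map_val_apply)

lemma homs_eval_map_val:
  assumes "partial_structure Sg M" "h \<in> homs Sg M N" "sorted_term Sg V t s"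
    "m \<in> (\<Pi> v\<in>V. car M (fst v))" "eval M m t = Some y"
  shows "eval N (map_val V h m) t = Some (h s y)"
  using assms(1-4) _ assms(5) by (rule homs_eval) (rule map_val_apply)

lemma map_val_PiE:
  assumes "h \<in> homs Sg M N" "m \<in> (\<Pi> v\<in>X. car M (fst v))"
  shows "map_val X h m \<in> (\<Pi>\<^sub>E v\<in>X. car N (fst v))"
  using homs_car[OF assms(1)] assms(2) by (auto simp: map_val_def Pi_iff)

lemma map_val_hom_comp:
  assumes "m \<in> (\<Pi> v\<in>X. car M (fst v))"
  shows "map_val X (hom_comp M k h) m = map_val X k (map_val X h m)"
  using assms by (auto simp: map_val_def compose_def fun_eq_iff Pi_iff)

lemma map_val_hom_id:
  assumes "m \<in> (\<Pi>\<^sub>E v\<in>X. car M (fst v))"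
  shows "map_val X (hom_id M) m = m"
proof
  fix v show "map_val X (hom_id M) m v = m v"
    using PiE_mem[OF assms, of v] PiE_arb[OF assms, of v] by (cases "v \<in> X") (simp_all add: map_val_def)
qed


section \<open>Representing models and the epimorphisms of a scale\<close>

lemma context_small:
  fixes \<kappa> :: "'u::wellorder"
  assumes U: "universe TYPE('u)" and Sg: "is_signature \<kappa> Sg" and X: "is_context \<kappa> Sg X"
  shows "small TYPE('u) X"
proof (rule small_mono)
  show "X \<subseteq> sorts Sg \<times> {..<\<kappa>}" using X by (simp add: is_context_def)
  have "small TYPE('u) (sorts Sg)" using Sg by (simp add: is_signature_def)
  then show "small TYPE('u) (sorts Sg \<times> {..<\<kappa>})" by (rule small_Times[OF U _ small_lessThan[OF U]])
qed

lemma represents_exists: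
  fixes \<kappa> :: "'u::wellorder"
  assumes U: "universe TYPE('u)" and Sg: "is_signature \<kappa> Sg" and T: "horn_theory \<kappa> Sg T"
    and \<phi>: "horn_formula \<kappa> Sg X \<phi>"
  shows "\<exists>A a. represents Sg T X \<phi> A a"
proof -
  have X: "is_context \<kappa> Sg X" using \<phi> by (simp add: horn_formula_def)
  have "sorted_formula Sg X \<phi>"
    using \<phi> by (auto simp: horn_formula_def intro: raw_formula_sorted_formula)
  then have "\<exists>A a. presents Sg T X {\<phi>} A a"
    by (intro presentation_exists[OF U Sg T context_small[OF U Sg X]])
      (use X in \<open>auto simp: is_context_def\<close>)
  then obtain A a where A: "presents Sg T X {\<phi>} A a" by blast
  have sol: "(M, m) \<in> solutions Sg T X {\<phi>} \<longleftrightarrow> M \<in> models Sg T \<and> m \<in> interp M X \<phi>" for M m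
    by (auto simp: solutions_def interp_def)
  have "\<exists>!h. h \<in> homs Sg A M \<and> map_val X h a = m"
    if "M \<in> models Sg T" "m \<in> interp M X \<phi>" for M m
  proof -
    have "\<exists>h\<in>homs Sg A M. map_val X h a = m"
      using presents_homE[OF A, of M m] that sol[of M m] by blast
    moreover have "h = k" if "h \<in> homs Sg A M \<and> map_val X h a = m"
        "k \<in> homs Sg A M \<and> map_val X k a = m" for h k
      using that presents_hom_unique[OF A, of h M k] map_val_apply by metis
    ultimately show ?thesis by blast
  qed
  moreover have "A \<in> models Sg T \<and> a \<in> interp A X \<phi>"
    using presents_solution[OF A] sol by simp
  ultimately have "represents Sg T X \<phi> A a" unfolding represents_def by blast
  then show ?thesis by blast
qed

lemma represents_representation:
  assumes "\<exists>A a. represents Sg T X \<phi> A a"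
  obtains A a where "representation Sg T X \<phi> = (A, a)" "represents Sg T X \<phi> A a"
proof -
  have "case representation Sg T X \<phi> of (A, a) \<Rightarrow> represents Sg T X \<phi> A a"
    unfolding representation_def by (rule someI_ex) (use assms in auto)
  then show thesis using that by (cases "representation Sg T X \<phi>") auto
qed

lemma represents_homE:
  assumes "represents Sg T X \<phi> A a" "M \<in> models Sg T" "m \<in> interp M X \<phi>"
  obtains h where "h \<in> homs Sg A M" "map_val X h a = m"
  using assms unfolding represents_def by blast

lemma represents_unique:
  assumes A: "represents Sg T X \<phi> A a" and \<phi>: "sorted_formula Sg X \<phi>" and M: "M \<in> models Sg T"
    and h: "h \<in> homs Sg A M" and k: "k \<in> homs Sg A M" and eq: "map_val X h a = map_val X k a"
  shows "h = k"
proof -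
  have a: "a \<in> (\<Pi>\<^sub>E v\<in>X. car A (fst v))" "sat A a \<phi>" and struct: "partial_structure Sg A"
    using A by (auto simp: represents_def interp_def models_struct)
  have Pi: "a \<in> (\<Pi> v\<in>X. car A (fst v))" using a(1) by auto
  have "sat M (map_val X h a) \<phi>"
    by (rule homs_sat_map_val[OF struct h \<phi> Pi a(2)])
  then have "map_val X h a \<in> interp M X \<phi>"
    using map_val_PiE[OF h Pi] by (simp add: interp_def)
  then have "\<exists>!h'. h' \<in> homs Sg A M \<and> map_val X h' a = map_val X h a"
    using A M unfolding represents_def by blast
  then show ?thesis using h k eq by metis
qed

locale scaled_theory =
  fixes \<kappa> :: "'u::wellorder"
    and Sg :: "('s, 'f, 'r, 'u) signature"
    and T :: "('s, 'f, 'r, 'u) sequent set"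
    and L :: "('l, 's, 'f, 'r, 'u) scale"
  assumes universe: "universe TYPE('u)"
    and signature: "is_signature \<kappa> Sg"
    and horn: "horn_theory \<kappa> Sg T"
    and scale: "is_scale \<kappa> Sg L"
begin

abbreviation scale_vars :: "'l \<Rightarrow> ('s \<times> 'u) set" where
  "scale_vars l \<equiv> set (sctx L l)"

abbreviation tuples_of :: "('s, 'f, 'r, 'u) struct \<Rightarrow> 'l \<Rightarrow> ('s \<times> 'u \<Rightarrow> 'u) set" where
  "tuples_of M l \<equiv> (\<Pi>\<^sub>E v\<in>scale_vars l. car M (fst v))"

lemma scale_horn: "l \<in> idx L \<Longrightarrow> horn_formula \<kappa> Sg (scale_vars l) (sfm L l)"
  using scale by (simp add: is_scale_def)

lemma scale_sorted: "l \<in> idx L \<Longrightarrow> sorted_formula Sg (scale_vars l) (sfm L l)"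
  using scale_horn[of l] by (auto simp: horn_formula_def intro: raw_formula_sorted_formula)

lemma scale_fvs: "l \<in> idx L \<Longrightarrow> fvs (sfm L l) \<subseteq> scale_vars l"
  using scale_horn[of l] by (simp add: horn_formula_def)

lemma inclusion_epiE:
  assumes l: "l \<in> idx L"
  obtains A a B b h where
    "inclusion_epi Sg T (scale_vars l) (sfm L l) = (A, h, B)"
    "represents Sg T (scale_vars l) Top A a" "represents Sg T (scale_vars l) (sfm L l) B b"
    "h \<in> homs Sg A B" "map_val (scale_vars l) h a = b"
proof -
  have "horn_formula \<kappa> Sg (scale_vars l) Top"
    using scale_horn[OF l] by (auto simp: horn_formula_def intro: raw_formula.intros)
  from represents_exists[OF universe signature horn this]
  obtain A a where A: "representation Sg T (scale_vars l) Top = (A, a)"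
    "represents Sg T (scale_vars l) Top A a"
    by (rule represents_representation)
  from represents_exists[OF universe signature horn scale_horn[OF l]]
  obtain B b where B: "representation Sg T (scale_vars l) (sfm L l) = (B, b)"
    "represents Sg T (scale_vars l) (sfm L l) B b"
    by (rule represents_representation)
  have "B \<in> models Sg T" "b \<in> interp B (scale_vars l) Top"
    using B(2) by (auto simp: represents_def interp_def)
  then have ex1: "\<exists>!h. h \<in> homs Sg A B \<and> map_val (scale_vars l) h a = b"
    using A(2) unfolding represents_def by blast
  then obtain h where h: "h \<in> homs Sg A B" "map_val (scale_vars l) h a = b" by blast
  have "(THE h. h \<in> homs Sg A B \<and> map_val (scale_vars l) h a = b) = h"
    by (rule the1_equality[OF ex1]) (intro conjI h)
  then have "inclusion_epi Sg T (scale_vars l) (sfm L l) = (A, h, B)"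
    by (simp add: inclusion_epi_def A(1) B(1))
  then show thesis by (rule that[OF _ A(2) B(2) h])
qed

text \<open>Factorization through the epimorphism of \<open>l\<close> is satisfaction of the formula of \<open>l\<close>.\<close>

lemma factors_through_iff_sat:
  assumes l: "l \<in> idx L" and A: "represents Sg T (scale_vars l) Top A a"
    and B: "represents Sg T (scale_vars l) (sfm L l) B b"
    and h: "h \<in> homs Sg A B" "map_val (scale_vars l) h a = b"
    and M: "M \<in> models Sg T" and u: "u \<in> homs Sg A M"
  shows "factors_through (PMod Sg T) (A, u, M) (A, h, B) \<longleftrightarrow>
    sat M (map_val (scale_vars l) u a) (sfm L l)"
proof
  let ?Z = "scale_vars l"
  have mods: "A \<in> models Sg T" "B \<in> models Sg T" using A B by (auto simp: represents_def)
  have a: "a \<in> (\<Pi> v\<in>?Z. car A (fst v))" using A by (auto simp: represents_def interp_def)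
  have b: "b \<in> (\<Pi> v\<in>?Z. car B (fst v))" "sat B b (sfm L l)"
    using B by (auto simp: represents_def interp_def)
  show "sat M (map_val ?Z u a) (sfm L l)"
    if fac: "factors_through (PMod Sg T) (A, u, M) (A, h, B)"
  proof -
    obtain w' where w': "w' \<in> hom (PMod Sg T) B M" "Comp (PMod Sg T) w' (A, h, B) = (A, u, M)"
      using fac unfolding factors_through_def PMod_simps by blast
    from w'(1) obtain w where "w' = (B, w, M)" "w \<in> homs Sg B M" by (rule PMod_homE)
    with w'(2) have w: "w \<in> homs Sg B M" "hom_comp A w h = u" by simp_all
    have eq: "map_val ?Z u a = map_val ?Z w b"
      using map_val_hom_comp[OF a, of w h] h(2) w(2) by simp
    show ?thesis
      unfolding eq
      by (rule homs_sat_map_val[OF models_struct[OF mods(2)] w(1) scale_sorted[OF l] b])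
  qed
  show "factors_through (PMod Sg T) (A, u, M) (A, h, B)"
    if "sat M (map_val ?Z u a) (sfm L l)"
  proof -
    have "map_val ?Z u a \<in> interp M ?Z (sfm L l)"
      using that map_val_PiE[OF u a] by (simp add: interp_def)
    from represents_homE[OF B M this] obtain w where
      w: "w \<in> homs Sg B M" "map_val ?Z w b = map_val ?Z u a" .
    have "hom_comp A w h = u"
    proof (rule represents_unique[OF A sorted_formula.Top M hom_comp_homs[OF mods h(1) w(1)] u])
      show "map_val ?Z (hom_comp A w h) a = map_val ?Z u a"
        using map_val_hom_comp[OF a, of w h] h(2) w(2) by simp
    qed
    then show ?thesis
      using w(1) M mods unfolding factors_through_def by (intro bexI[of _ "(B, w, M)"]) simp_all
  qed
qed

text \<open>
  In the condition defining regular epimorphisms, the morphisms out of the representing models may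
  thus be replaced by tuples of elements.
\<close>

definition carries_scale ::
    "('s, 'f, 'r, 'u) struct \<Rightarrow> ('s \<Rightarrow> 'u \<Rightarrow> 'u) \<Rightarrow> ('s, 'f, 'r, 'u) struct \<Rightarrow>
     ('s \<Rightarrow> 'u \<Rightarrow> 'u) \<Rightarrow> ('s, 'f, 'r, 'u) struct \<Rightarrow> bool" where
  "carries_scale P q Q g Y \<longleftrightarrow> (\<forall>l\<in>idx L. \<forall>m\<in>tuples_of P l.
     sat Q (map_val (scale_vars l) q m) (sfm L l) \<longrightarrow>
     sat Y (map_val (scale_vars l) g m) (sfm L l))"

lemma carries_scale_iff:
  assumes P: "P \<in> models Sg T" and Q: "Q \<in> models Sg T" and Y: "Y \<in> models Sg T"
    and q: "q \<in> homs Sg P Q" and g: "g \<in> homs Sg P Y"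
  shows "(\<forall>e\<in>scale_epis Sg T L. \<forall>u\<in>hom (PMod Sg T) (Dom (PMod Sg T) e) P.
      factors_through (PMod Sg T) (Comp (PMod Sg T) (P, q, Q) u) e \<longrightarrow>
      factors_through (PMod Sg T) (Comp (PMod Sg T) (P, g, Y) u) e) \<longleftrightarrow> carries_scale P q Q g Y"
    (is "?L \<longleftrightarrow> _")
proof -
  have one: "(\<forall>u\<in>hom (PMod Sg T) (Dom (PMod Sg T) e) P.
      factors_through (PMod Sg T) (Comp (PMod Sg T) (P, q, Q) u) e \<longrightarrow>
      factors_through (PMod Sg T) (Comp (PMod Sg T) (P, g, Y) u) e) \<longleftrightarrow>
    (\<forall>m\<in>tuples_of P l. sat Q (map_val (scale_vars l) q m) (sfm L l) \<longrightarrow>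
      sat Y (map_val (scale_vars l) g m) (sfm L l))" (is "?F \<longleftrightarrow> ?S")
    if l: "l \<in> idx L" and e_def: "e = inclusion_epi Sg T (scale_vars l) (sfm L l)" for l e
  proof -
    let ?Z = "scale_vars l"
    obtain A a B b h where e: "e = (A, h, B)"
      and A: "represents Sg T ?Z Top A a" and B: "represents Sg T ?Z (sfm L l) B b"
      and h: "h \<in> homs Sg A B" "map_val ?Z h a = b"
      using inclusion_epiE[OF l] unfolding e_def by metis
    have Am: "A \<in> models Sg T" using A by (simp add: represents_def)
    have a: "a \<in> (\<Pi> v\<in>?Z. car A (fst v))" using A by (auto simp: represents_def interp_def)
    have fact: "factors_through (PMod Sg T) (A, hom_comp A k u, N) e \<longleftrightarrow>
        sat N (map_val ?Z k (map_val ?Z u a)) (sfm L l)"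
      if "N \<in> models Sg T" "k \<in> homs Sg P N" "u \<in> homs Sg A P" for N k u
      using factors_through_iff_sat[OF l A B h that(1) hom_comp_homs[OF Am P that(3,2)]]
      unfolding e map_val_hom_comp[OF a] .
    show ?thesis
    proof
      assume F: ?F
      show ?S
      proof (intro ballI impI)
        fix m assume m: "m \<in> tuples_of P l" and sat: "sat Q (map_val ?Z q m) (sfm L l)"
        then have "m \<in> interp P ?Z Top" by (simp add: interp_def)
        from represents_homE[OF A P this] obtain u where
          u: "u \<in> homs Sg A P" "map_val ?Z u a = m" .
        have "(A, u, P) \<in> hom (PMod Sg T) (Dom (PMod Sg T) e) P"
          using Am P u(1) by (simp add: e)
        from F[rule_format, OF this] show "sat Y (map_val ?Z g m) (sfm L l)"
          using fact[OF Q q u(1)] fact[OF Y g u(1)] sat by (simp add: u(2))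
      qed
    next
      assume S: ?S
      show ?F
      proof (intro ballI impI)
        fix u' assume "u' \<in> hom (PMod Sg T) (Dom (PMod Sg T) e) P"
          and fac: "factors_through (PMod Sg T) (Comp (PMod Sg T) (P, q, Q) u') e"
        then obtain u where u': "u' = (A, u, P)" and u: "u \<in> homs Sg A P"
          by (auto simp: e elim: PMod_homE)
        show "factors_through (PMod Sg T) (Comp (PMod Sg T) (P, g, Y) u') e"
          using fac fact[OF Q q u] fact[OF Y g u] S[rule_format, OF map_val_PiE[OF u a]]
          by (simp add: u')
      qed
    qed
  qed
  have "?L \<longleftrightarrow> (\<forall>l\<in>idx L. \<forall>u\<in>hom (PMod Sg T)
      (Dom (PMod Sg T) (inclusion_epi Sg T (scale_vars l) (sfm L l))) P.
      factors_through (PMod Sg T) (Comp (PMod Sg T) (P, q, Q) u)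
        (inclusion_epi Sg T (scale_vars l) (sfm L l)) \<longrightarrow>
      factors_through (PMod Sg T) (Comp (PMod Sg T) (P, g, Y) u)
        (inclusion_epi Sg T (scale_vars l) (sfm L l)))"
    by (simp only: scale_epis_def ball_simps)
  also have "\<dots> \<longleftrightarrow> carries_scale P q Q g Y"
    unfolding carries_scale_def by (rule ball_cong[OF refl]) (rule one[OF _ refl])
  finally show ?thesis .
qed

abbreviation regular_epis :: "('s, 'f, 'r, 'u) model_arrow set" where
  "regular_epis \<equiv> Reg (PMod Sg T) (scale_epis Sg T L)"

lemma Reg_iff:
  "(P, q, Q) \<in> regular_epis \<longleftrightarrow>
    P \<in> models Sg T \<and> Q \<in> models Sg T \<and> q \<in> homs Sg P Q \<and>
    (\<forall>Y\<in>models Sg T. \<forall>g\<in>homs Sg P Y. carries_scale P q Q g Y \<longrightarrow>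
      (\<exists>!k. k \<in> homs Sg Q Y \<and> hom_comp P k q = g))" (is "_ \<longleftrightarrow> ?R")
proof -
  have ex1: "(\<exists>!k. k \<in> hom (PMod Sg T) Q Y \<and> Comp (PMod Sg T) k (P, q, Q) = (P, g, Y)) \<longleftrightarrow>
      (\<exists>!k. k \<in> homs Sg Q Y \<and> hom_comp P k q = g)" (is "Ex1 ?A \<longleftrightarrow> Ex1 ?B")
    if "Q \<in> models Sg T" "Y \<in> models Sg T" for Y g
  proof -
    have A_iff: "?A k \<longleftrightarrow> (\<exists>k'. k = (Q, k', Y) \<and> ?B k')" for k
      using that by (auto elim: PMod_homE)
    show ?thesis unfolding A_iff by blast
  qed
  have arrows: "(\<forall>f\<in>Ar (PMod Sg T). Dom (PMod Sg T) f = P \<longrightarrow> C f) \<longleftrightarrow>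
      (\<forall>Y\<in>models Sg T. \<forall>g\<in>homs Sg P Y. C (P, g, Y))" if "P \<in> models Sg T" for C
    using that by (auto elim!: PMod_ArE)
  show ?thesis
  proof (cases "P \<in> models Sg T \<and> Q \<in> models Sg T \<and> q \<in> homs Sg P Q")
    case True
    then have P: "P \<in> models Sg T" and Q: "Q \<in> models Sg T" and q: "q \<in> homs Sg P Q" by auto
    have "(P, q, Q) \<in> regular_epis \<longleftrightarrow> (\<forall>Y\<in>models Sg T. \<forall>g\<in>homs Sg P Y.
      (\<forall>e\<in>scale_epis Sg T L. \<forall>u\<in>hom (PMod Sg T) (Dom (PMod Sg T) e) P.
      factors_through (PMod Sg T) (Comp (PMod Sg T) (P, q, Q) u) e \<longrightarrow>
      factors_through (PMod Sg T) (Comp (PMod Sg T) (P, g, Y) u) e) \<longrightarrow>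
      (\<exists>!k. k \<in> hom (PMod Sg T) Q Y \<and> Comp (PMod Sg T) k (P, q, Q) = (P, g, Y)))"
      using True unfolding Reg_def by (simp only: mem_Collect_eq PMod_simps arrows[OF P]) simp
    also have "\<dots> \<longleftrightarrow> (\<forall>Y\<in>models Sg T. \<forall>g\<in>homs Sg P Y. carries_scale P q Q g Y \<longrightarrow>
      (\<exists>!k. k \<in> homs Sg Q Y \<and> hom_comp P k q = g))"
      by (intro ball_cong refl) (simp only: carries_scale_iff[OF P Q _ q] ex1[OF Q])
    finally show ?thesis using True by simp
  next
    case False
    then show ?thesis by (auto simp: Reg_def)
  qed
qed

definition reflects_scale ::
    "('s, 'f, 'r, 'u) struct \<Rightarrow> ('s \<Rightarrow> 'u \<Rightarrow> 'u) \<Rightarrow> ('s, 'f, 'r, 'u) struct \<Rightarrow> bool" where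
  "reflects_scale M p X \<longleftrightarrow> (\<forall>l\<in>idx L. \<forall>m\<in>tuples_of M l.
     sat X (map_val (scale_vars l) p m) (sfm L l) \<longrightarrow> sat M m (sfm L l))"

text \<open>
  In a commutative square \<open>p u = v q\<close>, a tuple whose image under \<open>q\<close> satisfies the formula has an
  image under \<open>v q = p u\<close> that satisfies it too, and \<open>p\<close> reflects this to its image under \<open>u\<close>. Hence
  \<open>u\<close> factors uniquely through \<open>q\<close>.
\<close>

lemma reflects_scale_orthogonal:
  assumes M: "M \<in> models Sg T" and X: "X \<in> models Sg T" and p: "p \<in> homs Sg M X"
    and refl: "reflects_scale M p X" and e: "e \<in> regular_epis"
  shows "orthogonal (PMod Sg T) e (M, p, X)"
proof -
  have "e \<in> Ar (PMod Sg T)" using e by (simp add: Reg_def)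
  then obtain P q Q where eq: "e = (P, q, Q)" by (rule PMod_ArE)
  have P: "P \<in> models Sg T" and Q: "Q \<in> models Sg T" and q: "q \<in> homs Sg P Q"
    and univ: "\<And>Y g. Y \<in> models Sg T \<Longrightarrow> g \<in> homs Sg P Y \<Longrightarrow> carries_scale P q Q g Y \<Longrightarrow>
      \<exists>!k. k \<in> homs Sg Q Y \<and> hom_comp P k q = g"
    using e unfolding eq Reg_iff by blast+
  have Ps: "partial_structure Sg P" and Qs: "partial_structure Sg Q"
    using P Q by (simp_all add: models_struct)
  have main: "\<exists>h\<in>homs Sg Q M. hom_comp P h q = u \<and> hom_comp Q p h = v \<and>
      (\<forall>k\<in>homs Sg Q M. hom_comp P k q = u \<longrightarrow> k = h)"
    if u: "u \<in> homs Sg P M" and v: "v \<in> homs Sg Q X" and comm: "hom_comp P p u = hom_comp P v q"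
    for u v
  proof -
    have im_sat: "sat X (map_val (scale_vars l) v (map_val (scale_vars l) q m)) (sfm L l)"
      if l: "l \<in> idx L" and m: "m \<in> tuples_of P l"
        and sat: "sat Q (map_val (scale_vars l) q m) (sfm L l)" for l m
    proof -
      have "map_val (scale_vars l) q m \<in> (\<Pi> v\<in>scale_vars l. car Q (fst v))"
        using map_val_PiE[OF q, of m "scale_vars l"] m by auto
      from homs_sat_map_val[OF Qs v scale_sorted[OF l] this sat] show ?thesis .
    qed
    have "carries_scale P q Q u M"
      unfolding carries_scale_def
    proof (intro ballI impI)
      fix l m assume l: "l \<in> idx L" and m: "m \<in> tuples_of P l"
        and sat: "sat Q (map_val (scale_vars l) q m) (sfm L l)"
      have m': "m \<in> (\<Pi> v\<in>scale_vars l. car P (fst v))" using m by auto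
      have "map_val (scale_vars l) p (map_val (scale_vars l) u m) =
          map_val (scale_vars l) v (map_val (scale_vars l) q m)"
        using comm map_val_hom_comp[OF m', of p u] map_val_hom_comp[OF m', of v q] by simp
      then have "sat X (map_val (scale_vars l) p (map_val (scale_vars l) u m)) (sfm L l)"
        using im_sat[OF l m sat] by simp
      then show "sat M (map_val (scale_vars l) u m) (sfm L l)"
        using refl l map_val_PiE[OF u m'] unfolding reflects_scale_def by blast
    qed
    then obtain h where h: "h \<in> homs Sg Q M" "hom_comp P h q = u"
      and h_unique: "\<And>k. k \<in> homs Sg Q M \<Longrightarrow> hom_comp P k q = u \<Longrightarrow> k = h"
      using univ[OF M u] by blast
    have "carries_scale P q Q (hom_comp P v q) X"
      unfolding carries_scale_def using im_sat by (auto simp: map_val_hom_comp PiE_def)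
    from univ[OF X hom_comp_homs[OF P Q q v] this]
    have v_unique: "k = v" if "k \<in> homs Sg Q X" "hom_comp P k q = hom_comp P v q" for k
      using that v by blast
    have "hom_comp P (hom_comp Q p h) q = hom_comp P p (hom_comp P h q)"
      using homs_car[OF q] by (auto simp: compose_def fun_eq_iff)
    also have "\<dots> = hom_comp P p u" by (rule arg_cong[OF h(2)])
    also note comm
    finally have "hom_comp Q p h = v" by (rule v_unique[OF hom_comp_homs[OF Q M h(1) p]])
    then show ?thesis using h h_unique by blast
  qed
  show ?thesis
    unfolding orthogonal_def eq
  proof (intro ballI impI)
    fix u' v'
    assume "u' \<in> hom (PMod Sg T) (Dom (PMod Sg T) (P, q, Q)) (Dom (PMod Sg T) (M, p, X))"
      and "v' \<in> hom (PMod Sg T) (Cod (PMod Sg T) (P, q, Q)) (Cod (PMod Sg T) (M, p, X))"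
      and comm': "Comp (PMod Sg T) (M, p, X) u' = Comp (PMod Sg T) v' (P, q, Q)"
    then obtain u v where u': "u' = (P, u, M)" and v': "v' = (Q, v, X)"
      and u: "u \<in> homs Sg P M" and v: "v \<in> homs Sg Q X"
      by (auto elim!: PMod_homE)
    have comm: "hom_comp P p u = hom_comp P v q" using comm' by (simp add: u' v')
    from main[OF u v comm] obtain h where h: "h \<in> homs Sg Q M"
      and h_props: "hom_comp P h q = u \<and> hom_comp Q p h = v \<and>
        (\<forall>k\<in>homs Sg Q M. hom_comp P k q = u \<longrightarrow> k = h)"
      by (rule bexE)
    note tri = h_props[THEN conjunct1] h_props[THEN conjunct2, THEN conjunct1]
      and all = h_props[THEN conjunct2, THEN conjunct2]
    have unique: "k = h" if "k \<in> homs Sg Q M" "hom_comp P k q = u" for k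
      using that by (rule all[THEN bspec, THEN mp])
    show "\<exists>!h. h \<in> hom (PMod Sg T) (Cod (PMod Sg T) (P, q, Q)) (Dom (PMod Sg T) (M, p, X)) \<and>
        Comp (PMod Sg T) h (P, q, Q) = u' \<and> Comp (PMod Sg T) (M, p, X) h = v'"
    proof (intro ex1I[of _ "(Q, h, M)"])
      show "(Q, h, M) \<in> hom (PMod Sg T) (Cod (PMod Sg T) (P, q, Q)) (Dom (PMod Sg T) (M, p, X)) \<and>
          Comp (PMod Sg T) (Q, h, M) (P, q, Q) = u' \<and> Comp (PMod Sg T) (M, p, X) (Q, h, M) = v'"
        by (simp add: u' v' h M Q tri)
    next
      fix k'
      assume k': "k' \<in> hom (PMod Sg T) (Cod (PMod Sg T) (P, q, Q)) (Dom (PMod Sg T) (M, p, X)) \<and>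
          Comp (PMod Sg T) k' (P, q, Q) = u' \<and> Comp (PMod Sg T) (M, p, X) k' = v'"
      then obtain k where k: "k' = (Q, k, M)" "k \<in> homs Sg Q M" by (auto elim!: PMod_homE)
      then have "hom_comp P k q = u" using k' by (simp add: u')
      then show "k' = (Q, h, M)" using unique[OF k(2)] k(1) by simp
    qed
  qed
qed

end


section \<open>The stages of the decomposition\<close>

locale scaled_morphism = scaled_theory \<kappa> Sg T L
  for \<kappa> :: "'u::wellorder"
    and Sg :: "('s, 'f, 'r, 'u) signature"
    and T :: "('s, 'f, 'r, 'u) sequent set"
    and L :: "('l, 's, 'f, 'r, 'u) scale" +
  fixes A X :: "('s, 'f, 'r, 'u) struct"
    and f :: "'s \<Rightarrow> 'u \<Rightarrow> 'u"
  assumes source: "A \<in> models Sg T"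
    and target: "X \<in> models Sg T"
    and hom_f: "f \<in> homs Sg A X"
begin

definition elements :: "('s \<times> 'u) set" where
  "elements = {(s, a). a \<in> car A s}"

definition self_val :: "'s \<times> 'u \<Rightarrow> 'u" where
  "self_val = (\<lambda>v\<in>elements. snd v)"

definition target_val :: "'s \<times> 'u \<Rightarrow> 'u" where
  "target_val = map_val elements f self_val"

lemma self_val_PiE: "self_val \<in> (\<Pi>\<^sub>E v\<in>elements. car A (fst v))"
  by (auto simp: self_val_def elements_def)

lemma self_val_Pi: "self_val \<in> (\<Pi> v\<in>elements. car A (fst v))"
  using self_val_PiE by auto

lemma target_val_PiE: "target_val \<in> (\<Pi>\<^sub>E v\<in>elements. car X (fst v))"
  unfolding target_val_def by (rule map_val_PiE[OF hom_f self_val_Pi])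

lemma source_structure: "partial_structure Sg A"
  using source by (rule models_struct)

lemma elements_sorts: "fst ` elements \<subseteq> sorts Sg"
  using source_structure by (auto simp: elements_def partial_structure_def)

lemma elements_small: "small TYPE('u) elements"
proof -
  have "small TYPE('u) (sorts Sg)" using signature by (simp add: is_signature_def)
  moreover have "small TYPE('u) (Pair s ` car A s)" if "s \<in> sorts Sg" for s
  proof -
    have "small TYPE('u) (car A s)" using source_structure that by (simp add: partial_structure_def)
    then show ?thesis by (rule small_image)
  qed
  ultimately have "small TYPE('u) (\<Union>s\<in>sorts Sg. Pair s ` car A s)"
    by (rule small_UN[OF universe])
  moreover have "elements \<subseteq> (\<Union>s\<in>sorts Sg. Pair s ` car A s)"
    using elements_sorts by (force simp: elements_def)
  ultimately show ?thesis by (rule small_mono[rotated])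
qed

text \<open>The elements of \<open>A\<close> and the positive diagram of \<open>A\<close> present \<open>A\<close>.\<close>

definition var_args :: "'u \<Rightarrow> ('u \<Rightarrow> 's) \<Rightarrow> ('u \<Rightarrow> 'u) \<Rightarrow> 'u \<Rightarrow> ('s, 'f, 'u) sterm option" where
  "var_args \<alpha> ss x = (\<lambda>i. if i < \<alpha> then Some (Var (ss i, x i)) else None)"

definition diagram :: "('s, 'f, 'r, 'u) sformula set" where
  "diagram =
     {Eq (App g (var_args (far Sg g) (fdom Sg g) x)) (Var (fcod Sg g, y)) |g x y.
        g \<in> funs Sg \<and> fint A g x = Some y} \<union>
     {Rel R (var_args (rar Sg R) (rdom Sg R) x) |R x. R \<in> rels Sg \<and> x \<in> rint A R}"

lemma dom_var_args: "dom (var_args \<alpha> ss x) = {..<\<alpha>}"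
  by (auto simp: var_args_def dom_def)

lemma sat_diagram_fun:
  "sat Y m (Eq (App g (var_args \<alpha> ss x)) (Var w)) \<longleftrightarrow>
    fint Y g (\<lambda>i\<in>{..<\<alpha>}. m (ss i, x i)) = Some (m w)"
proof -
  have "eval Y m (App g (var_args \<alpha> ss x)) = fint Y g (\<lambda>i\<in>{..<\<alpha>}. m (ss i, x i))"
    by (rule eval_App_eq[OF dom_var_args]) (simp add: var_args_def)
  then show ?thesis by simp
qed

lemma sat_diagram_rel:
  "sat Y m (Rel R (var_args \<alpha> ss x)) \<longleftrightarrow> (\<lambda>i\<in>{..<\<alpha>}. m (ss i, x i)) \<in> rint Y R"
  by (rule sat_Rel_eq[OF dom_var_args]) (simp add: var_args_def)

lemma source_fun:
  assumes "g \<in> funs Sg" "fint A g x = Some y"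
  shows "x \<in> tuples A (far Sg g) (fdom Sg g)" "y \<in> car A (fcod Sg g)"
proof -
  have "dom (fint A g) \<subseteq> tuples A (far Sg g) (fdom Sg g)" "ran (fint A g) \<subseteq> car A (fcod Sg g)"
    using source_structure assms(1) by (simp_all add: partial_structure_def)
  then show "x \<in> tuples A (far Sg g) (fdom Sg g)" "y \<in> car A (fcod Sg g)"
    using domI[of "fint A g" x y] ranI[of "fint A g" x y] assms(2) by auto
qed

lemma source_rel:
  assumes "R \<in> rels Sg" "x \<in> rint A R"
  shows "x \<in> tuples A (rar Sg R) (rdom Sg R)"
  using source_structure assms by (auto simp: partial_structure_def)

lemma diagram_sorted:
  assumes "\<phi> \<in> diagram"
  shows "sorted_formula Sg elements \<phi>"
proof -
  consider (funs) g x y where "\<phi> = Eq (App g (var_args (far Sg g) (fdom Sg g) x)) (Var (fcod Sg g, y))"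
      "g \<in> funs Sg" "fint A g x = Some y"
    | (rel) R x where "\<phi> = Rel R (var_args (rar Sg R) (rdom Sg R) x)" "R \<in> rels Sg" "x \<in> rint A R"
    using assms by (auto simp: diagram_def)
  then show ?thesis
  proof cases
    case funs
    have "sorted_term Sg elements (App g (var_args (far Sg g) (fdom Sg g) x)) (fcod Sg g)"
    proof (rule sorted_term.app[OF funs(2) dom_var_args _ refl])
      fix i assume "i < far Sg g"
      then show "sorted_term Sg elements (the (var_args (far Sg g) (fdom Sg g) x i)) (fdom Sg g i)"
        using source_fun(1)[OF funs(2,3)]
        by (auto simp: var_args_def tuples_def elements_def intro: sorted_term.var)
    qed
    moreover have "sorted_term Sg elements (Var (fcod Sg g, y)) (fcod Sg g)"
      using source_fun(2)[OF funs(2,3)] by (auto simp: elements_def intro: sorted_term.var)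
    ultimately show ?thesis unfolding funs(1) by (rule sorted_formula.Eq)
  next
    case rel
    show ?thesis unfolding rel(1)
    proof (rule sorted_formula.Rel[OF rel(2) dom_var_args])
      fix i assume "i < rar Sg R"
      then show "sorted_term Sg elements (the (var_args (rar Sg R) (rdom Sg R) x i)) (rdom Sg R i)"
        using source_rel[OF rel(2,3)]
        by (auto simp: var_args_def tuples_def elements_def intro: sorted_term.var)
    qed
  qed
qed

lemma homs_sat_diagram:
  assumes h: "h \<in> homs Sg A Y" and \<phi>: "\<phi> \<in> diagram"
  shows "sat Y (map_val elements h self_val) \<phi>"
proof -
  have "sat A self_val \<phi>"
  proof -
    have val: "(\<lambda>i\<in>{..<\<alpha>}. self_val (ss i, x i)) = x" if "x \<in> tuples A \<alpha> ss" for \<alpha> ss x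
      using that by (auto simp: tuples_def self_val_def elements_def fun_eq_iff PiE_def extensional_def)
    from \<phi> consider (funs) g x y
      where "\<phi> = Eq (App g (var_args (far Sg g) (fdom Sg g) x)) (Var (fcod Sg g, y))"
        "g \<in> funs Sg" "fint A g x = Some y"
      | (rel) R x where "\<phi> = Rel R (var_args (rar Sg R) (rdom Sg R) x)" "R \<in> rels Sg" "x \<in> rint A R"
      by (auto simp: diagram_def)
    then show ?thesis
    proof cases
      case funs
      have "self_val (fcod Sg g, y) = y"
        using source_fun(2)[OF funs(2,3)] by (simp add: self_val_def elements_def)
      then show ?thesis
        using funs(3) val[OF source_fun(1)[OF funs(2,3)]] unfolding funs(1) sat_diagram_fun by simp
    next
      case rel
      then show ?thesis using val[OF source_rel[OF rel(2,3)]] unfolding rel(1) sat_diagram_rel by simp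
    qed
  qed
  then show ?thesis
    by (rule homs_sat_map_val[OF source_structure h diagram_sorted[OF \<phi>] self_val_Pi])
qed

lemma diagram_hom:
  assumes Y: "(Y, m) \<in> solutions Sg T elements diagram"
  shows "(\<lambda>s. \<lambda>x\<in>car A s. m (s, x)) \<in> homs Sg A Y"
proof -
  let ?h = "\<lambda>s. \<lambda>x\<in>car A s. m (s, x)"
  have m: "m \<in> (\<Pi>\<^sub>E v\<in>elements. car Y (fst v))" and sat: "\<And>\<phi>. \<phi> \<in> diagram \<Longrightarrow> sat Y m \<phi>"
    using Y by (auto simp: solutions_def)
  have args: "(\<lambda>i\<in>{..<\<alpha>}. ?h (ss i) (x i)) = (\<lambda>i\<in>{..<\<alpha>}. m (ss i, x i))"
    if "x \<in> tuples A \<alpha> ss" for \<alpha> ss x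
    using that by (auto simp: tuples_def fun_eq_iff)
  have "?h s \<in> car A s \<rightarrow>\<^sub>E car Y s" for s
    using PiE_mem[OF m, of "(s, _)"] by (auto simp: elements_def)
  moreover have "fint Y g (\<lambda>i\<in>{..<far Sg g}. ?h (fdom Sg g i) (x i)) = Some (?h (fcod Sg g) y)"
    if "g \<in> funs Sg" "fint A g x = Some y" for g x y
  proof -
    have "Eq (App g (var_args (far Sg g) (fdom Sg g) x)) (Var (fcod Sg g, y)) \<in> diagram"
      using that unfolding diagram_def by blast
    from sat[OF this] show ?thesis
      using source_fun[OF that] unfolding sat_diagram_fun args[OF source_fun(1)[OF that]] by simp
  qed
  moreover have "(\<lambda>i\<in>{..<rar Sg R}. ?h (rdom Sg R i) (x i)) \<in> rint Y R"
    if "R \<in> rels Sg" "x \<in> rint A R" for R x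
  proof -
    have "Rel R (var_args (rar Sg R) (rdom Sg R) x) \<in> diagram"
      using that unfolding diagram_def by blast
    from sat[OF this] show ?thesis
      unfolding sat_diagram_rel args[OF source_rel[OF that]] .
  qed
  ultimately show ?thesis unfolding homs_def by blast
qed

lemma diagram_presents: "presents Sg T elements diagram A self_val"
proof -
  have "map_val elements (hom_id A) self_val = self_val"
    by (rule map_val_hom_id[OF self_val_PiE])
  then have "sat A self_val \<phi>" if "\<phi> \<in> diagram" for \<phi>
    using homs_sat_diagram[OF hom_id_homs[OF source_structure] that] by simp
  then have "(A, self_val) \<in> solutions Sg T elements diagram"
    using source self_val_PiE by (simp add: solutions_def)
  moreover have "\<exists>t. sorted_term Sg elements t s \<and> eval A self_val t = Some x"
    if "x \<in> car A s" for s x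
    using that by (intro exI[of _ "Var (s, x)"])
      (auto simp: elements_def self_val_def intro: sorted_term.var)
  moreover have "\<exists>h\<in>homs Sg A Y. map_val elements h self_val = m"
    if Y: "(Y, m) \<in> solutions Sg T elements diagram" for Y m
  proof (rule bexI[OF _ diagram_hom[OF Y]])
    have m: "m \<in> (\<Pi>\<^sub>E v\<in>elements. car Y (fst v))" using Y by (simp add: solutions_def)
    show "map_val elements (\<lambda>s. \<lambda>x\<in>car A s. m (s, x)) self_val = m"
    proof
      fix v show "map_val elements (\<lambda>s. \<lambda>x\<in>car A s. m (s, x)) self_val v = m v"
        using PiE_arb[OF m, of v]
        by (cases "v \<in> elements") (auto simp: map_val_def self_val_def elements_def)
    qed
  qed
  ultimately show ?thesis unfolding presents_def by blast
qed

text \<open>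
  All stages are presented by the elements of \<open>A\<close>. The relations of a stage consist of the diagram of
  \<open>A\<close> and, for each earlier stage, of all instances of formulas of the scale at tuples of terms
  that are defined in that earlier stage, provided that the instance holds in \<open>X\<close>.
\<close>

definition forced :: "('s, 'f, 'r, 'u) sformula set \<Rightarrow> ('s, 'f, 'r, 'u) sformula set" where
  "forced \<Phi> = {subst_fm \<theta> (sfm L l) |l \<theta>. l \<in> idx L \<and>
     (\<forall>z\<in>scale_vars l. sorted_term Sg elements (\<theta> z) (fst z)) \<and>
     (\<forall>(Y, m)\<in>solutions Sg T elements \<Phi>. \<forall>z\<in>scale_vars l. eval Y m (\<theta> z) \<noteq> None) \<and>
     sat X target_val (subst_fm \<theta> (sfm L l))}"

function stage :: "'u \<Rightarrow> ('s, 'f, 'r, 'u) sformula set" where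
  "stage \<beta> = diagram \<union> (\<Union>\<beta>'\<in>{..<\<beta>}. forced (stage \<beta>'))"
  by pat_completeness auto
termination
  by (relation "{(x, y). x < y}") (auto simp: wf)

declare stage.simps [simp del]

abbreviation stage_solutions :: "'u \<Rightarrow> (('s, 'f, 'r, 'u) struct \<times> ('s \<times> 'u \<Rightarrow> 'u)) set" where
  "stage_solutions \<beta> \<equiv> solutions Sg T elements (stage \<beta>)"

lemma forcedI:
  assumes "l \<in> idx L" "\<And>z. z \<in> scale_vars l \<Longrightarrow> sorted_term Sg elements (\<theta> z) (fst z)"
    and "\<And>Y m z. (Y, m) \<in> solutions Sg T elements \<Phi> \<Longrightarrow> z \<in> scale_vars l \<Longrightarrow> eval Y m (\<theta> z) \<noteq> None"
    and "sat X target_val (subst_fm \<theta> (sfm L l))"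
  shows "subst_fm \<theta> (sfm L l) \<in> forced \<Phi>"
  using assms unfolding forced_def by blast

lemma stage_forced: "\<beta>' < \<beta> \<Longrightarrow> \<phi> \<in> forced (stage \<beta>') \<Longrightarrow> \<phi> \<in> stage \<beta>"
  by (subst stage.simps) blast

lemma stage_diagram: "diagram \<subseteq> stage \<beta>"
  by (subst stage.simps) blast

lemma stageE:
  assumes "\<phi> \<in> stage \<beta>"
  obtains "\<phi> \<in> diagram"
  | \<beta>' l \<theta> where "\<beta>' < \<beta>" "\<phi> = subst_fm \<theta> (sfm L l)" "l \<in> idx L"
      "\<And>z. z \<in> scale_vars l \<Longrightarrow> sorted_term Sg elements (\<theta> z) (fst z)"
      "\<And>Y m z. (Y, m) \<in> stage_solutions \<beta>' \<Longrightarrow> z \<in> scale_vars l \<Longrightarrow> eval Y m (\<theta> z) \<noteq> None"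
      "sat X target_val \<phi>"
proof -
  have "\<phi> \<in> diagram \<or> (\<exists>\<beta>'<\<beta>. \<phi> \<in> forced (stage \<beta>'))"
    using assms by (subst (asm) stage.simps) blast
  then show thesis
  proof (elim disjE exE conjE)
    fix \<beta>' assume \<beta>': "\<beta>' < \<beta>" and "\<phi> \<in> forced (stage \<beta>')"
    then obtain l \<theta> where l: "\<phi> = subst_fm \<theta> (sfm L l)" "l \<in> idx L"
      "\<forall>z\<in>scale_vars l. sorted_term Sg elements (\<theta> z) (fst z)"
      and def: "\<forall>(Y, m)\<in>stage_solutions \<beta>'. \<forall>z\<in>scale_vars l. eval Y m (\<theta> z) \<noteq> None"
      and sat: "sat X target_val (subst_fm \<theta> (sfm L l))"
      unfolding forced_def by blast
    show thesis
    proof (rule that(2)[OF \<beta>' l(1,2)])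
      show "sorted_term Sg elements (\<theta> z) (fst z)" if "z \<in> scale_vars l" for z
        using l(3) that by blast
      show "eval Y m (\<theta> z) \<noteq> None" if "(Y, m) \<in> stage_solutions \<beta>'" "z \<in> scale_vars l" for Y m z
        using bspec[OF def that(1)] that(2) by simp
      show "sat X target_val \<phi>" using sat l(1) by simp
    qed
  qed (rule that(1))
qed

lemma stage_mono: "\<beta> \<le> \<gamma> \<Longrightarrow> stage \<beta> \<subseteq> stage \<gamma>"
  unfolding stage.simps[of \<beta>] stage.simps[of \<gamma>] by (force intro: order_less_le_trans)

lemma stage_solutions_antimono: "\<beta> \<le> \<gamma> \<Longrightarrow> stage_solutions \<gamma> \<subseteq> stage_solutions \<beta>"
  using stage_mono[of \<beta> \<gamma>] by (auto simp: solutions_def)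

lemma not_less_zero_ord: "\<not> x < (zero_ord :: 'u)"
  using zero_ord_le[of x] by (simp add: not_less)

lemma stage_zero: "stage zero_ord = diagram"
proof -
  have "{..<zero_ord :: 'u} = {}" using not_less_zero_ord by auto
  then show ?thesis by (subst stage.simps) simp
qed

lemma stage_sorted: "\<phi> \<in> stage \<beta> \<Longrightarrow> sorted_formula Sg elements \<phi>"
  by (erule stageE) (auto intro: diagram_sorted sorted_formula_subst[OF scale_sorted])

lemma target_solution: "(X, target_val) \<in> stage_solutions \<beta>"
proof -
  have "sat X target_val \<phi>" if "\<phi> \<in> stage \<beta>" for \<phi>
    using that
  proof (cases rule: stageE)
    case 1
    then show ?thesis unfolding target_val_def by (rule homs_sat_diagram[OF hom_f])
  qed
  then show ?thesis using target target_val_PiE by (simp add: solutions_def)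
qed

text \<open>
  Stage zero has to be \<open>A\<close> itself, and not merely isomorphic to it, which the choice of
  presentations has to respect.
\<close>

definition obj_gens :: "'u \<Rightarrow> ('s, 'f, 'r, 'u) struct \<times> ('s \<times> 'u \<Rightarrow> 'u)" where
  "obj_gens \<beta> = (if \<beta> = zero_ord then (A, self_val)
     else SOME (B, \<eta>). presents Sg T elements (stage \<beta>) B \<eta>)"

definition obj :: "'u \<Rightarrow> ('s, 'f, 'r, 'u) struct" where
  "obj \<beta> = fst (obj_gens \<beta>)"

definition gens :: "'u \<Rightarrow> 's \<times> 'u \<Rightarrow> 'u" where
  "gens \<beta> = snd (obj_gens \<beta>)"

lemma obj_presents: "presents Sg T elements (stage \<beta>) (obj \<beta>) (gens \<beta>)"
proof (cases "\<beta> = zero_ord")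
  case True
  then show ?thesis
    using diagram_presents by (simp add: obj_def gens_def obj_gens_def stage_zero)
next
  case False
  have "\<exists>B \<eta>. presents Sg T elements (stage \<beta>) B \<eta>"
    by (rule presentation_exists[OF universe signature horn elements_small elements_sorts stage_sorted])
  then have "\<exists>p. case p of (B, \<eta>) \<Rightarrow> presents Sg T elements (stage \<beta>) B \<eta>"
    by (simp only: split_paired_Ex prod.case)
  then have "case (SOME (B, \<eta>). presents Sg T elements (stage \<beta>) B \<eta>) of
      (B, \<eta>) \<Rightarrow> presents Sg T elements (stage \<beta>) B \<eta>"
    by (rule someI_ex)
  then show ?thesis using False by (simp add: obj_def gens_def obj_gens_def case_prod_beta)
qed

lemma obj_zero: "obj zero_ord = A" and gens_zero: "gens zero_ord = self_val"
  by (simp_all add: obj_def gens_def obj_gens_def)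

lemma obj_solution: "(obj \<beta>, gens \<beta>) \<in> stage_solutions \<beta>"
  by (rule presents_solution[OF obj_presents])

lemma obj_model: "obj \<beta> \<in> models Sg T" and gens_PiE: "gens \<beta> \<in> (\<Pi>\<^sub>E v\<in>elements. car (obj \<beta>) (fst v))"
  using obj_solution[of \<beta>] by (auto simp: solutions_def)

lemma gens_Pi: "gens \<beta> \<in> (\<Pi> v\<in>elements. car (obj \<beta>) (fst v))"
  using gens_PiE[of \<beta>] by auto

lemma obj_structure: "partial_structure Sg (obj \<beta>)"
  by (rule models_struct[OF obj_model])

lemma obj_hom_unique:
  assumes "h \<in> homs Sg (obj \<beta>) Y" "k \<in> homs Sg (obj \<beta>) Y"
    "map_val elements h (gens \<beta>) = map_val elements k (gens \<beta>)"
  shows "h = k"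
  using obj_presents assms(1,2)
proof (rule presents_hom_unique)
  fix v assume "v \<in> elements"
  then show "h (fst v) (gens \<beta> v) = k (fst v) (gens \<beta> v)"
    using fun_cong[OF assms(3), of v] by (simp add: map_val_def)
qed

definition induced ::
    "'u \<Rightarrow> ('s, 'f, 'r, 'u) struct \<Rightarrow> ('s \<times> 'u \<Rightarrow> 'u) \<Rightarrow> 's \<Rightarrow> 'u \<Rightarrow> 'u" where
  "induced \<beta> Y m = (SOME h. h \<in> homs Sg (obj \<beta>) Y \<and> map_val elements h (gens \<beta>) = m)"

lemma induced:
  assumes "(Y, m) \<in> stage_solutions \<beta>"
  shows "induced \<beta> Y m \<in> homs Sg (obj \<beta>) Y" "map_val elements (induced \<beta> Y m) (gens \<beta>) = m"
proof -
  obtain h where "h \<in> homs Sg (obj \<beta>) Y \<and> map_val elements h (gens \<beta>) = m"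
    using presents_homE[OF obj_presents assms] by blast
  from someI[where P = "\<lambda>h. h \<in> homs Sg (obj \<beta>) Y \<and> map_val elements h (gens \<beta>) = m", OF this]
  show "induced \<beta> Y m \<in> homs Sg (obj \<beta>) Y" "map_val elements (induced \<beta> Y m) (gens \<beta>) = m"
    by (simp_all add: induced_def)
qed

lemma induced_eqI:
  assumes "(Y, m) \<in> stage_solutions \<beta>" "h \<in> homs Sg (obj \<beta>) Y" "map_val elements h (gens \<beta>) = m"
  shows "induced \<beta> Y m = h"
  using induced[OF assms(1)] assms(2,3) by (intro obj_hom_unique[of _ \<beta> Y]) simp_all

definition trans_map :: "'u \<Rightarrow> 'u \<Rightarrow> 's \<Rightarrow> 'u \<Rightarrow> 'u" where
  "trans_map \<beta> \<gamma> = induced \<beta> (obj \<gamma>) (gens \<gamma>)"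

definition cocone_map :: "'u \<Rightarrow> 's \<Rightarrow> 'u \<Rightarrow> 'u" where
  "cocone_map \<beta> = induced \<beta> X target_val"

lemma obj_solution_le: "\<beta> \<le> \<gamma> \<Longrightarrow> (obj \<gamma>, gens \<gamma>) \<in> stage_solutions \<beta>"
  using stage_solutions_antimono obj_solution by blast

lemma trans_map:
  assumes "\<beta> \<le> \<gamma>"
  shows "trans_map \<beta> \<gamma> \<in> homs Sg (obj \<beta>) (obj \<gamma>)"
    "map_val elements (trans_map \<beta> \<gamma>) (gens \<beta>) = gens \<gamma>"
  unfolding trans_map_def using induced[OF obj_solution_le[OF assms]] .

lemma cocone_map:
  shows "cocone_map \<beta> \<in> homs Sg (obj \<beta>) X"
    "map_val elements (cocone_map \<beta>) (gens \<beta>) = target_val"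
  unfolding cocone_map_def using induced[OF target_solution] .

lemma comp_gens:
  "map_val elements (hom_comp (obj \<beta>) k h) (gens \<beta>) = map_val elements k (map_val elements h (gens \<beta>))"
  by (rule map_val_hom_comp[OF gens_Pi])

lemma comp_trans_map:
  assumes le: "\<beta> \<le> \<gamma>" and k: "k \<in> homs Sg (obj \<gamma>) Y"
  shows "hom_comp (obj \<beta>) k (trans_map \<beta> \<gamma>) \<in> homs Sg (obj \<beta>) Y"
    "map_val elements (hom_comp (obj \<beta>) k (trans_map \<beta> \<gamma>)) (gens \<beta>) = map_val elements k (gens \<gamma>)"
  using hom_comp_homs[OF obj_model obj_model trans_map(1)[OF le] k] comp_gens trans_map(2)[OF le]
  by simp_all

lemma comp_trans_map_eqI:
  assumes "\<beta> \<le> \<gamma>" "k \<in> homs Sg (obj \<gamma>) Y" "h \<in> homs Sg (obj \<beta>) Y"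
    and "map_val elements k (gens \<gamma>) = map_val elements h (gens \<beta>)"
  shows "hom_comp (obj \<beta>) k (trans_map \<beta> \<gamma>) = h"
  using comp_trans_map[OF assms(1,2)] assms(3,4) by (intro obj_hom_unique[of _ \<beta> Y]) simp_all

abbreviation stage_arrow :: "'u \<Rightarrow> 'u \<Rightarrow> ('s, 'f, 'r, 'u) model_arrow" where
  "stage_arrow \<beta> \<gamma> \<equiv> (obj \<beta>, trans_map \<beta> \<gamma>, obj \<gamma>)"

abbreviation cocone_arrow :: "'u \<Rightarrow> ('s, 'f, 'r, 'u) model_arrow" where
  "cocone_arrow \<beta> \<equiv> (obj \<beta>, cocone_map \<beta>, X)"

lemma stages_functor: "ordinal_functor (PMod Sg T) obj stage_arrow"
proof -
  have "trans_map \<beta> \<beta> = hom_id (obj \<beta>)" for \<beta>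
    unfolding trans_map_def
    by (rule induced_eqI[OF obj_solution hom_id_homs[OF obj_structure] map_val_hom_id[OF gens_PiE]])
  moreover have "hom_comp (obj \<alpha>) (trans_map \<beta> \<gamma>) (trans_map \<alpha> \<beta>) = trans_map \<alpha> \<gamma>"
    if "\<alpha> \<le> \<beta>" "\<beta> \<le> \<gamma>" for \<alpha> \<beta> \<gamma>
    using that trans_map[of \<beta> \<gamma>] trans_map[of \<alpha> \<gamma>]
    by (intro comp_trans_map_eqI[of \<alpha> \<beta> _ "obj \<gamma>"]) auto
  ultimately show ?thesis
    using trans_map(1) obj_model by (simp add: ordinal_functor_def)
qed

text \<open>
  The members of a cocone on the stages below a limit \<open>\<gamma>\<close> all give the same valuation of the elements
  of \<open>A\<close>. It satisfies the relations of every stage below \<open>\<gamma>\<close>, and each relation of the stage \<open>\<gamma>\<close>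
  already occurs in one of these.
\<close>

lemma stages_colimit:
  assumes lim: "limit_ord \<gamma>"
  shows "colimit_at (PMod Sg T) obj stage_arrow \<gamma>"
  unfolding colimit_at_def
proof (intro ballI allI impI)
  fix Y g'
  assume Y: "Y \<in> Ob (PMod Sg T)"
    and g': "(\<forall>\<beta><\<gamma>. g' \<beta> \<in> hom (PMod Sg T) (obj \<beta>) Y) \<and>
      (\<forall>\<alpha> \<beta>. \<alpha> \<le> \<beta> \<longrightarrow> \<beta> < \<gamma> \<longrightarrow> Comp (PMod Sg T) (g' \<beta>) (stage_arrow \<alpha> \<beta>) = g' \<alpha>)"
  have Ym: "Y \<in> models Sg T" using Y by simp
  define g where "g \<beta> = fst (snd (g' \<beta>))" for \<beta>
  have g'_eq: "g' \<beta> = (obj \<beta>, g \<beta>, Y)" and g: "g \<beta> \<in> homs Sg (obj \<beta>) Y" if "\<beta> < \<gamma>" for \<beta>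
  proof -
    have "g' \<beta> \<in> hom (PMod Sg T) (obj \<beta>) Y" using g' that by blast
    then show "g' \<beta> = (obj \<beta>, g \<beta>, Y)" "g \<beta> \<in> homs Sg (obj \<beta>) Y"
      by (auto simp: g_def elim: PMod_homE)
  qed
  have g_comp: "hom_comp (obj \<alpha>) (g \<beta>) (trans_map \<alpha> \<beta>) = g \<alpha>" if "\<alpha> \<le> \<beta>" "\<beta> < \<gamma>" for \<alpha> \<beta>
  proof -
    have "Comp (PMod Sg T) (g' \<beta>) (stage_arrow \<alpha> \<beta>) = g' \<alpha>" using g' that by blast
    then show ?thesis using that by (simp add: g'_eq)
  qed
  have zero: "zero_ord < \<gamma>"
    using lim zero_ord_le[of \<gamma>] by (auto simp: limit_ord_def)
  define m where "m = map_val elements (g zero_ord) (gens zero_ord)"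
  have m: "map_val elements (g \<beta>) (gens \<beta>) = m" if "\<beta> < \<gamma>" for \<beta>
    using comp_trans_map(2)[OF zero_ord_le g[OF that]] g_comp[OF zero_ord_le that]
    by (simp add: m_def)
  have mP: "m \<in> (\<Pi>\<^sub>E v\<in>elements. car Y (fst v))"
    unfolding m_def by (rule map_val_PiE[OF g[OF zero] gens_Pi])
  have sat_lower: "sat Y m \<phi>" if "\<phi> \<in> stage \<beta>" "\<beta> < \<gamma>" for \<phi> \<beta>
  proof -
    have "sat (obj \<beta>) (gens \<beta>) \<phi>" using obj_solution[of \<beta>] that(1) by (simp add: solutions_def)
    then show ?thesis
      using homs_sat_map_val[OF obj_structure g[OF that(2)] stage_sorted[OF that(1)] gens_Pi] m[OF that(2)]
      by simp
  qed
  have sat: "sat Y m \<phi>" if "\<phi> \<in> stage \<gamma>" for \<phi>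
    using that
  proof (cases rule: stageE)
    case 1
    then show ?thesis using sat_lower[OF _ zero] by (simp add: stage_zero)
  next
    case (2 \<beta>' l \<theta>)
    then have "\<phi> \<in> forced (stage \<beta>')" unfolding 2(2) by (intro forcedI) simp_all
    then have "\<phi> \<in> stage (suc_ord \<beta>')" by (rule stage_forced[OF less_suc_ord[OF universe]])
    moreover have "suc_ord \<beta>' < \<gamma>" using lim 2(1) by (simp add: limit_ord_def)
    ultimately show ?thesis by (rule sat_lower)
  qed
  have sol: "(Y, m) \<in> stage_solutions \<gamma>" using Ym mP sat by (simp add: solutions_def)
  show "\<exists>!k. k \<in> hom (PMod Sg T) (obj \<gamma>) Y \<and>
      (\<forall>\<beta><\<gamma>. Comp (PMod Sg T) k (stage_arrow \<beta> \<gamma>) = g' \<beta>)"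
  proof (intro ex1I[of _ "(obj \<gamma>, induced \<gamma> Y m, Y)"] conjI allI impI)
    show "(obj \<gamma>, induced \<gamma> Y m, Y) \<in> hom (PMod Sg T) (obj \<gamma>) Y"
      using Ym obj_model induced(1)[OF sol] by simp
    fix \<beta> assume \<beta>: "\<beta> < \<gamma>"
    have "hom_comp (obj \<beta>) (induced \<gamma> Y m) (trans_map \<beta> \<gamma>) = g \<beta>"
      using \<beta> induced[OF sol] g[OF \<beta>] m[OF \<beta>] by (intro comp_trans_map_eqI[of \<beta> \<gamma> _ Y]) auto
    then show "Comp (PMod Sg T) (obj \<gamma>, induced \<gamma> Y m, Y) (stage_arrow \<beta> \<gamma>) = g' \<beta>"
      by (simp add: g'_eq[OF \<beta>])
  next
    fix k' assume k': "k' \<in> hom (PMod Sg T) (obj \<gamma>) Y \<and>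
      (\<forall>\<beta><\<gamma>. Comp (PMod Sg T) k' (stage_arrow \<beta> \<gamma>) = g' \<beta>)"
    then obtain k where k: "k' = (obj \<gamma>, k, Y)" "k \<in> homs Sg (obj \<gamma>) Y"
      by (auto elim: PMod_homE)
    have "Comp (PMod Sg T) k' (stage_arrow zero_ord \<gamma>) = g' zero_ord" using k' zero by blast
    then have "hom_comp (obj zero_ord) k (trans_map zero_ord \<gamma>) = g zero_ord"
      by (simp add: k(1) g'_eq[OF zero])
    then have "map_val elements k (gens \<gamma>) = m"
      using comp_trans_map(2)[OF zero_ord_le k(2)] by (simp add: m_def)
    then show "k' = (obj \<gamma>, induced \<gamma> Y m, Y)"
      using induced_eqI[OF sol k(2)] k(1) by simp
  qed
qed

lemma less_suc_ord_iff: "\<beta>' < suc_ord \<beta> \<longleftrightarrow> \<beta>' \<le> (\<beta> :: 'u)"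
  using less_suc_ord[OF universe, of \<beta>] suc_ord_le[of \<beta> \<beta>'] by (meson leD le_less_trans not_le)

text \<open>
  The relations that the stage \<open>\<beta> + 1\<close> adds to those of the stage \<open>\<beta>\<close> are conditions on tuples of elements
  of the latter, and they hold in the stage \<open>\<beta> + 1\<close>. A homomorphism for which the scale is
  carried over therefore satisfies them.
\<close>

lemma stages_regular: "stage_arrow \<beta> (suc_ord \<beta>) \<in> regular_epis"
  unfolding Reg_iff
proof (intro conjI ballI impI obj_model)
  let ?q = "trans_map \<beta> (suc_ord \<beta>)"
  have le: "\<beta> \<le> suc_ord \<beta>" using less_suc_ord[OF universe, of \<beta>] by simp
  show q: "?q \<in> homs Sg (obj \<beta>) (obj (suc_ord \<beta>))" by (rule trans_map(1)[OF le])
  fix Y g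
  assume Y: "Y \<in> models Sg T" and g: "g \<in> homs Sg (obj \<beta>) Y"
    and carries: "carries_scale (obj \<beta>) ?q (obj (suc_ord \<beta>)) g Y"
  let ?m = "map_val elements g (gens \<beta>)"
  have sat_lower: "sat Y ?m \<phi>" if "\<phi> \<in> stage \<beta>" for \<phi>
  proof -
    have "sat (obj \<beta>) (gens \<beta>) \<phi>" using obj_solution[of \<beta>] that by (simp add: solutions_def)
    then show ?thesis by (rule homs_sat_map_val[OF obj_structure g stage_sorted[OF that] gens_Pi])
  qed
  have sat: "sat Y ?m \<phi>" if \<phi>: "\<phi> \<in> stage (suc_ord \<beta>)" for \<phi>
    using \<phi>
  proof (cases rule: stageE)
    case 1
    then show ?thesis using sat_lower stage_diagram by blast
  next
    case (2 \<beta>' l \<theta>)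
    have forced: "\<phi> \<in> forced (stage \<beta>')"
      unfolding 2(2) by (intro forcedI) (use 2 in simp_all)
    consider "\<beta>' < \<beta>" | "\<beta>' = \<beta>" using 2(1) less_suc_ord_iff by fastforce
    then show ?thesis
    proof cases
      assume "\<beta>' < \<beta>"
      from stage_forced[OF this forced] show ?thesis by (rule sat_lower)
    next
      assume eq: "\<beta>' = \<beta>"
      define u where "u = (\<lambda>z\<in>scale_vars l. the (eval (obj \<beta>) (gens \<beta>) (\<theta> z)))"
      have ev: "eval (obj \<beta>) (gens \<beta>) (\<theta> z) = Some (u z)" if "z \<in> scale_vars l" for z
        using 2(5)[OF _ that] obj_solution[of \<beta>] that unfolding eq u_def by fastforce
      have u: "u \<in> tuples_of (obj \<beta>) l"
        using eval_in_car[OF obj_structure 2(4) gens_Pi ev] by (auto simp: u_def)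
      have push: "sat N (map_val elements h (gens \<beta>)) \<phi> \<longleftrightarrow>
          sat N (map_val (scale_vars l) h u) (sfm L l)" if h: "h \<in> homs Sg (obj \<beta>) N" for h N
        unfolding 2(2)
      proof (rule sat_subst)
        fix z assume "z \<in> fvs (sfm L l)"
        then have z: "z \<in> scale_vars l" using scale_fvs[OF 2(3)] by blast
        show "eval N (map_val elements h (gens \<beta>)) (\<theta> z) = Some (map_val (scale_vars l) h u z)"
          using homs_eval_map_val[OF obj_structure h 2(4)[OF z] gens_Pi ev[OF z]]
          by (simp add: map_val_apply[OF z])
      qed
      have "sat (obj (suc_ord \<beta>)) (gens (suc_ord \<beta>)) \<phi>"
        using obj_solution[of "suc_ord \<beta>"] \<phi> by (simp add: solutions_def)
      then have "sat (obj (suc_ord \<beta>)) (map_val (scale_vars l) ?q u) (sfm L l)"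
        using push[OF q] trans_map(2)[OF le] by simp
      then have "sat Y (map_val (scale_vars l) g u) (sfm L l)"
        using carries 2(3) u unfolding carries_scale_def by blast
      then show ?thesis using push[OF g] by simp
    qed
  qed
  have sol: "(Y, ?m) \<in> stage_solutions (suc_ord \<beta>)"
    using Y map_val_PiE[OF g gens_Pi] sat by (simp add: solutions_def)
  show "\<exists>!k. k \<in> homs Sg (obj (suc_ord \<beta>)) Y \<and> hom_comp (obj \<beta>) k ?q = g"
  proof (intro ex1I[of _ "induced (suc_ord \<beta>) Y ?m"] conjI)
    show "induced (suc_ord \<beta>) Y ?m \<in> homs Sg (obj (suc_ord \<beta>)) Y" by (rule induced(1)[OF sol])
    show "hom_comp (obj \<beta>) (induced (suc_ord \<beta>) Y ?m) ?q = g"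
      by (rule comp_trans_map_eqI[OF le induced(1)[OF sol] g induced(2)[OF sol]])
    fix k assume k: "k \<in> homs Sg (obj (suc_ord \<beta>)) Y \<and> hom_comp (obj \<beta>) k ?q = g"
    then have "map_val elements k (gens (suc_ord \<beta>)) = ?m"
      using comp_trans_map(2)[OF le, of k Y] by simp
    with k show "k = induced (suc_ord \<beta>) Y ?m" using induced_eqI[OF sol, of k] by simp
  qed
qed

lemma stages_predecomposition:
  "predecomposition (PMod Sg T) regular_epis (A, f, X) obj stage_arrow cocone_arrow"
proof -
  have "hom_comp (obj \<alpha>) (cocone_map \<beta>) (trans_map \<alpha> \<beta>) = cocone_map \<alpha>" if "\<alpha> \<le> \<beta>" for \<alpha> \<beta>
    using that cocone_map by (intro comp_trans_map_eqI[of \<alpha> \<beta> _ X]) simp_all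
  moreover have "cocone_map zero_ord = f"
    using hom_f unfolding cocone_map_def
    by (intro induced_eqI[OF target_solution]) (simp_all add: obj_zero gens_zero target_val_def)
  ultimately show ?thesis
    using stages_functor stages_colimit stages_regular cocone_map(1) obj_model target obj_zero
    by (simp add: predecomposition_def)
qed

end


section \<open>Renaming to fewer than \<open>\<kappa>\<close> variables\<close>

lemma sorted_term_few_variables:
  assumes \<kappa>: "small_regular_cardinal (\<kappa> :: 'u::wellorder)"
    and Sg: "is_signature \<kappa> (Sg :: ('s, 'f, 'r, 'u) signature)" and t: "sorted_term Sg V t s"
  shows "|fv t| <o |{..<\<kappa>}|"
  using t
proof (induction rule: sorted_term.induct)
  case (var v s)
  show ?case by (rule finite_below_regular[OF \<kappa>]) simp
next
  case (app f ts s)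
  have "far Sg f < \<kappa>" using Sg app.hyps(1) by (simp add: is_signature_def)
  from below_regular_UN[OF \<kappa> this app.IH] show ?case using app.hyps(2) by simp
qed

lemma sorted_term_has_sort:
  "sorted_term Sg V t s \<Longrightarrow> V \<subseteq> sorts Sg \<times> {..<\<kappa>} \<Longrightarrow> has_sort \<kappa> Sg t s"
proof (induction rule: sorted_term.induct)
  case (var v s)
  then show ?case by (cases v) (auto intro: has_sort.intros)
qed (auto intro: has_sort.intros)

text \<open>
  The gauge speaks of raw terms only. By regularity of \<open>\<kappa>\<close> a term over \<open>V\<close> has fewer than \<open>\<kappa>\<close>
  variables, and is therefore an instance of a raw term at a valuation of its variables in \<open>V\<close>.
\<close>

lemma sorted_term_raw_instance:
  assumes \<kappa>: "small_regular_cardinal (\<kappa> :: 'u::wellorder)"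
    and Sg: "is_signature \<kappa> (Sg :: ('s, 'f, 'r, 'u) signature)"
    and V: "fst ` V \<subseteq> sorts Sg" and t: "sorted_term Sg V t s"
  obtains \<tau> a where "has_sort \<kappa> Sg \<tau> s" "\<And>v. v \<in> fv \<tau> \<Longrightarrow> a v \<in> V \<and> fst (a v) = fst v"
    "\<And>(M :: ('s, 'f, 'r, 'u) struct) m. eval M (\<lambda>v. m (a v)) \<tau> = eval M m t"
proof -
  have "|fv t| \<le>o |{..<\<kappa>}|"
    using sorted_term_few_variables[OF \<kappa> Sg t] by (rule ordLess_imp_ordLeq)
  then have "\<exists>g. inj_on g (fv t) \<and> g ` fv t \<subseteq> {..<\<kappa>}" by (rule card_of_ordLeq[THEN iffD2])
  then obtain g :: "'s \<times> 'u \<Rightarrow> 'u" where g: "inj_on g (fv t)" "g ` fv t \<subseteq> {..<\<kappa>}" by blast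
  define r where "r v = (fst v, g v)" for v
  define \<tau> where "\<tau> = subst_tm (\<lambda>v. Var (r v)) t"
  define a where "a = inv_into (fv t) r"
  have r: "inj_on r (fv t)" using g(1) by (auto simp: r_def inj_on_def)
  have a_r: "a (r v) = v" if "v \<in> fv t" for v using inv_into_f_f[OF r that] by (simp add: a_def)
  have fvV: "fv t \<subseteq> V" by (rule sorted_term_fv[OF t])
  have "sorted_term Sg (r ` fv t) \<tau> s"
    unfolding \<tau>_def
    by (rule sorted_term_subst[OF sorted_term_mono[OF t subset_refl]])
      (auto intro!: sorted_term.var simp: r_def)
  note \<tau> = this
  show thesis
  proof
    have "r ` fv t \<subseteq> sorts Sg \<times> {..<\<kappa>}" using g(2) fvV V by (auto simp: r_def)
    then show "has_sort \<kappa> Sg \<tau> s" by (rule sorted_term_has_sort[OF \<tau>])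
    show "a v \<in> V \<and> fst (a v) = fst v" if "v \<in> fv \<tau>" for v
    proof -
      have "v \<in> r ` fv t" using that sorted_term_fv[OF \<tau>] by blast
      then obtain w where "w \<in> fv t" "v = r w" by blast
      then show ?thesis using a_r fvV by (auto simp: r_def)
    qed
    show "eval M (\<lambda>v. m (a v)) \<tau> = eval M m t" for M :: "('s, 'f, 'r, 'u) struct" and m
      unfolding \<tau>_def by (rule eval_subst) (simp add: a_r)
  qed
qed


section \<open>Gauges bound the length\<close>

lemma sat_Conj_ran: "sat M m (Conj \<phi>s) \<longleftrightarrow> (\<forall>\<phi>\<in>ran \<phi>s. sat M m \<phi>)"
proof -
  have "ran \<phi>s = (\<lambda>i. the (\<phi>s i)) ` dom \<phi>s" by (force simp: ran_def dom_def)
  then show ?thesis by (simp add: sat_Conj_iff)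
qed

lemma sat_Conj_list:
  fixes \<phi>s :: "('v, 'f, 'r, 'u::wellorder) fm list"
  assumes "universe TYPE('u)"
  shows "sat M m (Conj_list \<phi>s) \<longleftrightarrow> (\<forall>\<phi>\<in>set \<phi>s. sat M m \<phi>)"
proof -
  let ?\<psi> = "map_of (zip (map nat_ord [0..<length \<phi>s] :: 'u list) \<phi>s)"
  have "distinct (map nat_ord [0..<length \<phi>s] :: 'u list)"
    using strict_mono_imp_inj_on[OF nat_ord_strict_mono[OF assms]]
    by (auto simp: distinct_map inj_on_def)
  then have "ran ?\<psi> = set \<phi>s" by (intro ran_map_of_zip) simp_all
  moreover have "sat M m (Conj_list \<phi>s) \<longleftrightarrow> (\<forall>\<phi>\<in>ran ?\<psi>. sat M m \<phi>)"
    unfolding Conj_list_def by (rule sat_Conj_ran)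
  ultimately show ?thesis by simp
qed

lemma sat_gauge_formula:
  fixes G :: "('l, 's, 'f, 'u::wellorder) gauge"
  assumes "universe TYPE('u)"
  shows "sat M m (gauge_formula L G \<tau>) \<longleftrightarrow> (\<forall>t\<in>gset G \<tau>.
    sat M m (subst_fm (subst_list (sctx L (gidx G \<tau> t)) (gtms G \<tau> t)) (sfm L (gidx G \<tau> t))) \<and>
    (\<forall>\<sigma>\<in>set (gtms G \<tau> t). eval M m \<sigma> \<noteq> None))"
proof -
  let ?\<phi> = "\<lambda>t. Conj_list (subst_fm (subst_list (sctx L (gidx G \<tau> t)) (gtms G \<tau> t))
    (sfm L (gidx G \<tau> t)) # map Defined (gtms G \<tau> t))"
  have "ran (\<lambda>t. if t \<in> gset G \<tau> then Some (?\<phi> t) else None) = ?\<phi> ` gset G \<tau>"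
    by (auto simp: ran_def)
  then have "sat M m (gauge_formula L G \<tau>) \<longleftrightarrow> (\<forall>t\<in>gset G \<tau>. sat M m (?\<phi> t))"
    unfolding gauge_formula_def Let_def sat_Conj_ran by simp
  also have "\<dots> \<longleftrightarrow> (\<forall>t\<in>gset G \<tau>.
    sat M m (subst_fm (subst_list (sctx L (gidx G \<tau> t)) (gtms G \<tau> t)) (sfm L (gidx G \<tau> t))) \<and>
    (\<forall>\<sigma>\<in>set (gtms G \<tau> t). eval M m \<sigma> \<noteq> None))"
    unfolding sat_Conj_list[OF assms] by (simp only: list.set image_iff set_map ball_simps sat_Defined)
  finally show ?thesis .
qed

lemma subst_list_mem:
  assumes "list_all2 P \<sigma>s zs" "z \<in> set zs"
  shows "subst_list zs \<sigma>s z \<in> set \<sigma>s" "P (subst_list zs \<sigma>s z) z"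
proof -
  have len: "length \<sigma>s = length zs" using assms(1) by (rule list_all2_lengthD)
  then obtain \<sigma> where \<sigma>: "map_of (zip zs \<sigma>s) z = Some \<sigma>"
    using assms(2) by (metis map_of_zip_is_Some)
  then have "(z, \<sigma>) \<in> set (zip zs \<sigma>s)" by (rule map_of_SomeD)
  then show "subst_list zs \<sigma>s z \<in> set \<sigma>s" "P (subst_list zs \<sigma>s z) z"
    using \<sigma> assms(1) by (auto simp: subst_list_def set_zip list_all2_conv_all_nth)
qed

lemma finite_bound_below:
  fixes \<beta> :: "'b::wellorder"
  assumes "finite S" "\<And>x. x \<in> S \<Longrightarrow> g x < \<beta>" "S = {} \<Longrightarrow> zero_ord < \<beta>"
  obtains b where "b < \<beta>" "\<And>x. x \<in> S \<Longrightarrow> g x \<le> b"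
proof (cases "S = {}")
  case True
  then show thesis using assms(3) that by blast
next
  case False
  show thesis
  proof (rule that)
    show "Max (g ` S) < \<beta>" using assms(1,2) False by simp
    show "g x \<le> Max (g ` S)" if "x \<in> S" for x using assms(1) that by simp
  qed
qed

locale gauged_morphism = scaled_morphism \<kappa> Sg T L A X f
  for \<kappa> :: "'u::wellorder"
    and Sg :: "('s, 'f, 'r, 'u) signature"
    and T :: "('s, 'f, 'r, 'u) sequent set"
    and L :: "('l, 's, 'f, 'r, 'u) scale"
    and A X :: "('s, 'f, 'r, 'u) struct"
    and f :: "'s \<Rightarrow> 'u \<Rightarrow> 'u" +
  fixes G :: "('l, 's, 'f, 'u) gauge"
    and \<rho> :: "('s, 'f, 'u) sterm \<Rightarrow> 'u"
    and \<gamma> :: 'u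
  assumes regular: "small_regular_cardinal \<kappa>"
    and gauge: "is_gauge \<kappa> Sg T L G"
    and rank_less: "raw_term \<kappa> Sg \<tau> \<Longrightarrow> t \<in> gset G \<tau> \<Longrightarrow> \<sigma> \<in> set (gtms G \<tau> t) \<Longrightarrow> \<rho> \<sigma> < \<rho> \<tau>"
    and rank_nullary: "raw_term \<kappa> Sg \<tau> \<Longrightarrow> t \<in> gset G \<tau> \<Longrightarrow> gtms G \<tau> t = [] \<Longrightarrow> zero_ord < \<rho> \<tau>"
    and rank_bound: "raw_term \<kappa> Sg \<tau> \<Longrightarrow> \<rho> \<tau> < \<gamma>"
    and bound_nullary: "l \<in> idx L \<Longrightarrow> sctx L l = [] \<Longrightarrow> zero_ord < \<gamma>"
begin

lemma gauge_term:
  assumes "raw_term \<kappa> Sg \<tau>" "t \<in> gset G \<tau>"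
  shows "gidx G \<tau> t \<in> idx L"
    "list_all2 (\<lambda>\<sigma> z. has_sort \<kappa> Sg \<sigma> (fst z)) (gtms G \<tau> t) (sctx L (gidx G \<tau> t))"
    "\<And>\<sigma>. \<sigma> \<in> set (gtms G \<tau> t) \<Longrightarrow> fv \<sigma> \<subseteq> fv \<tau> \<and> raw_term \<kappa> Sg \<sigma>"
proof -
  have *: "gidx G \<tau> t \<in> idx L \<and>
      list_all2 (\<lambda>\<sigma> z. has_sort \<kappa> Sg \<sigma> (fst z)) (gtms G \<tau> t) (sctx L (gidx G \<tau> t)) \<and>
      (\<forall>\<sigma>\<in>set (gtms G \<tau> t). fv \<sigma> \<subseteq> fv \<tau> \<and> sharp G \<sigma> < sharp G \<tau>)"
    using gauge assms unfolding is_gauge_def by blast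
  then show "gidx G \<tau> t \<in> idx L"
    "list_all2 (\<lambda>\<sigma> z. has_sort \<kappa> Sg \<sigma> (fst z)) (gtms G \<tau> t) (sctx L (gidx G \<tau> t))" by blast+
  fix \<sigma> assume \<sigma>: "\<sigma> \<in> set (gtms G \<tau> t)"
  then have "raw_term \<kappa> Sg \<sigma>"
    using * by (fastforce simp: raw_term_def list_all2_conv_all_nth in_set_conv_nth)
  then show "fv \<sigma> \<subseteq> fv \<tau> \<and> raw_term \<kappa> Sg \<sigma>" using * \<sigma> by blast
qed

lemma gauge_sat_iff:
  assumes \<tau>: "raw_term \<kappa> Sg \<tau>" and M: "M \<in> models Sg T"
    and n: "n \<in> (\<Pi>\<^sub>E v\<in>fv \<tau>. car M (fst v))"
  shows "eval M n \<tau> \<noteq> None \<longleftrightarrow> sat M n (gauge_formula L G \<tau>)"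
proof -
  have "derivable Sg T (fv \<tau>, Defined \<tau>, gauge_formula L G \<tau>)"
    "derivable Sg T (fv \<tau>, gauge_formula L G \<tau>, Defined \<tau>)"
    using gauge \<tau> unfolding is_gauge_def by blast+
  then have "interp M (fv \<tau>) (Defined \<tau>) = interp M (fv \<tau>) (gauge_formula L G \<tau>)"
    using M by (simp add: derivable_def set_eq_subset)
  then have "sat M n (Defined \<tau>) \<longleftrightarrow> sat M n (gauge_formula L G \<tau>)"
    using n unfolding interp_def by blast
  then show ?thesis by (simp only: sat_Defined)
qed

text \<open>
  A term that is defined in \<open>X\<close> is defined from the stage of its rank on: the terms that the gauge
  attaches to it are defined earlier, since their ranks are smaller, and the conditions on them that
  hold in \<open>X\<close> are forced one stage later. As the contexts of a scale are finite, one earlier stage does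
  for all terms of one condition.
\<close>

lemma defined_from_rank:
  assumes "raw_term \<kappa> Sg \<tau>" "\<And>v. v \<in> fv \<tau> \<Longrightarrow> a v \<in> elements \<and> fst (a v) = fst v"
    and "eval X (\<lambda>v. target_val (a v)) \<tau> \<noteq> None" "\<rho> \<tau> \<le> \<beta>" "(Y, m) \<in> stage_solutions \<beta>"
  shows "eval Y (\<lambda>v. m (a v)) \<tau> \<noteq> None"
  using assms
proof (induction "\<rho> \<tau>" arbitrary: \<tau> \<beta> Y m rule: less_induct)
  case less
  note \<tau> = less.prems(1) and a = less.prems(2)
  \<comment> \<open>Sequents are interpreted at valuations that are extensional on their context.\<close>
  define n where "n k = (\<lambda>v\<in>fv \<tau>. k (a v))" for k :: "'s \<times> 'u \<Rightarrow> 'u"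
  have n_eval: "eval M (n k) \<sigma> = eval M (\<lambda>v. k (a v)) \<sigma>" if "fv \<sigma> \<subseteq> fv \<tau>"
    for M :: "('s, 'f, 'r, 'u) struct" and k \<sigma>
    using that by (intro eval_cong) (auto simp: n_def)
  have n_PiE: "n k \<in> (\<Pi>\<^sub>E v\<in>fv \<tau>. car M (fst v))" if "k \<in> (\<Pi>\<^sub>E v\<in>elements. car M (fst v))"
    for M :: "('s, 'f, 'r, 'u) struct" and k
    using a PiE_mem[OF that] by (fastforce simp: n_def)
  have Y: "Y \<in> models Sg T" "m \<in> (\<Pi>\<^sub>E v\<in>elements. car Y (fst v))" "\<And>\<phi>. \<phi> \<in> stage \<beta> \<Longrightarrow> sat Y m \<phi>"
    using less.prems(5) by (auto simp: solutions_def)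
  have "eval X (n target_val) \<tau> \<noteq> None" using less.prems(3) n_eval[OF subset_refl] by simp
  then have satX: "sat X (n target_val) (gauge_formula L G \<tau>)"
    using gauge_sat_iff[OF \<tau> target n_PiE[OF target_val_PiE]] by simp
  have "sat Y (n m) (subst_fm (subst_list (sctx L (gidx G \<tau> t)) (gtms G \<tau> t)) (sfm L (gidx G \<tau> t))) \<and>
      (\<forall>\<sigma>\<in>set (gtms G \<tau> t). eval Y (n m) \<sigma> \<noteq> None)" if t: "t \<in> gset G \<tau>" for t
  proof -
    let ?l = "gidx G \<tau> t"
    let ?\<theta> = "subst_list (sctx L ?l) (gtms G \<tau> t)"
    note gt = gauge_term[OF \<tau> t]
    have X_formula: "sat X (n target_val) (subst_fm ?\<theta> (sfm L ?l))"
      and X_terms: "\<And>\<sigma>. \<sigma> \<in> set (gtms G \<tau> t) \<Longrightarrow> eval X (n target_val) \<sigma> \<noteq> None"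
      using satX t unfolding sat_gauge_formula[OF universe] by blast+
    obtain b where b: "b < \<beta>" "\<And>\<sigma>. \<sigma> \<in> set (gtms G \<tau> t) \<Longrightarrow> \<rho> \<sigma> \<le> b"
    proof (rule finite_bound_below[of "set (gtms G \<tau> t)" \<rho> \<beta>])
      show "\<rho> \<sigma> < \<beta>" if "\<sigma> \<in> set (gtms G \<tau> t)" for \<sigma>
        using rank_less[OF \<tau> t that] less.prems(4) by (rule less_le_trans)
      show "zero_ord < \<beta>" if "set (gtms G \<tau> t) = {}"
        using rank_nullary[OF \<tau> t] that less.prems(4) by (auto intro: less_le_trans)
    qed auto
    have defined: "eval N (\<lambda>v. k (a v)) \<sigma> \<noteq> None"
      if \<sigma>: "\<sigma> \<in> set (gtms G \<tau> t)" and N: "(N, k) \<in> stage_solutions b" for \<sigma> N k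
    proof (rule less.hyps[OF rank_less[OF \<tau> t \<sigma>] _ _ _ b(2)[OF \<sigma>] N])
      show "raw_term \<kappa> Sg \<sigma>" using gt(3)[OF \<sigma>] by blast
      show "a v \<in> elements \<and> fst (a v) = fst v" if "v \<in> fv \<sigma>" for v
        using a gt(3)[OF \<sigma>] that by blast
      show "eval X (\<lambda>v. target_val (a v)) \<sigma> \<noteq> None"
        using X_terms[OF \<sigma>] n_eval gt(3)[OF \<sigma>] by simp
    qed
    have Yb: "(Y, m) \<in> stage_solutions b"
      by (rule subsetD[OF stage_solutions_antimono[OF less_imp_le[OF b(1)]] less.prems(5)])
    have Y_terms: "eval Y (n m) \<sigma> \<noteq> None" if "\<sigma> \<in> set (gtms G \<tau> t)" for \<sigma>
      using defined[OF that Yb] n_eval gt(3)[OF that] by simp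
    \<comment> \<open>the terms of the condition, with elements of \<open>A\<close> put for the variables of the raw term\<close>
    define \<theta>' where "\<theta>' z = subst_tm (\<lambda>v. Var (a v)) (?\<theta> z)" for z
    have \<theta>: "?\<theta> z \<in> set (gtms G \<tau> t)" "has_sort \<kappa> Sg (?\<theta> z) (fst z)" if "z \<in> scale_vars ?l" for z
      using subst_list_mem[OF gt(2) that] by blast+
    have \<theta>'_eval: "eval M k (\<theta>' z) = eval M (\<lambda>v. k (a v)) (?\<theta> z)"
      for M :: "('s, 'f, 'r, 'u) struct" and k z
      unfolding \<theta>'_def by (rule eval_subst) simp
    have \<theta>'_sat: "sat M k (subst_fm \<theta>' (sfm L ?l)) \<longleftrightarrow> sat M (n k) (subst_fm ?\<theta> (sfm L ?l))"
      if def: "\<And>\<sigma>. \<sigma> \<in> set (gtms G \<tau> t) \<Longrightarrow> eval M (n k) \<sigma> \<noteq> None"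
      for M :: "('s, 'f, 'r, 'u) struct" and k
    proof -
      define w where "w z = the (eval M (n k) (?\<theta> z))" for z
      have w: "eval M (n k) (?\<theta> z) = Some (w z)" "eval M k (\<theta>' z) = Some (w z)"
        if "z \<in> fvs (sfm L ?l)" for z
      proof -
        have mem: "?\<theta> z \<in> set (gtms G \<tau> t)" using \<theta>(1) scale_fvs[OF gt(1)] that by blast
        show "eval M (n k) (?\<theta> z) = Some (w z)" using def[OF mem] by (auto simp: w_def)
        then show "eval M k (\<theta>' z) = Some (w z)"
          using n_eval[of "?\<theta> z" M k] gt(3)[OF mem] by (simp add: \<theta>'_eval)
      qed
      have "sat M k (subst_fm \<theta>' (sfm L ?l)) \<longleftrightarrow> sat M w (sfm L ?l)"
        by (rule sat_subst) (rule w(2))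
      also have "\<dots> \<longleftrightarrow> sat M (n k) (subst_fm ?\<theta> (sfm L ?l))"
        by (rule sat_subst[symmetric]) (rule w(1))
      finally show ?thesis .
    qed
    have "subst_fm \<theta>' (sfm L ?l) \<in> forced (stage b)"
    proof (rule forcedI[OF gt(1)])
      fix z assume z: "z \<in> scale_vars ?l"
      show "sorted_term Sg elements (\<theta>' z) (fst z)"
        unfolding \<theta>'_def
      proof (rule sorted_term_subst[OF has_sort_sorted_term[OF \<theta>(2)[OF z]]])
        fix v assume "v \<in> fv (?\<theta> z)"
        then have "v \<in> fv \<tau>" using gt(3)[OF \<theta>(1)[OF z]] by blast
        then show "sorted_term Sg elements (Var (a v)) (fst v)"
          using a[of v] by (intro sorted_term.var) simp_all
      qed
      show "eval N k (\<theta>' z) \<noteq> None" if "(N, k) \<in> stage_solutions b" for N k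
        unfolding \<theta>'_eval by (rule defined[OF \<theta>(1)[OF z] that])
    next
      show "sat X target_val (subst_fm \<theta>' (sfm L ?l))"
        using \<theta>'_sat[OF X_terms] X_formula by simp
    qed
    from Y(3)[OF stage_forced[OF b(1) this]]
    have "sat Y (n m) (subst_fm ?\<theta> (sfm L ?l))" using \<theta>'_sat[OF Y_terms] by simp
    then show ?thesis using Y_terms by blast
  qed
  then have "sat Y (n m) (gauge_formula L G \<tau>)" unfolding sat_gauge_formula[OF universe] by blast
  then have "eval Y (n m) \<tau> \<noteq> None" using gauge_sat_iff[OF \<tau> Y(1) n_PiE[OF Y(2)]] by simp
  then show ?case using n_eval[OF subset_refl] by simp
qed

lemma term_defined_below_bound:
  assumes t: "sorted_term Sg elements t s" and X: "eval X target_val t \<noteq> None"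
  obtains b where "b < \<gamma>" "\<And>\<beta> Y m. b \<le> \<beta> \<Longrightarrow> (Y, m) \<in> stage_solutions \<beta> \<Longrightarrow> eval Y m t \<noteq> None"
proof -
  obtain \<tau> a where \<tau>: "has_sort \<kappa> Sg \<tau> s"
    and a: "\<And>v. v \<in> fv \<tau> \<Longrightarrow> a v \<in> elements \<and> fst (a v) = fst v"
    and ev: "\<And>(M :: ('s, 'f, 'r, 'u) struct) m. eval M (\<lambda>v. m (a v)) \<tau> = eval M m t"
    using sorted_term_raw_instance[OF regular signature elements_sorts t] by blast
  have raw: "raw_term \<kappa> Sg \<tau>" using \<tau> by (auto simp: raw_term_def)
  show thesis
  proof (rule that[OF rank_bound[OF raw]])
    fix \<beta> Y m assume "\<rho> \<tau> \<le> \<beta>" "(Y, m) \<in> stage_solutions \<beta>"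
    from defined_from_rank[OF raw a _ this] X show "eval Y m t \<noteq> None" by (simp add: ev)
  qed
qed

text \<open>
  The members of a tuple in the stage \<open>\<beta>\<close> are values of terms in the elements of \<open>A\<close>. Their images in \<open>X\<close>
  show that these terms are defined in \<open>X\<close>, and hence in one common stage below \<open>\<gamma>\<close>. If the image
  of the tuple satisfies the formula, the formula is thus a relation of the stage \<open>\<gamma>\<close>.
\<close>

lemma cocone_reflects_scale:
  assumes "\<gamma> \<le> \<beta>"
  shows "reflects_scale (obj \<beta>) (cocone_map \<beta>) X"
  unfolding reflects_scale_def
proof (intro ballI impI)
  fix l u
  assume l: "l \<in> idx L" and u: "u \<in> tuples_of (obj \<beta>) l"
    and sat: "sat X (map_val (scale_vars l) (cocone_map \<beta>) u) (sfm L l)"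
  have "\<exists>t. sorted_term Sg elements t (fst z) \<and> eval (obj \<beta>) (gens \<beta>) t = Some (u z)"
    if "z \<in> scale_vars l" for z
    using presents_generated[OF obj_presents, of "u z" \<beta> "fst z"] PiE_mem[OF u that] by blast
  then obtain \<theta> where \<theta>: "\<And>z. z \<in> scale_vars l \<Longrightarrow> sorted_term Sg elements (\<theta> z) (fst z)"
    "\<And>z. z \<in> scale_vars l \<Longrightarrow> eval (obj \<beta>) (gens \<beta>) (\<theta> z) = Some (u z)" by metis
  have \<theta>X: "eval X target_val (\<theta> z) = Some (map_val (scale_vars l) (cocone_map \<beta>) u z)"
    if "z \<in> scale_vars l" for z
    using homs_eval_map_val[OF obj_structure cocone_map(1) \<theta>(1)[OF that] gens_Pi \<theta>(2)[OF that]]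
    by (simp add: cocone_map(2) map_val_apply[OF that])
  have "\<exists>b. b < \<gamma> \<and> (\<forall>\<beta> Y m. b \<le> \<beta> \<longrightarrow> (Y, m) \<in> stage_solutions \<beta> \<longrightarrow> eval Y m (\<theta> z) \<noteq> None)"
    if "z \<in> scale_vars l" for z
    using term_defined_below_bound[OF \<theta>(1)[OF that]] \<theta>X[OF that] by (metis option.distinct(1))
  then obtain g where g: "\<And>z. z \<in> scale_vars l \<Longrightarrow> g z < \<gamma>"
    "\<And>z \<beta> Y m. z \<in> scale_vars l \<Longrightarrow> g z \<le> \<beta> \<Longrightarrow> (Y, m) \<in> stage_solutions \<beta> \<Longrightarrow> eval Y m (\<theta> z) \<noteq> None"
    by metis
  obtain b where b: "b < \<gamma>" "\<And>z. z \<in> scale_vars l \<Longrightarrow> g z \<le> b"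
    by (rule finite_bound_below[of "scale_vars l" g \<gamma>]) (use g(1) bound_nullary[OF l] in auto)
  have "subst_fm \<theta> (sfm L l) \<in> forced (stage b)"
  proof (rule forcedI[OF l \<theta>(1)])
    show "eval Y m (\<theta> z) \<noteq> None" if "(Y, m) \<in> stage_solutions b" "z \<in> scale_vars l" for Y m z
      by (rule g(2)[OF that(2) b(2)[OF that(2)] that(1)])
    have "sat X target_val (subst_fm \<theta> (sfm L l)) \<longleftrightarrow>
        sat X (map_val (scale_vars l) (cocone_map \<beta>) u) (sfm L l)"
      by (rule sat_subst) (use \<theta>X scale_fvs[OF l] in blast)
    then show "sat X target_val (subst_fm \<theta> (sfm L l))" using sat by simp
  qed
  then have "subst_fm \<theta> (sfm L l) \<in> stage \<beta>" using b(1) assms by (intro stage_forced) auto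
  then have "sat (obj \<beta>) (gens \<beta>) (subst_fm \<theta> (sfm L l))"
    using obj_solution[of \<beta>] by (simp add: solutions_def)
  moreover have "sat (obj \<beta>) (gens \<beta>) (subst_fm \<theta> (sfm L l)) \<longleftrightarrow> sat (obj \<beta>) u (sfm L l)"
    by (rule sat_subst) (use \<theta>(2) scale_fvs[OF l] in blast)
  ultimately show "sat (obj \<beta>) u (sfm L l)" by simp
qed

lemma decomposition_exists:
  "\<exists>B b p. decomposition (PMod Sg T) regular_epis (A, f, X) B b p \<and>
    decomposition_length (PMod Sg T) regular_epis p \<le> \<gamma>"
proof -
  have orth: "\<forall>\<beta>\<ge>\<gamma>. \<forall>e\<in>regular_epis. orthogonal (PMod Sg T) e (cocone_arrow \<beta>)"
    using reflects_scale_orthogonal[OF obj_model target cocone_map(1) cocone_reflects_scale] by blast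
  then have "decomposition (PMod Sg T) regular_epis (A, f, X) obj stage_arrow cocone_arrow"
    using stages_predecomposition unfolding decomposition_def by blast
  moreover have "decomposition_length (PMod Sg T) regular_epis cocone_arrow \<le> \<gamma>"
    unfolding decomposition_length_def by (rule Least_le) (rule orth)
  ultimately show ?thesis by blast
qed

end

lemma delta_le:
  fixes \<gamma> :: "'u::wellorder"
  assumes "decomposition C E f A a p" "decomposition_length C E p \<le> \<gamma>"
  shows "\<exists>d\<le>\<gamma>. delta_eq C E f d"
proof -
  let ?lengths = "{decomposition_length C E p | A a (p :: 'u \<Rightarrow> _). decomposition C E f A a p}"
  let ?d = "LEAST d. d \<in> ?lengths"
  have mem: "decomposition_length C E p \<in> ?lengths" using assms(1) by blast
  then have "?d \<in> ?lengths" by (rule LeastI)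
  moreover have "\<forall>l\<in>?lengths. ?d \<le> l" using Least_le[of "\<lambda>d. d \<in> ?lengths"] by blast
  ultimately have "delta_eq C E f ?d" unfolding delta_eq_def Let_def by blast
  moreover have "?d \<le> \<gamma>" using Least_le[of "\<lambda>d. d \<in> ?lengths", OF mem] assms(2) by (rule order_trans)
  ultimately show ?thesis by blast
qed

lemma Delta_le:
  fixes d :: "'u::wellorder"
  assumes "\<And>f. f \<in> Ar C \<Longrightarrow> \<exists>l. delta_eq C E f l \<and> l < d"
  shows "\<exists>d'\<le>d. Delta_eq C E d'"
proof -
  let ?bound = "\<lambda>b :: 'u. \<forall>f\<in>Ar C. \<exists>l. delta_eq C E f l \<and> l < b"
  have "?bound d" using assms by blast
  then have "?bound (LEAST b. ?bound b)" "(LEAST b. ?bound b) \<le> d"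
    by (rule LeastI) (rule Least_le, fact)
  moreover have "\<forall>b. ?bound b \<longrightarrow> (LEAST b. ?bound b) \<le> b" by (intro allI impI Least_le)
  ultimately show ?thesis unfolding Delta_eq_def Let_def by blast
qed

text \<open>
  This is \<open>x \<mapsto> 1 + x\<close>. It makes all ranks positive, and preserves the bound \<open>\<gamma>\<close> if \<open>\<gamma>\<close> is infinite.
\<close>

definition one_plus :: "'u::wellorder \<Rightarrow> 'u" where
  "one_plus x = (if finite {..<x} then suc_ord x else x)"

lemma finite_lessThan_suc_ord:
  assumes "universe TYPE('u::wellorder)" "finite {..<x :: 'u}"
  shows "finite {..<suc_ord x}"
proof -
  have "{..<suc_ord x} \<subseteq> insert x {..<x}"
    using suc_ord_le[of x] by (force simp: not_less[symmetric])
  then show ?thesis using assms(2) finite_subset by blast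
qed

lemma one_plus_pos:
  assumes "universe TYPE('u::wellorder)"
  shows "zero_ord < one_plus (x :: 'u)"
proof (cases "finite {..<x}")
  case True
  then show ?thesis
    using le_less_trans[OF zero_ord_le less_suc_ord[OF assms]] by (simp add: one_plus_def)
next
  case False
  then have "{..<x} \<noteq> {}" by auto
  then show ?thesis using False le_less_trans[OF zero_ord_le] by (auto simp: one_plus_def)
qed

lemma one_plus_less:
  assumes U: "universe TYPE('u::wellorder)" and "(x :: 'u) < y"
  shows "one_plus x < one_plus y"
proof (cases "finite {..<x}")
  case True
  show ?thesis
  proof (cases "finite {..<y}")
    case y: True
    have "suc_ord x < suc_ord y" using suc_ord_le[OF assms(2)] less_suc_ord[OF U] by (rule le_less_trans)
    then show ?thesis using True y by (simp add: one_plus_def)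
  next
    case False
    have "suc_ord x \<noteq> y" using finite_lessThan_suc_ord[OF U True] False by auto
    then have "suc_ord x < y" using suc_ord_le[OF assms(2)] by simp
    then show ?thesis using True False by (simp add: one_plus_def)
  qed
next
  case False
  have "{..<x} \<subseteq> {..<y}" using assms(2) by auto
  with False have "infinite {..<y}" using finite_subset by blast
  then show ?thesis using False assms(2) by (simp add: one_plus_def)
qed

theorem theorem4p11:
  fixes \<kappa> \<gamma> :: "'u::wellorder"
    and Sg :: "('s, 'f, 'r, 'u) signature"
    and T :: "('s, 'f, 'r, 'u) sequent set"
    and L :: "('l, 's, 'f, 'r, 'u) scale"
    and G :: "('l, 's, 'f, 'u) gauge"
  assumes "universe TYPE('u)"
    and "small_regular_cardinal \<kappa>"
    and "is_signature \<kappa> Sg"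
    and "horn_theory \<kappa> Sg T"
    and "is_scale \<kappa> Sg L"
    and "is_gauge \<kappa> Sg T L G"
    and "\<And>\<tau>. raw_term \<kappa> Sg \<tau> \<Longrightarrow> sharp G \<tau> < \<gamma>"
    and nullary_pos: "\<And>l. l \<in> idx L \<Longrightarrow> sctx L l = [] \<Longrightarrow> zero_ord < \<gamma>"
    and nullary_sharp: "\<And>\<tau> t. finite {..<\<gamma>} \<Longrightarrow> raw_term \<kappa> Sg \<tau> \<Longrightarrow> t \<in> gset G \<tau> \<Longrightarrow>
           sctx L (gidx G \<tau> t) = [] \<Longrightarrow> zero_ord < sharp G \<tau>"
  shows "(\<forall>f\<in>Ar (PMod Sg T). \<exists>d\<le>\<gamma>. delta_eq (PMod Sg T) (Reg (PMod Sg T) (scale_epis Sg T L)) f d) \<and>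
         (\<exists>d\<le>suc_ord \<gamma>. Delta_eq (PMod Sg T) (Reg (PMod Sg T) (scale_epis Sg T L)) d)"
proof -
  note U = assms(1)
  \<comment> \<open>Ranks have to be positive where an empty context occurs, so that some stage lies below.\<close>
  define \<rho> where "\<rho> \<tau> = (if finite {..<\<gamma>} then sharp G \<tau> else one_plus (sharp G \<tau>))" for \<tau>
  have sharp_less: "sharp G \<sigma> < sharp G \<tau>"
    if "raw_term \<kappa> Sg \<tau>" "t \<in> gset G \<tau>" "\<sigma> \<in> set (gtms G \<tau> t)" for \<sigma> \<tau> t
    using assms(6) that unfolding is_gauge_def by blast
  have rank_less: "\<rho> \<sigma> < \<rho> \<tau>"
    if "raw_term \<kappa> Sg \<tau>" "t \<in> gset G \<tau>" "\<sigma> \<in> set (gtms G \<tau> t)" for \<sigma> \<tau> t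
    using sharp_less[OF that] one_plus_less[OF U] by (simp add: \<rho>_def)
  have rank_nullary: "zero_ord < \<rho> \<tau>"
    if "raw_term \<kappa> Sg \<tau>" "t \<in> gset G \<tau>" "gtms G \<tau> t = []" for \<tau> t
  proof -
    have "list_all2 (\<lambda>\<sigma> z. has_sort \<kappa> Sg \<sigma> (fst z)) (gtms G \<tau> t) (sctx L (gidx G \<tau> t))"
      using assms(6) that(1,2) unfolding is_gauge_def by blast
    then have "sctx L (gidx G \<tau> t) = []" using that(3) by simp
    then show ?thesis using nullary_sharp[OF _ that(1,2)] one_plus_pos[OF U] by (simp add: \<rho>_def)
  qed
  have rank_bound: "\<rho> \<tau> < \<gamma>" if "raw_term \<kappa> Sg \<tau>" for \<tau>
  proof (cases "finite {..<\<gamma>}")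
    case True
    then show ?thesis using assms(7)[OF that] by (simp add: \<rho>_def)
  next
    case False
    then have "one_plus \<gamma> = \<gamma>" by (simp add: one_plus_def)
    then show ?thesis using False one_plus_less[OF U assms(7)[OF that]] by (simp add: \<rho>_def)
  qed
  have delta: "\<exists>d\<le>\<gamma>. delta_eq (PMod Sg T) (Reg (PMod Sg T) (scale_epis Sg T L)) f d"
    if f: "f \<in> Ar (PMod Sg T)" for f
  proof -
    obtain A h X where f_eq: "f = (A, h, X)" and mods: "A \<in> models Sg T" "X \<in> models Sg T" "h \<in> homs Sg A X"
      using f by (rule PMod_ArE)
    interpret gauged_morphism \<kappa> Sg T L A X h G \<rho> \<gamma>
      by unfold_locales (fact U assms(2-6) mods rank_less rank_nullary rank_bound nullary_pos)+
    from decomposition_exists show ?thesis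
      unfolding f_eq by (elim exE conjE) (rule delta_le)
  qed
  have "\<exists>l. delta_eq (PMod Sg T) (Reg (PMod Sg T) (scale_epis Sg T L)) f l \<and> l < suc_ord \<gamma>"
    if "f \<in> Ar (PMod Sg T)" for f
    using delta[OF that] less_suc_ord[OF U, of \<gamma>] by (blast intro: le_less_trans)
  then have "\<exists>d\<le>suc_ord \<gamma>. Delta_eq (PMod Sg T) (Reg (PMod Sg T) (scale_epis Sg T L)) d"
    by (rule Delta_le)
  with delta show ?thesis by blast
qed

end
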